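(* Let $d\in\{2,3\}$ and $\lambda>0$. If $k\in\mathbb{N}$ and $u_0\in H^m(\mathbb{T}^d)$ with $m>\frac d2+4k$, then there exist $T>0$ and a classical solution $u$ of the Kuramoto-Sivashinsky equation $$\partial_tu+(u\cdot\nabla)u+\lambda\Delta u+\Delta^2u=0\quad\text{in }\mathbb{T}^d\times[0,T]$$ such that $u\in H^k(\mathbb{T}^d\times[0,T])$ and $u(t=0)=u_0$.
   Context: $\mathbb{T}^d=\mathbb{R}^d/(2\pi\mathbb{Z}^d)$; $u:\mathbb{T}^d\times[0,T]\to\mathbb{R}^d$ is vector valued and not assumed divergence free; $H^k(\mathbb{T}^d\times[0,T])$ is the space-time Sobolev space of order $k$. *)

theory Defs
  imports "HOL-Analysis.Analysis"
begin

text \<open>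
  Functions on the torus \<open>T^d = R^d / (2 pi Z^d)\<close> are functions on \<open>R^d\<close> that are \<open>2 pi\<close>-periodic in
  every coordinate; functions on \<open>T^d \<times> [0,T]\<close> are functions of \<open>(x, t)\<close> that are periodic in \<open>x\<close>.
  Integrals over the torus are taken over the period cell.
\<close>

definition torus_periodic :: "(real^'d \<Rightarrow> 'b) \<Rightarrow> bool" where
  "torus_periodic f \<longleftrightarrow> (\<forall>x i. f (x + axis i (2 * pi)) = f x)"

definition torus_cell :: "(real^'d) set" where
  "torus_cell = cbox 0 (\<chi> i. 2 * pi)"

definition L2_on :: "'a::euclidean_space set \<Rightarrow> ('a \<Rightarrow> 'b::euclidean_space) \<Rightarrow> bool" where
  "L2_on A f \<longleftrightarrow> set_borel_measurable lebesgue A f \<and>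
     set_integrable lebesgue A (\<lambda>p. (norm (f p))\<^sup>2)"


section \<open>The Sobolev space of real order on the torus\<close>

definition of_int_vec :: "int^'d \<Rightarrow> real^'d" where
  "of_int_vec n = (\<chi> i. real_of_int (n $ i))"

definition fourier_coeff :: "(real^'d \<Rightarrow> real) \<Rightarrow> int^'d \<Rightarrow> complex" where
  "fourier_coeff f n =
     (LINT x:torus_cell|lebesgue. f x *\<^sub>R cis (- (of_int_vec n \<bullet> x))) / of_real ((2 * pi) ^ CARD('d))"

text \<open>For real order \<open>m \<ge> 0\<close> and vector-valued functions.\<close>

definition sobolev_torus :: "real \<Rightarrow> (real^'d \<Rightarrow> real^'n) \<Rightarrow> bool" where
  "sobolev_torus m f \<longleftrightarrow> torus_periodic f \<and> L2_on torus_cell f \<and>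
     (\<forall>i. (\<lambda>n. (1 + (norm (of_int_vec n))\<^sup>2) powr m * (cmod (fourier_coeff (\<lambda>x. f x $ i) n))\<^sup>2)
            summable_on UNIV)"


section \<open>Iterated partial derivatives\<close>

text \<open>
  The derivative in direction \<open>v\<close> is taken relative to \<open>S\<close>: with \<open>S = UNIV \<times> {0..T}\<close> the time
  derivative is one-sided at \<open>t = 0\<close> and \<open>t = T\<close>, and spatial derivatives are the usual ones.
\<close>

definition pd :: "'a::real_normed_vector set \<Rightarrow> 'a \<Rightarrow> ('a \<Rightarrow> 'b::real_normed_vector) \<Rightarrow> 'a \<Rightarrow> 'b" where
  "pd S v f p = vector_derivative (\<lambda>s. f (p + s *\<^sub>R v)) (at 0 within {s. p + s *\<^sub>R v \<in> S})"

definition pd_exists :: "'a::real_normed_vector set \<Rightarrow> 'a \<Rightarrow> ('a \<Rightarrow> 'b::real_normed_vector) \<Rightarrow> bool" where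
  "pd_exists S v f \<longleftrightarrow>
     (\<forall>p\<in>S. (\<lambda>s. f (p + s *\<^sub>R v)) differentiable (at 0 within {s. p + s *\<^sub>R v \<in> S}))"

text \<open>A list of directions plays the role of a multi-index; its length is the order.\<close>

fun pds :: "'a::real_normed_vector set \<Rightarrow> 'a list \<Rightarrow> ('a \<Rightarrow> 'b::real_normed_vector) \<Rightarrow> 'a \<Rightarrow> 'b" where
  "pds S [] f = f"
| "pds S (v # vs) f = pd S v (pds S vs f)"

text \<open>The iterated derivative along the list exists, and all derivatives formed on the way are continuous.\<close>

fun C_along :: "'a::real_normed_vector set \<Rightarrow> 'a list \<Rightarrow> ('a \<Rightarrow> 'b::real_normed_vector) \<Rightarrow> bool" where
  "C_along S [] f \<longleftrightarrow> continuous_on S f"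
| "C_along S (v # vs) f \<longleftrightarrow> C_along S vs f \<and> pd_exists S v (pds S vs f) \<and>
     continuous_on S (pds S (v # vs) f)"

definition C_infinity :: "('a::euclidean_space \<Rightarrow> real) \<Rightarrow> bool" where
  "C_infinity f \<longleftrightarrow> (\<forall>vs. set vs \<subseteq> Basis \<longrightarrow> C_along UNIV vs f)"


section \<open>The space-time Sobolev space of integer order\<close>

text \<open>Smooth functions on \<open>T^d \<times> R\<close> with compact support in \<open>T^d \<times> (0,T)\<close>.\<close>

definition test_function :: "real \<Rightarrow> ((real^'d) \<times> real \<Rightarrow> real) \<Rightarrow> bool" where
  "test_function T \<phi> \<longleftrightarrow> C_infinity \<phi> \<and> (\<forall>t. torus_periodic (\<lambda>x. \<phi> (x, t))) \<and>
     (\<exists>a b. 0 < a \<and> b < T \<and> (\<forall>x t. t \<notin> {a..b} \<longrightarrow> \<phi> (x, t) = 0))"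

definition weak_pds ::
  "real \<Rightarrow> ((real^'d) \<times> real) list \<Rightarrow> ((real^'d) \<times> real \<Rightarrow> real^'n) \<Rightarrow> ((real^'d) \<times> real \<Rightarrow> real^'n) \<Rightarrow> bool" where
  "weak_pds T vs f g \<longleftrightarrow> (\<forall>\<phi>. test_function T \<phi> \<longrightarrow>
     (LINT p:torus_cell \<times> {0..T}|lebesgue. pds UNIV vs \<phi> p *\<^sub>R f p) =
     (-1) ^ length vs *\<^sub>R (LINT p:torus_cell \<times> {0..T}|lebesgue. \<phi> p *\<^sub>R g p))"

text \<open>
  \<open>Basis\<close> of \<open>(real^'d) \<times> real\<close> consists of the \<open>d\<close> spatial unit vectors and the time unit vector. The
  case of the empty list gives square integrability of \<open>f\<close> itself.
\<close>

definition sobolev_spacetime :: "nat \<Rightarrow> real \<Rightarrow> ((real^'d) \<times> real \<Rightarrow> real^'n) \<Rightarrow> bool" where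
  "sobolev_spacetime k T f \<longleftrightarrow>
     (\<forall>t\<in>{0..T}. torus_periodic (\<lambda>x. f (x, t))) \<and>
     L2_on (torus_cell \<times> {0..T}) f \<and>
     (\<forall>vs. set vs \<subseteq> Basis \<and> length vs \<le> k \<longrightarrow>
        (\<exists>g. L2_on (torus_cell \<times> {0..T}) g \<and> weak_pds T vs f g))"


section \<open>Classical solutions of the Kuramoto-Sivashinsky equation\<close>

definition dt :: "real \<Rightarrow> ((real^'d) \<times> real \<Rightarrow> real^'n) \<Rightarrow> (real^'d) \<times> real \<Rightarrow> real^'n" where
  "dt T = pd (UNIV \<times> {0..T}) (0, 1)"

definition dx :: "real \<Rightarrow> 'd \<Rightarrow> ((real^'d) \<times> real \<Rightarrow> real^'n) \<Rightarrow> (real^'d) \<times> real \<Rightarrow> real^'n" where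
  "dx T i = pd (UNIV \<times> {0..T}) (axis i 1, 0)"

definition laplacian :: "real \<Rightarrow> ((real^'d) \<times> real \<Rightarrow> real^'n) \<Rightarrow> (real^'d) \<times> real \<Rightarrow> real^'n" where
  "laplacian T u p = (\<Sum>i\<in>UNIV. dx T i (dx T i u) p)"

definition advection :: "real \<Rightarrow> ((real^'d) \<times> real \<Rightarrow> real^'d) \<Rightarrow> (real^'d) \<times> real \<Rightarrow> real^'d" where
  "advection T u p = (\<Sum>i\<in>UNIV. (u p $ i) *\<^sub>R dx T i u p)"

text \<open>
  The time derivative and all spatial derivatives up to order four exist and are continuous on
  \<open>T^d \<times> [0,T]\<close>, and the equation holds at every point, including \<open>t = 0\<close>.
\<close>

definition KS_classical_solution :: "real \<Rightarrow> real \<Rightarrow> ((real^'d) \<times> real \<Rightarrow> real^'d) \<Rightarrow> bool" where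
  "KS_classical_solution lam T u \<longleftrightarrow>
     (\<forall>t\<in>{0..T}. torus_periodic (\<lambda>x. u (x, t))) \<and>
     C_along (UNIV \<times> {0..T}) [(0, 1)] u \<and>
     (\<forall>vs. set vs \<subseteq> range (\<lambda>i. (axis i 1, 0)) \<and> length vs \<le> 4 \<longrightarrow> C_along (UNIV \<times> {0..T}) vs u) \<and>
     (\<forall>p \<in> UNIV \<times> {0..T}.
        dt T u p + advection T u p + lam *\<^sub>R laplacian T u p + laplacian T (laplacian T u) p = 0)"

end

theory Submission
  imports Defs
begin

text \<open>
  Everything is done on the Fourier side. Let \<open>A\<^sup>s\<close> be the space of coefficient sequences that are
  summable against \<open>(1 + |n|) ^ s\<close>; it is a Banach algebra under convolution, and by the
  Cauchy-Schwarz inequality \<open>H\<^sup>m\<close> embeds in \<open>A\<^sup>s\<close> with \<open>s = 4 k\<close> because \<open>m - s > d / 2\<close>. The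
  nonlinearity maps \<open>A\<^sup>s\<close> to \<open>A\<^sup>s\<^sup>-\<^sup>1\<close>, and the Duhamel integral of the fourth order semigroup regains
  this derivative with operator norm \<open>O(sqrt T)\<close>, so that the Picard iteration converges in \<open>A\<^sup>s\<close> for
  small \<open>T\<close>. The equation trades one time derivative for four space derivatives, hence the mixed
  derivatives with \<open>j\<close> time and at most \<open>4 (k - j)\<close> space derivatives are given by absolutely
  convergent series. For \<open>k \<ge> 1\<close> these include all derivatives in the equation and all those of
  total order at most \<open>k\<close>. The initial value is attained because an integrable function is determined
  almost everywhere by its Fourier coefficients, by the Stone-Weierstrass theorem.
\<close>



section \<open>Unconditionally summable families\<close>

text \<open>Absolutely summable weighted coefficients, in place of norms based on square
  integrability, make every series converge absolutely and uniformly on the slab: termwise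
  differentiation then gives pointwise derivatives, one-sided at the ends of the time interval, and
  a product of two series is the series of the convolution. The price is the \<open>d / 2\<close>
  lost between square summability and summability, which is the margin in the bound on
  \<open>m\<close>. All regularity, also that of the time derivatives at \<open>t = 0\<close>, is
  inherited from the data; the smoothing of the semigroup only repays the derivative in the
  advection term. Coefficients are complex while the field takes real parts. Real parts respect sums
  but not products, so the symmetry of the coefficients of a real function has to be carried through
  the iteration. The field is continuous whereas \<open>u0\<close> may be arbitrary on a null set,
  so the initial values can agree only almost everywhere.\<close>

lemma
  fixes f g :: "'a::ab_group_add \<Rightarrow> 'b::{real_normed_div_algebra,banach}"
  assumes f: "(\<lambda>k. norm (f k)) summable_on UNIV" and g: "(\<lambda>k. norm (g k)) summable_on UNIV"
  shows abs_summable_convolution_terms: "(\<lambda>k. norm (f k * g (n - k))) summable_on UNIV"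
    and has_sum_convolution:
      "((\<lambda>n. \<Sum>\<^sub>\<infinity>k. f k * g (n - k)) has_sum (infsum f UNIV * infsum g UNIV)) UNIV"
proof -
  define P where "P = (\<lambda>(k, l). f k * g l)"
  have P: "(\<lambda>p. norm (P p)) summable_on UNIV \<times> UNIV"
    unfolding Infinite_Sum.abs_summable_on_Sigma_iff P_def
    using f g by (simp add: norm_mult infsum_cmult_right' abs_mult infsum_nonneg
        summable_on_cmult_right summable_on_cmult_left del: UNIV_Times_UNIV)
  have f': "f summable_on UNIV" and g': "g summable_on UNIV"
    using f g abs_summable_summable by blast+
  have "((\<lambda>k. f k * infsum g UNIV) has_sum infsum P (UNIV \<times> UNIV)) UNIV"
    by (rule has_sum_Sigma[OF isUCont_plus, where f = P and B = "\<lambda>_. UNIV"])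
      (use abs_summable_summable[OF P] g' in \<open>auto simp: P_def intro!: has_sum_cmult_right\<close>)
  moreover have "((\<lambda>k. f k * infsum g UNIV) has_sum (infsum f UNIV * infsum g UNIV)) UNIV"
    by (intro has_sum_cmult_left) (use f' in auto)
  ultimately have sum_P: "infsum P (UNIV \<times> UNIV) = infsum f UNIV * infsum g UNIV"
    using has_sum_unique by blast
  \<comment> \<open>The bijection \<open>(k, l) \<mapsto> (k + l, k)\<close> groups the product
    family by total frequency; summing over the fibres gives the Cauchy product.\<close>
  define Q where "Q = (\<lambda>(n, k). f k * g (n - k))"
  have "(\<lambda>p. norm (Q p)) summable_on UNIV \<times> UNIV \<longleftrightarrow> (\<lambda>p. norm (P p)) summable_on UNIV \<times> UNIV"
    by (rule summable_on_reindex_bij_witness[of _ "\<lambda>(k, l). (k + l, k)" "\<lambda>(n, k). (k, n - k)"])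
      (auto simp: P_def Q_def)
  with P have Q: "(\<lambda>p. norm (Q p)) summable_on UNIV \<times> UNIV" by (simp only:)
  then show terms: "(\<lambda>k. norm (f k * g (n - k))) summable_on UNIV" for n
    unfolding Infinite_Sum.abs_summable_on_Sigma_iff by (simp add: Q_def)
  have "infsum Q (UNIV \<times> UNIV) = infsum P (UNIV \<times> UNIV)"
    by (rule infsum_reindex_bij_witness[of _ "\<lambda>(k, l). (k + l, k)" "\<lambda>(n, k). (k, n - k)"])
      (auto simp: P_def Q_def)
  then have "(Q has_sum (infsum f UNIV * infsum g UNIV)) (UNIV \<times> UNIV)"
    using Q abs_summable_summable sum_P by (metis has_sum_infsum)
  then show "((\<lambda>n. \<Sum>\<^sub>\<infinity>k. f k * g (n - k)) has_sum (infsum f UNIV * infsum g UNIV)) UNIV"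
    by (rule has_sum_Sigma[OF isUCont_plus, where B = "\<lambda>_. UNIV"]) (use abs_summable_summable[OF terms] in \<open>auto simp: Q_def\<close>)
qed

lemma has_sum_diff:
  fixes f g :: "'a \<Rightarrow> 'b::real_normed_vector"
  assumes "(f has_sum a) A" "(g has_sum b) A"
  shows "((\<lambda>x. f x - g x) has_sum (a - b)) A"
  using has_sum_add[of f A a "\<lambda>x. - g x" "- b"] assms by (simp add: has_sum_uminus)

lemma summable_on_norm_comparison:
  fixes f :: "'a \<Rightarrow> 'b::banach"
  assumes "g summable_on A" and "\<And>x. x \<in> A \<Longrightarrow> norm (f x) \<le> g x"
  shows "f summable_on A"
  by (rule abs_summable_summable, rule Infinite_Sum.abs_summable_on_comparison_test'[OF assms])

lemma norm_infsum_le_infsum: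
  fixes f :: "'a \<Rightarrow> 'b::banach"
  assumes "g summable_on A" and "\<And>x. x \<in> A \<Longrightarrow> norm (f x) \<le> g x"
  shows "norm (infsum f A) \<le> infsum g A"
  by (rule norm_infsum_le[OF has_sum_infsum[OF summable_on_norm_comparison] has_sum_infsum])
    (use assms in auto)

lemma continuous_on_infsum:
  fixes f :: "'i \<Rightarrow> 'a::topological_space \<Rightarrow> 'b::banach"
  assumes "\<And>i. i \<in> A \<Longrightarrow> continuous_on S (f i)"
    and "\<And>i x. i \<in> A \<Longrightarrow> x \<in> S \<Longrightarrow> norm (f i x) \<le> M i"
    and "M summable_on A"
  shows "continuous_on S (\<lambda>x. \<Sum>\<^sub>\<infinity>i\<in>A. f i x)"
proof (rule uniform_limit_theorem)
  show "uniform_limit S (\<lambda>X x. \<Sum>i\<in>X. f i x) (\<lambda>x. \<Sum>\<^sub>\<infinity>i\<in>A. f i x) (finite_subsets_at_top A)"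
    by (rule Weierstrass_m_test_general) (use assms in auto)
  show "\<forall>\<^sub>F X in finite_subsets_at_top A. continuous_on S (\<lambda>x. \<Sum>i\<in>X. f i x)"
    by (rule eventually_finite_subsets_at_top_weakI) (auto intro!: continuous_on_sum assms(1))
qed auto

lemma vector_derivative_bound:
  fixes f :: "real \<Rightarrow> 'b::real_normed_vector"
  assumes "convex S" "x \<in> S" "y \<in> S"
    and "\<And>s. s \<in> S \<Longrightarrow> (f has_vector_derivative f' s) (at s within S)"
    and "\<And>s. s \<in> S \<Longrightarrow> norm (f' s) \<le> M"
  shows "norm (f x - f y) \<le> M * norm (x - y)"
proof (rule differentiable_bound[OF assms(1)])
  show "(f has_derivative (\<lambda>h. h *\<^sub>R f' s)) (at s within S)" if "s \<in> S" for s
    using assms(4)[OF that] by (simp add: has_vector_derivative_def)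
  show "onorm (\<lambda>h. h *\<^sub>R f' s) \<le> M" if "s \<in> S" for s
    by (rule onorm_le) (use assms(5)[OF that] in \<open>simp add: mult.commute[of M] mult_left_mono\<close>)
qed (use assms in auto)

text \<open>All but finitely many terms have small total bound \<open>M\<close>, and by the mean
  value inequality such a tail changes the difference quotient by at most twice its bound; the rest
  is a finite sum. Derivatives are relative to a convex \<open>S\<close>, so the endpoints of the
  time interval need no separate treatment.\<close>

lemma has_vector_derivative_infsum:
  fixes f :: "'i \<Rightarrow> real \<Rightarrow> 'b::banach"
  assumes S: "convex S" "x \<in> S"
    and deriv: "\<And>i s. i \<in> A \<Longrightarrow> s \<in> S \<Longrightarrow> (f i has_vector_derivative f' i s) (at s within S)"
    and bound: "\<And>i s. i \<in> A \<Longrightarrow> s \<in> S \<Longrightarrow> norm (f' i s) \<le> M i"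
    and M: "M summable_on A"
    and summ: "\<And>s. s \<in> S \<Longrightarrow> (\<lambda>i. f i s) summable_on A"
  shows "((\<lambda>s. \<Sum>\<^sub>\<infinity>i\<in>A. f i s) has_vector_derivative (\<Sum>\<^sub>\<infinity>i\<in>A. f' i x)) (at x within S)"
  unfolding has_vector_derivative_def has_derivative_within_alt2
proof (intro conjI allI impI)
  show "bounded_linear (\<lambda>h. h *\<^sub>R (\<Sum>\<^sub>\<infinity>i\<in>A. f' i x))"
    by (rule bounded_linear_scaleR_left)
  fix e :: real assume e: "e > 0"
  have M0: "M i \<ge> 0" if "i \<in> A" for i
    using bound[OF that S(2)] norm_ge_zero order_trans by blast
  \<comment> \<open>The tail enters with the factor 2, so \<open>e / 4\<close> leaves the other half
    of \<open>e\<close> for the finite part.\<close>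
  obtain F where F: "finite F" "F \<subseteq> A" "dist (sum M F) (infsum M A) \<le> e / 4"
    using infsum_finite_approximation[OF M, of "e / 4"] e by auto
  have MD: "M summable_on (A - F)" using M summable_on_subset_banach by blast
  have "infsum M A = sum M F + infsum M (A - F)"
    using infsum_Diff[OF M _ F(2)] F by (simp add: infsum_finite)
  then have tail: "infsum M (A - F) \<le> e / 4"
    using F(3) by (simp add: dist_norm)
  define h where "h y i = f i y - f i x - (y - x) *\<^sub>R f' i x" for y i
  have f'summ: "(\<lambda>i. f' i x) summable_on A"
    by (rule summable_on_norm_comparison[OF M]) (use bound S in auto)
  have h: "(h y has_sum ((\<Sum>\<^sub>\<infinity>i\<in>A. f i y) - (\<Sum>\<^sub>\<infinity>i\<in>A. f i x) - (y - x) *\<^sub>R (\<Sum>\<^sub>\<infinity>i\<in>A. f' i x))) A"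
    if "y \<in> S" for y
    unfolding h_def using summ[OF that] summ[OF S(2)] f'summ
    by (intro has_sum_diff has_sum_scaleR has_sum_infsum)
  then have hsumm: "h y summable_on A" if "y \<in> S" for y
    using that has_sum_imp_summable by blast
  have hinf: "(\<Sum>\<^sub>\<infinity>i\<in>A. f i y) - (\<Sum>\<^sub>\<infinity>i\<in>A. f i x) - (y - x) *\<^sub>R (\<Sum>\<^sub>\<infinity>i\<in>A. f' i x) = infsum (h y) A"
    if "y \<in> S" for y
    using infsumI[OF h[OF that]] by simp
  have hbound: "norm (h y i) \<le> 2 * norm (y - x) * M i" if "i \<in> A" "y \<in> S" for i y
  proof -
    have "norm (f i y - f i x) \<le> M i * norm (y - x)"
      by (rule vector_derivative_bound[OF S(1) that(2) S(2) deriv bound]) (use that in auto)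
    moreover have "norm ((y - x) *\<^sub>R f' i x) \<le> norm (y - x) * M i"
      using bound[OF that(1) S(2)] by (simp add: mult_left_mono)
    moreover have "norm (h y i) \<le> norm (f i y - f i x) + norm ((y - x) *\<^sub>R f' i x)"
      unfolding h_def by (rule norm_triangle_ineq4)
    ultimately show ?thesis by (simp add: mult.commute)
  qed
  have "((\<lambda>s. \<Sum>i\<in>F. f i s) has_vector_derivative (\<Sum>i\<in>F. f' i x)) (at x within S)"
    by (intro has_vector_derivative_sum deriv) (use F S in auto)
  then have "\<forall>\<^sub>F y in at x within S. norm ((\<Sum>i\<in>F. f i y) - (\<Sum>i\<in>F. f i x) - (y - x) *\<^sub>R (\<Sum>i\<in>F. f' i x))
      \<le> (e / 2) * norm (y - x)"
    unfolding has_vector_derivative_def has_derivative_within_alt2 using e half_gt_zero by blast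
  moreover have "\<forall>\<^sub>F y in at x within S. y \<in> S" by (simp add: eventually_at_filter)
  ultimately show "\<forall>\<^sub>F y in at x within S. norm ((\<Sum>\<^sub>\<infinity>i\<in>A. f i y) - (\<Sum>\<^sub>\<infinity>i\<in>A. f i x) -
       (y - x) *\<^sub>R (\<Sum>\<^sub>\<infinity>i\<in>A. f' i x)) \<le> e * norm (y - x)"
  proof eventually_elim
    case (elim y)
    have "norm (infsum (h y) A) = norm (sum (h y) F + infsum (h y) (A - F))"
      using infsum_Diff[OF hsumm[OF elim(2)] _ F(2)] F by (simp add: infsum_finite)
    moreover have "norm (sum (h y) F) \<le> (e / 2) * norm (y - x)"
      using elim(1) by (simp add: h_def sum_subtractf scaleR_sum_right)
    moreover have "norm (infsum (h y) (A - F)) \<le> (\<Sum>\<^sub>\<infinity>i\<in>A - F. 2 * norm (y - x) * M i)"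
    proof (rule norm_infsum_le)
      show "(h y has_sum infsum (h y) (A - F)) (A - F)"
        using summable_on_subset_banach[OF hsumm[OF elim(2)]] by auto
      show "((\<lambda>i. 2 * norm (y - x) * M i) has_sum (\<Sum>\<^sub>\<infinity>i\<in>A - F. 2 * norm (y - x) * M i)) (A - F)"
        using MD by (intro has_sum_infsum summable_on_cmult_right) auto
    qed (use hbound elim in auto)
    moreover have "(\<Sum>\<^sub>\<infinity>i\<in>A - F. 2 * norm (y - x) * M i) \<le> 2 * norm (y - x) * (e / 4)"
      unfolding infsum_cmult_right' using tail by (intro mult_left_mono) auto
    ultimately have "norm (infsum (h y) A) \<le> (e / 2) * norm (y - x) + 2 * norm (y - x) * (e / 4)"
      using norm_triangle_ineq[of "sum (h y) F" "infsum (h y) (A - F)"] by linarith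
    then show ?case unfolding hinf[OF elim(2)] by simp
  qed
qed



section \<open>Weighted summable Fourier coefficients\<close>

text \<open>The form \<open>1 + |n|\<close> is submultiplicative with constant one, so for every
  \<open>s\<close> the weighted norm of a convolution is at most the product of the norms, with no
  constant depending on \<open>s\<close>.\<close>

definition wt :: "int^'d \<Rightarrow> real" where
  "wt n = 1 + norm (of_int_vec n)"

lemma of_int_vec_diff: "of_int_vec (a - b) = of_int_vec a - of_int_vec b"
  and of_int_vec_add: "of_int_vec (a + b) = of_int_vec a + of_int_vec b"
  and of_int_vec_uminus: "of_int_vec (- a) = - of_int_vec a"
  and of_int_vec_zero: "of_int_vec 0 = 0"
  and of_int_vec_nth: "of_int_vec a $ i = of_int (a $ i)"
  by (simp_all add: of_int_vec_def vec_eq_iff)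

lemma wt_ge_1: "1 \<le> wt n"
  and wt_pos: "0 < wt n"
  and wt_nonneg: "0 \<le> wt n"
  using norm_ge_zero[of "of_int_vec n"] unfolding wt_def by linarith+

lemma wt_pow_mult_nonneg: "0 \<le> x \<Longrightarrow> 0 \<le> wt n ^ s * x"
  by (intro mult_nonneg_nonneg zero_le_power wt_nonneg)

lemma wt_le_mult: "wt n \<le> wt k * wt (n - k)"
proof -
  have "norm (of_int_vec n) \<le> norm (of_int_vec k) + norm (of_int_vec (n - k))"
    using norm_triangle_ineq[of "of_int_vec k" "of_int_vec (n - k)"] by (simp add: of_int_vec_diff)
  moreover have "0 \<le> norm (of_int_vec k) * norm (of_int_vec (n - k))" by simp
  ultimately show ?thesis unfolding wt_def distrib_left distrib_right mult_1_left mult_1_right by linarith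
qed

lemma wt_pow_le_mult: "wt n ^ s \<le> wt k ^ s * wt (n - k) ^ s"
  unfolding power_mult_distrib[symmetric] by (intro power_mono wt_le_mult wt_nonneg)

lemma abs_index_le_wt: "\<bar>of_int (n $ i)\<bar> \<le> wt n"
  using component_le_norm_cart[of "of_int_vec n" i] by (simp add: wt_def of_int_vec_nth)

text \<open>A bound \<open>R\<close> on the norm \<open>\<Sum>\<^sub>n wt n ^ s * sup\<^sub>t cmod (c n t)\<close>: the supremum over
  \<open>t\<close> sits inside the sum, which is why it is replaced by a majorant sequence.\<close>

definition majorized :: "nat \<Rightarrow> real \<Rightarrow> real \<Rightarrow> (int^'d \<Rightarrow> real \<Rightarrow> complex) \<Rightarrow> bool" where
  "majorized s T R c \<longleftrightarrow> (\<exists>a. (\<forall>n. \<forall>t\<in>{0..T}. cmod (c n t) \<le> a n) \<and> (\<forall>n. 0 \<le> a n) \<and>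
     (\<lambda>n. wt n ^ s * a n) summable_on UNIV \<and> (\<Sum>\<^sub>\<infinity>n. wt n ^ s * a n) \<le> R)"

lemma majorizedE:
  assumes "majorized s T R c"
  obtains a where "\<And>n t. t \<in> {0..T} \<Longrightarrow> cmod (c n t) \<le> a n" "\<And>n. 0 \<le> a n"
    "(\<lambda>n. wt n ^ s * a n) summable_on UNIV" "(\<Sum>\<^sub>\<infinity>n. wt n ^ s * a n) \<le> R"
  using assms unfolding majorized_def by blast

lemma majorizedI:
  assumes "\<And>n t. t \<in> {0..T} \<Longrightarrow> cmod (c n t) \<le> a n" "\<And>n. 0 \<le> a n"
    "(\<lambda>n. wt n ^ s * a n) summable_on UNIV" "(\<Sum>\<^sub>\<infinity>n. wt n ^ s * a n) \<le> R"
  shows "majorized s T R c"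
  using assms unfolding majorized_def by blast

lemma summable_wt_mono:
  assumes "(\<lambda>n. wt n ^ s * a n) summable_on UNIV" "\<And>n. 0 \<le> a n" "r \<le> s"
  shows "(\<lambda>n. wt n ^ r * a n) summable_on UNIV"
  by (rule summable_on_comparison_test[OF assms(1)])
    (rule mult_right_mono[OF power_increasing[OF assms(3) wt_ge_1] assms(2)],
      rule wt_pow_mult_nonneg[OF assms(2)])

lemma majorized_weaken:
  assumes "majorized s T R c" "r \<le> s" "R \<le> R'"
  shows "majorized r T R' c"
proof -
  obtain a where a: "\<And>n t. t \<in> {0..T} \<Longrightarrow> cmod (c n t) \<le> a n" "\<And>n. 0 \<le> a n"
    "(\<lambda>n. wt n ^ s * a n) summable_on UNIV" "(\<Sum>\<^sub>\<infinity>n. wt n ^ s * a n) \<le> R"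
    by (rule majorizedE[OF assms(1)]) (rule that)
  note r = summable_wt_mono[OF a(3,2) assms(2)]
  have "(\<Sum>\<^sub>\<infinity>n. wt n ^ r * a n) \<le> (\<Sum>\<^sub>\<infinity>n. wt n ^ s * a n)"
    by (rule infsum_mono[OF r a(3)]) (intro mult_right_mono power_increasing a(2) wt_ge_1 assms(2))
  then show ?thesis using a r assms by (intro majorizedI[of T c a]) auto
qed

lemma majorized_nonneg: "majorized s T R c \<Longrightarrow> 0 \<le> R"
  by (erule majorizedE, erule order_trans[rotated], rule infsum_nonneg)
    (rule wt_pow_mult_nonneg)

text \<open>All weights are at least 1, so one term is below the whole sum. This turns norm
  estimates into uniform estimates of single coefficients.\<close>

lemma majorized_bound:
  assumes "majorized s T R c" "t \<in> {0..T}"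
  shows "cmod (c n t) \<le> R"
proof -
  obtain a where a: "\<And>n t. t \<in> {0..T} \<Longrightarrow> cmod (c n t) \<le> a n" "\<And>n. 0 \<le> a n"
    "(\<lambda>n. wt n ^ s * a n) summable_on UNIV" "(\<Sum>\<^sub>\<infinity>n. wt n ^ s * a n) \<le> R"
    by (rule majorizedE[OF assms(1)]) (rule that)
  have "1 * a n \<le> wt n ^ s * a n" by (intro mult_right_mono a one_le_power wt_ge_1)
  also have "\<dots> = (\<Sum>n\<in>{n}. wt n ^ s * a n)" by simp
  also have "\<dots> \<le> (\<Sum>\<^sub>\<infinity>n. wt n ^ s * a n)"
    by (rule finite_sum_le_infsum) (use a in \<open>auto intro!: wt_pow_mult_nonneg\<close>)
  finally show ?thesis using a(1)[OF assms(2), of n] a(4) by linarith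
qed

lemma majorized_add:
  assumes "majorized s T R c" "majorized s T Q d"
  shows "majorized s T (R + Q) (\<lambda>n t. c n t + d n t)"
proof -
  obtain a where a: "\<And>n t. t \<in> {0..T} \<Longrightarrow> cmod (c n t) \<le> a n" "\<And>n. 0 \<le> a n"
    "(\<lambda>n. wt n ^ s * a n) summable_on UNIV" "(\<Sum>\<^sub>\<infinity>n. wt n ^ s * a n) \<le> R"
    by (rule majorizedE[OF assms(1)]) (rule that)
  obtain b where b: "\<And>n t. t \<in> {0..T} \<Longrightarrow> cmod (d n t) \<le> b n" "\<And>n. 0 \<le> b n"
    "(\<lambda>n. wt n ^ s * b n) summable_on UNIV" "(\<Sum>\<^sub>\<infinity>n. wt n ^ s * b n) \<le> Q"
    by (rule majorizedE[OF assms(2)]) (rule that)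
  show ?thesis
    by (rule majorizedI[of T _ "\<lambda>n. a n + b n"])
      (use a b in \<open>auto simp: distrib_left infsum_add
        intro!: summable_on_add norm_triangle_mono add_mono\<close>)
qed

lemma majorized_zero: "majorized s T 0 (\<lambda>n t. 0)"
  by (rule majorizedI[of _ _ "\<lambda>_. 0"]) auto

text \<open>Covers Fourier multipliers of order \<open>q\<close>, possibly depending on time. Only
  absolute values are compared, so \<open>q = 0\<close>, \<open>K = 1\<close> also gives invariance
  under sign changes and domination by another sequence.\<close>

lemma majorized_symbol:
  assumes "majorized (s + q) T R c" "K \<ge> 0"
    and "\<And>n t. t \<in> {0..T} \<Longrightarrow> cmod (d n t) \<le> K * wt n ^ q * cmod (c n t)"
  shows "majorized s T (K * R) d"
proof -
  obtain a where a: "\<And>n t. t \<in> {0..T} \<Longrightarrow> cmod (c n t) \<le> a n" "\<And>n. 0 \<le> a n"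
    "(\<lambda>n. wt n ^ (s + q) * a n) summable_on UNIV" "(\<Sum>\<^sub>\<infinity>n. wt n ^ (s + q) * a n) \<le> R"
    by (rule majorizedE[OF assms(1)]) (rule that)
  have eq: "(\<lambda>n. wt n ^ s * (K * wt n ^ q * a n)) = (\<lambda>n. K * (wt n ^ (s + q) * a n))"
    by (simp add: power_add mult_ac)
  show ?thesis
  proof (rule majorizedI[of T _ "\<lambda>n. K * wt n ^ q * a n"])
    show "cmod (d n t) \<le> K * wt n ^ q * a n" if "t \<in> {0..T}" for n t
      by (rule order_trans[OF assms(3)[OF that]])
        (intro mult_left_mono a that mult_nonneg_nonneg assms(2) zero_le_power wt_nonneg)
    show "(\<Sum>\<^sub>\<infinity>n. wt n ^ s * (K * wt n ^ q * a n)) \<le> K * R"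
      unfolding eq infsum_cmult_right' by (intro mult_left_mono a assms(2))
  qed (use a assms(2) in \<open>auto simp: eq wt_nonneg intro!: summable_on_cmult_right\<close>)
qed

lemma majorized_uminus: "majorized s T R c \<Longrightarrow> majorized s T R (\<lambda>n t. - c n t)"
  using majorized_symbol[of s 0 T R c 1 "\<lambda>n t. - c n t"] by simp

lemma majorized_diff:
  assumes "majorized s T R c" "majorized s T Q d"
  shows "majorized s T (R + Q) (\<lambda>n t. c n t - d n t)"
  using majorized_add[OF assms(1) majorized_uminus[OF assms(2)]] by simp

lemma majorized_sum:
  assumes "finite I" "\<And>i. i \<in> I \<Longrightarrow> majorized s T (R i) (c i)"
  shows "majorized s T (\<Sum>i\<in>I. R i) (\<lambda>n t. \<Sum>i\<in>I. c i n t)"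
  using assms
proof (induction I rule: finite_induct)
  case (insert i I)
  then show ?case by (simp add: majorized_add)
qed (simp add: majorized_zero)

section \<open>The convolution algebra\<close>

definition conv :: "(int^'d \<Rightarrow> real \<Rightarrow> complex) \<Rightarrow> (int^'d \<Rightarrow> real \<Rightarrow> complex) \<Rightarrow> int^'d \<Rightarrow> real \<Rightarrow> complex" where
  "conv u v n t = (\<Sum>\<^sub>\<infinity>k. u k t * v (n - k) t)"

definition d_coeff :: "'d \<Rightarrow> (int^'d \<Rightarrow> real \<Rightarrow> complex) \<Rightarrow> int^'d \<Rightarrow> real \<Rightarrow> complex" where
  "d_coeff i c n t = \<i> * of_int (n $ i) * c n t"

lemma majorized_d_coeff:
  assumes "majorized (Suc s) T R c"
  shows "majorized s T R (d_coeff i c)"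
  using majorized_symbol[of s 1 T R c 1 "d_coeff i c"] assms
  by (simp add: d_coeff_def norm_mult mult_right_mono[OF abs_index_le_wt])

text \<open>The majorant of the convolution is the convolution of the majorants, with the weight
  distributed by \<open>wt_pow_le_mult\<close>. The second conclusion keeps, for each
  \<open>n\<close>, a majorant of the individual terms that does not depend on \<open>t\<close> and
  sums to \<open>cmod (m n)\<close>; it yields the norm bound, summability, continuity and the
  product rule alike.\<close>

lemma conv_majorant:
  assumes u: "majorized s T R u" and v: "majorized s T Q v"
  obtains m where "majorized s T (R * Q) (\<lambda>n t. m n)"
    "\<And>n. \<exists>a. a summable_on UNIV \<and> infsum a UNIV = cmod (m n) \<and> (\<forall>k. \<forall>t\<in>{0..T}. cmod (u k t * v (n - k) t) \<le> a k)"
proof -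
  obtain a where a: "\<And>n t. t \<in> {0..T} \<Longrightarrow> cmod (u n t) \<le> a n" "\<And>n. 0 \<le> a n"
    "(\<lambda>n. wt n ^ s * a n) summable_on UNIV" "(\<Sum>\<^sub>\<infinity>n. wt n ^ s * a n) \<le> R"
    by (rule majorizedE[OF assms(1)]) (rule that)
  obtain b where b: "\<And>n t. t \<in> {0..T} \<Longrightarrow> cmod (v n t) \<le> b n" "\<And>n. 0 \<le> b n"
    "(\<lambda>n. wt n ^ s * b n) summable_on UNIV" "(\<Sum>\<^sub>\<infinity>n. wt n ^ s * b n) \<le> Q"
    by (rule majorizedE[OF assms(2)]) (rule that)
  define A where "A n = wt n ^ s * a n" for n
  define B where "B n = wt n ^ s * b n" for n
  have nonneg: "A n \<ge> 0" "B n \<ge> 0" for n unfolding A_def B_def using a b by (intro wt_pow_mult_nonneg; simp)+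
  have AB: "(\<lambda>n. norm (A n)) summable_on UNIV" "(\<lambda>n. norm (B n)) summable_on UNIV"
    using a(3) b(3) nonneg by (auto simp: A_def[symmetric] B_def[symmetric])
  have absum: "a summable_on UNIV" "b summable_on UNIV"
    using summable_wt_mono[OF a(3,2), of 0] summable_wt_mono[OF b(3,2), of 0] by simp_all
  have terms: "(\<lambda>k. A k * B (n - k)) summable_on UNIV" for n
    by (rule abs_summable_summable[OF abs_summable_convolution_terms[OF AB]])
  have terms': "(\<lambda>k. a k * b (n - k)) summable_on UNIV" for n
    by (rule abs_summable_summable[OF abs_summable_convolution_terms]) (use absum a b in auto)
  define m where "m n = (\<Sum>\<^sub>\<infinity>k. a k * b (n - k))" for n
  have m0: "m n \<ge> 0" for n unfolding m_def by (rule infsum_nonneg) (use a b in auto)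
  have le: "wt n ^ s * m n \<le> (\<Sum>\<^sub>\<infinity>k. A k * B (n - k))" for n
    unfolding m_def infsum_cmult_right'[symmetric]
  proof (rule infsum_mono[OF summable_on_cmult_right[OF terms'] terms])
    fix k
    have "wt n ^ s * (a k * b (n - k)) \<le> (wt k ^ s * wt (n - k) ^ s) * (a k * b (n - k))"
      by (intro mult_right_mono wt_pow_le_mult mult_nonneg_nonneg a b)
    then show "wt n ^ s * (a k * b (n - k)) \<le> A k * B (n - k)" by (simp add: A_def B_def mult_ac)
  qed
  have sm: "((\<lambda>n. \<Sum>\<^sub>\<infinity>k. A k * B (n - k)) has_sum (infsum A UNIV * infsum B UNIV)) UNIV"
    by (rule has_sum_convolution[OF AB])
  have summ: "(\<lambda>n. wt n ^ s * m n) summable_on UNIV"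
    by (rule summable_on_comparison_test[OF has_sum_imp_summable[OF sm]])
      (use le m0 in \<open>auto intro!: wt_pow_mult_nonneg\<close>)
  have "(\<Sum>\<^sub>\<infinity>n. wt n ^ s * m n) \<le> infsum A UNIV * infsum B UNIV"
    using infsum_mono[OF summ has_sum_imp_summable[OF sm] le] infsumI[OF sm] by simp
  also have "\<dots> \<le> R * Q"
    by (intro mult_mono) (use a b nonneg infsum_nonneg[of UNIV A] infsum_nonneg[of UNIV B] in
        \<open>auto simp: A_def[symmetric] B_def[symmetric] intro: order_trans\<close>)
  finally have "majorized s T (R * Q) (\<lambda>n t. complex_of_real (m n))"
    by (intro majorizedI[of _ _ m]) (use m0 summ in auto)
  moreover have "\<exists>a. a summable_on UNIV \<and> infsum a UNIV = cmod (complex_of_real (m n)) \<and>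
      (\<forall>k. \<forall>t\<in>{0..T}. cmod (u k t * v (n - k) t) \<le> a k)" for n
    by (rule exI[of _ "\<lambda>k. a k * b (n - k)"])
      (use m0 terms' a b in \<open>auto simp: m_def norm_mult intro!: mult_mono\<close>)
  ultimately show ?thesis by (rule that)
qed

lemma conv_terms_majorant:
  assumes "majorized s T R u" "majorized s T Q v"
  obtains a where "a summable_on UNIV" "\<And>k t. t \<in> {0..T} \<Longrightarrow> cmod (u k t * v (n - k) t) \<le> a k"
proof -
  obtain m where m: "\<And>n. \<exists>a. a summable_on UNIV \<and> infsum a UNIV = cmod (m n) \<and>
      (\<forall>k. \<forall>t\<in>{0..T}. cmod (u k t * v (n - k) t) \<le> a k)"
    by (rule conv_majorant[OF assms]) (rule that)
  from m[of n] obtain a where "a summable_on UNIV" "\<forall>k. \<forall>t\<in>{0..T}. cmod (u k t * v (n - k) t) \<le> a k"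
    by (elim exE conjE)
  with that[of a] show ?thesis by simp
qed

lemma majorized_conv:
  assumes u: "majorized s T R u" and v: "majorized s T Q v"
  shows "majorized s T (R * Q) (conv u v)"
proof -
  obtain m where m: "majorized s T (R * Q) (\<lambda>n t. m n)"
    "\<And>n. \<exists>a. a summable_on UNIV \<and> infsum a UNIV = cmod (m n) \<and> (\<forall>k. \<forall>t\<in>{0..T}. cmod (u k t * v (n - k) t) \<le> a k)"
    using conv_majorant[OF assms] by blast
  have "cmod (conv u v n t) \<le> cmod (m n)" if t: "t \<in> {0..T}" for n t
  proof -
    obtain a where a: "a summable_on UNIV" "infsum a UNIV = cmod (m n)"
      "\<And>k t. t\<in>{0..T} \<Longrightarrow> cmod (u k t * v (n - k) t) \<le> a k" using m(2)[of n] by blast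
    show ?thesis unfolding conv_def a(2)[symmetric]
      by (rule norm_infsum_le_infsum[OF a(1) a(3)[OF t]])
  qed
  then show ?thesis using majorized_symbol[of s 0 T "R * Q" "\<lambda>n t. m n" 1 "conv u v"] m(1) by simp
qed

lemma conv_terms_summable:
  assumes u: "majorized s T R u" and v: "majorized s T Q v" and t: "t \<in> {0..T}"
  shows "(\<lambda>k. u k t * v (n - k) t) summable_on UNIV"
proof -
  obtain a where a: "a summable_on UNIV" "\<And>k t. t \<in> {0..T} \<Longrightarrow> cmod (u k t * v (n - k) t) \<le> a k"
    by (rule conv_terms_majorant[OF u v]) (rule that)
  show ?thesis by (rule summable_on_norm_comparison[OF a(1) a(2)[OF t]])
qed

lemma continuous_on_conv:
  assumes u: "majorized s T R u" and v: "majorized s T Q v"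
    and "\<And>n. continuous_on {0..T} (u n)" "\<And>n. continuous_on {0..T} (v n)"
  shows "continuous_on {0..T} (conv u v n)"
proof -
  obtain a where a: "a summable_on UNIV" "\<And>k t. t \<in> {0..T} \<Longrightarrow> cmod (u k t * v (n - k) t) \<le> a k"
    by (rule conv_terms_majorant[OF u v]) (rule that)
  have "continuous_on {0..T} (\<lambda>t. \<Sum>\<^sub>\<infinity>k. u k t * v (n - k) t)"
    by (rule continuous_on_infsum[OF _ _ a(1)]) (use a assms(3,4) in \<open>auto intro!: continuous_intros\<close>)
  then show ?thesis by (simp add: conv_def[abs_def])
qed

lemma conv_add_left:
  assumes "majorized s T R u" "majorized s T R' u'" "majorized s T Q v" "t \<in> {0..T}"
  shows "conv (\<lambda>n t. u n t + u' n t) v n t = conv u v n t + conv u' v n t"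
  unfolding conv_def distrib_right
  by (rule infsum_add) (use assms conv_terms_summable in blast)+

lemma conv_add_right:
  assumes "majorized s T R v" "majorized s T R' v'" "majorized s T Q u" "t \<in> {0..T}"
  shows "conv u (\<lambda>n t. v n t + v' n t) n t = conv u v n t + conv u v' n t"
  unfolding conv_def distrib_left
  by (rule infsum_add) (use assms conv_terms_summable in blast)+

lemma conv_uminus: "conv (\<lambda>n t. - u n t) v n t = - conv u v n t" "conv u (\<lambda>n t. - v n t) n t = - conv u v n t"
  by (simp_all add: conv_def infsum_uminus)



section \<open>The mild formulation\<close>

text \<open>The Fourier symbol of the Laplacian times \<open>lam\<close> plus the squared Laplacian.
  For positive \<open>lam\<close> it is negative when \<open>0 < |n|^2 < lam\<close>: these modes
  grow, hence the shift below.\<close>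

definition ks_symbol :: "real \<Rightarrow> int^'d \<Rightarrow> real" where
  "ks_symbol lam n = norm (of_int_vec n) ^ 4 - lam * norm (of_int_vec n) ^ 2"

definition heat :: "real \<Rightarrow> (int^'d \<Rightarrow> complex) \<Rightarrow> int^'d \<Rightarrow> real \<Rightarrow> complex" where
  "heat lam c n t = exp (- t * ks_symbol lam n) *\<^sub>R c n"

text \<open>The kernel \<open>exp (- (t - s) * L)\<close> is split so that \<open>t\<close> occurs
  only in a factor and as the upper limit; the product rule and the fundamental theorem then
  differentiate it.\<close>

definition duhamel :: "real \<Rightarrow> (int^'d \<Rightarrow> real \<Rightarrow> complex) \<Rightarrow> int^'d \<Rightarrow> real \<Rightarrow> complex" where
  "duhamel lam g n t =
     exp (- t * ks_symbol lam n) *\<^sub>R integral {0..t} (\<lambda>s. exp (s * ks_symbol lam n) *\<^sub>R g n s)"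

text \<open>With \<open>x = |n|\<close>: \<open>(1 + x)^2 \<le> 2 + 2 * x^2\<close> accounts for the
  2, and the minimum of \<open>y^2 - (lam + 2) * y\<close> over \<open>y = x^2\<close> for the
  square.\<close>

definition ks_shift :: "real \<Rightarrow> real" where
  "ks_shift lam = (lam + 2)\<^sup>2 / 4 + 2"

text \<open>The symbol controls the square of the weight up to a constant. Hence integrating the semigroup
  over time gains (at least) one derivative, with a small factor for short times.\<close>

lemma ks_symbol_ge: "(wt n)\<^sup>2 - ks_shift lam \<le> ks_symbol lam n"
proof -
  define x where "x = norm (of_int_vec n)"
  have "0 \<le> (x\<^sup>2 - (lam + 2) / 2)\<^sup>2" "0 \<le> (x - 1)\<^sup>2" by simp_all
  then have "(1 + x)\<^sup>2 - ((lam + 2)\<^sup>2 / 4 + 2) \<le> x ^ 4 - lam * x\<^sup>2"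
    by (simp add: power2_eq_square power4_eq_xxxx field_simps)
  then show ?thesis by (simp add: wt_def ks_shift_def ks_symbol_def x_def)
qed

lemma ks_symbol_minus [simp]: "ks_symbol lam (- n) = ks_symbol lam n"
  by (simp add: ks_symbol_def of_int_vec_uminus)

lemma ks_shift_nonneg: "0 \<le> ks_shift lam"
  by (simp add: ks_shift_def)

text \<open>Times up to 1 turn the growth factor \<open>exp (t * ks_shift lam)\<close> into a
  constant, leaving pure decay in the weight.\<close>

lemma exp_ks_symbol_le:
  assumes "0 \<le> t" "t \<le> 1"
  shows "exp (- t * ks_symbol lam n) \<le> exp (ks_shift lam) * exp (- t * (wt n)\<^sup>2)"
proof -
  have "t * ((wt n)\<^sup>2 - ks_shift lam) \<le> t * ks_symbol lam n"
    by (intro mult_left_mono ks_symbol_ge assms)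
  moreover have "t * ks_shift lam \<le> 1 * ks_shift lam"
    by (intro mult_right_mono assms ks_shift_nonneg)
  ultimately have "- t * ks_symbol lam n \<le> ks_shift lam + - t * (wt n)\<^sup>2" by (simp add: algebra_simps)
  then show ?thesis by (simp add: exp_add[symmetric])
qed

lemma majorized_heat:
  fixes c :: "int^'a \<Rightarrow> complex"
  assumes "(\<lambda>n. wt n ^ s * cmod (c n)) summable_on UNIV" "T \<le> 1"
  shows "majorized s T (exp (ks_shift lam) * (\<Sum>\<^sub>\<infinity>n. wt n ^ s * cmod (c n))) (heat lam c)"
proof -
  have c: "majorized (s + 0) T (\<Sum>\<^sub>\<infinity>n. wt n ^ s * cmod (c n)) (\<lambda>n t. c n)"
    by (rule majorizedI[of _ _ "\<lambda>n. cmod (c n)"]) (use assms in auto)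
  show ?thesis
  proof (rule majorized_symbol[OF c])
    fix n :: "int^'a" and t :: real assume t: "t \<in> {0..T}"
    have "exp (- t * ks_symbol lam n) \<le> exp (ks_shift lam) * exp (- t * (wt n)\<^sup>2)"
      by (rule exp_ks_symbol_le) (use t assms in auto)
    also have "\<dots> \<le> exp (ks_shift lam) * 1" using t by (intro mult_left_mono) auto
    finally show "cmod (heat lam c n t) \<le> exp (ks_shift lam) * wt n ^ 0 * cmod (c n)"
      by (simp add: heat_def mult_right_mono)
  qed simp
qed

lemma continuous_on_heat: "continuous_on S (heat lam c n)"
  unfolding heat_def[abs_def] by (intro continuous_intros)

lemma heat_has_vector_derivative:
  "(heat lam c n has_vector_derivative - ks_symbol lam n *\<^sub>R heat lam c n t) (at t within S)"
  unfolding heat_def[abs_def]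
  by (auto intro!: derivative_eq_intros simp: has_real_derivative_iff_has_vector_derivative[symmetric])

lemma duhamel_has_vector_derivative:
  assumes "continuous_on {0..T} (g n)" "t \<in> {0..T}"
  shows "(duhamel lam g n has_vector_derivative g n t - ks_symbol lam n *\<^sub>R duhamel lam g n t) (at t within {0..T})"
proof -
  define L where "L = ks_symbol lam n"
  have I: "((\<lambda>t. integral {0..t} (\<lambda>s. exp (s * L) *\<^sub>R g n s)) has_vector_derivative exp (t * L) *\<^sub>R g n t)
      (at t within {0..T})"
    by (rule integral_has_vector_derivative) (use assms in \<open>auto intro!: continuous_intros\<close>)
  have E: "((\<lambda>t. exp (- t * L)) has_real_derivative - L * exp (- t * L)) (at t within {0..T})"
    by (auto intro!: derivative_eq_intros)
  have "(duhamel lam g n has_vector_derivative exp (- t * L) *\<^sub>R (exp (t * L) *\<^sub>R g n t) +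
      (- L * exp (- t * L)) *\<^sub>R integral {0..t} (\<lambda>s. exp (s * L) *\<^sub>R g n s)) (at t within {0..T})"
    unfolding duhamel_def[abs_def] L_def[symmetric] by (rule has_vector_derivative_scaleR[OF E I])
  moreover have "exp (- t * L) *\<^sub>R (exp (t * L) *\<^sub>R g n t) +
      (- L * exp (- t * L)) *\<^sub>R integral {0..t} (\<lambda>s. exp (s * L) *\<^sub>R g n s) = g n t - L *\<^sub>R duhamel lam g n t"
    by (simp add: duhamel_def L_def[symmetric] exp_minus)
  ultimately show ?thesis by (simp add: L_def)
qed

lemma continuous_on_duhamel:
  assumes "continuous_on {0..T} (g n)"
  shows "continuous_on {0..T} (duhamel lam g n)"
  using duhamel_has_vector_derivative[where g = g and n = n, OF assms] has_vector_derivative_continuous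
  by (fastforce simp: continuous_on_eq_continuous_within)

text \<open>The kernel integrates to at most a constant times
  \<open>(1 - exp (- y)) / (wt n)^2\<close> with \<open>y = t * (wt n)^2\<close>. Since
  \<open>1 - exp (- y) \<le> min 1 y \<le> sqrt y\<close>, one of the two powers of the weight is
  kept as a gain of regularity and the other is exchanged for \<open>sqrt T\<close>.\<close>

lemma duhamel_bound:
  assumes g: "continuous_on {0..T} (g n)" "\<And>s. s \<in> {0..T} \<Longrightarrow> cmod (g n s) \<le> G"
    and t: "t \<in> {0..T}" and T: "T \<le> 1"
  shows "cmod (duhamel lam g n t) \<le> exp (ks_shift lam) * sqrt T / wt n * G"
proof -
  define L where "L = ks_symbol lam n"
  define w where "w = wt n"
  define K where "K = exp (ks_shift lam)"
  have w: "w > 0" by (simp add: w_def wt_pos)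
  have G: "G \<ge> 0" using order_trans[OF norm_ge_zero g(2)[OF t]] .
  have t01: "0 \<le> t" "t \<le> T" "t \<le> 1" using t T by auto
  \<comment> \<open>\<open>h\<close> below dominates the integrand and \<open>F\<close> is its
    antiderivative; the factor \<open>exp (t * L)\<close> cancels against the prefactor in
    \<open>duhamel\<close>.\<close>
  define F where "F s = exp (t * L) * K * G * (exp (- (t - s) * w\<^sup>2) / w\<^sup>2)" for s
  define h where "h s = exp (t * L) * K * G * exp (- (t - s) * w\<^sup>2)" for s
  have F': "(h has_integral (F t - F 0)) {0..t}"
  proof (rule fundamental_theorem_of_calculus[OF t01(1)])
    fix s assume "s \<in> {0..t}"
    show "(F has_vector_derivative h s) (at s within {0..t})"
      unfolding has_real_derivative_iff_has_vector_derivative[symmetric] F_def[abs_def] h_def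
      using w by (auto intro!: derivative_eq_intros simp: field_simps)
  qed
  have gt: "continuous_on {0..t} (g n)" using g(1) t01 by (auto intro: continuous_on_subset)
  have "cmod (integral {0..t} (\<lambda>s. exp (s * L) *\<^sub>R g n s)) \<le> integral {0..t} h"
  proof (rule integral_norm_bound_integral)
    show "(\<lambda>s. exp (s * L) *\<^sub>R g n s) integrable_on {0..t}"
      by (intro integrable_continuous_real continuous_intros gt)
    show "h integrable_on {0..t}" using F' by blast
    fix s assume s: "s \<in> {0..t}"
    have "exp (s * L) = exp (t * L) * exp (- (t - s) * L)"
      by (simp add: exp_add[symmetric] algebra_simps)
    also have "\<dots> \<le> exp (t * L) * (K * exp (- (t - s) * w\<^sup>2))"
      unfolding K_def L_def w_def by (intro mult_left_mono exp_ks_symbol_le) (use s t01 in auto)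
    finally have "exp (s * L) * cmod (g n s) \<le> (exp (t * L) * (K * exp (- (t - s) * w\<^sup>2))) * G"
      by (intro mult_mono g(2)) (use s t01 in \<open>auto simp: K_def\<close>)
    then show "norm (exp (s * L) *\<^sub>R g n s) \<le> h s" by (simp add: h_def mult_ac)
  qed
  also have "integral {0..t} h = F t - F 0" using F' by (rule integral_unique)
  finally have "cmod (duhamel lam g n t) \<le> exp (- t * L) * (F t - F 0)"
    by (simp add: duhamel_def L_def[symmetric] mult_left_mono)
  also have "\<dots> = (exp (- t * L) * exp (t * L)) * (K * G * ((1 - exp (- (t * w\<^sup>2))) / w\<^sup>2))"
    by (simp add: F_def right_diff_distrib diff_divide_distrib mult_ac)
  also have "\<dots> = K * G * ((1 - exp (- (t * w\<^sup>2))) / w\<^sup>2)"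
    by (simp add: exp_add[symmetric])
  also have "\<dots> \<le> K * G * (sqrt T / w)"
  proof (intro mult_left_mono)
    define y where "y = t * w\<^sup>2"
    have y: "y \<ge> 0" using t01 by (simp add: y_def)
    have "1 - exp (- y) \<le> y" using exp_ge_add_one_self[of "- y"] by simp
    moreover have "y \<le> sqrt y" if "y \<le> 1"
      using y that by (intro real_le_rsqrt) (simp add: power2_eq_square mult_left_le)
    moreover have "1 - exp (- y) \<le> 1" by simp
    moreover have "1 \<le> sqrt y" if "y > 1" using that by simp
    ultimately have "1 - exp (- y) \<le> sqrt y" by linarith
    also have "sqrt y = sqrt t * w" using w by (simp add: y_def real_sqrt_mult)
    also have "\<dots> \<le> sqrt T * w" using w t01 by (intro mult_right_mono) auto
    finally have "(1 - exp (- y)) / w\<^sup>2 \<le> sqrt T * w / w\<^sup>2"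
      by (intro divide_right_mono) auto
    then show "(1 - exp (- (t * w\<^sup>2))) / w\<^sup>2 \<le> sqrt T / w"
      using w by (simp add: y_def power2_eq_square)
  qed (use G in \<open>auto simp: K_def\<close>)
  finally show ?thesis by (simp add: K_def w_def mult_ac)
qed

lemma majorized_duhamel:
  assumes "majorized s T R g" "\<And>n. continuous_on {0..T} (g n)" "0 \<le> T" "T \<le> 1"
  shows "majorized (Suc s) T (exp (ks_shift lam) * sqrt T * R) (duhamel lam g)"
proof -
  obtain a where a: "\<And>n t. t \<in> {0..T} \<Longrightarrow> cmod (g n t) \<le> a n" "\<And>n. 0 \<le> a n"
    "(\<lambda>n. wt n ^ s * a n) summable_on UNIV" "(\<Sum>\<^sub>\<infinity>n. wt n ^ s * a n) \<le> R"
    by (rule majorizedE[OF assms(1)]) (rule that)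
  define K where "K = exp (ks_shift lam) * sqrt T"
  have K: "K \<ge> 0" using assms by (simp add: K_def)
  have eq: "(\<lambda>n. wt n ^ Suc s * (K / wt n * a n)) = (\<lambda>n. K * (wt n ^ s * a n))"
    by (simp add: fun_eq_iff less_imp_neq[OF wt_pos, THEN not_sym])
  show ?thesis unfolding K_def[symmetric]
  proof (rule majorizedI[of _ _ "\<lambda>n. K / wt n * a n"])
    show "cmod (duhamel lam g n t) \<le> K / wt n * a n" if "t \<in> {0..T}" for n t
      unfolding K_def by (rule duhamel_bound) (use a assms that in auto)
    show "0 \<le> K / wt n * a n" for n using K a wt_pos[of n] by simp
    show "(\<lambda>n. wt n ^ Suc s * (K / wt n * a n)) summable_on UNIV"
      unfolding eq by (intro summable_on_cmult_right a)
    show "(\<Sum>\<^sub>\<infinity>n. wt n ^ Suc s * (K / wt n * a n)) \<le> K * R"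
      unfolding eq infsum_cmult_right' by (intro mult_left_mono a K)
  qed
qed

lemma duhamel_diff:
  fixes g h :: "int^'d \<Rightarrow> real \<Rightarrow> complex"
  assumes "continuous_on {0..T} (g n)" "continuous_on {0..T} (h n)" "t \<in> {0..T}"
  shows "duhamel lam g n t - duhamel lam h n t = duhamel lam (\<lambda>n t. g n t - h n t) n t"
proof -
  have "(\<lambda>s. exp (s * ks_symbol lam n) *\<^sub>R f n s) integrable_on {0..t}"
    if "continuous_on {0..T} (f n)" for f :: "int^'d \<Rightarrow> real \<Rightarrow> complex"
    by (intro integrable_continuous_real continuous_intros continuous_on_subset[OF that])
      (use assms in auto)
  from this[of g] this[of h] show ?thesis
    using assms by (simp add: duhamel_def integral_diff scaleR_diff_right)
qed

section \<open>The advection term\<close>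

definition advect :: "('d \<Rightarrow> int^'d \<Rightarrow> real \<Rightarrow> complex) \<Rightarrow> ('d \<Rightarrow> int^'d \<Rightarrow> real \<Rightarrow> complex) \<Rightarrow>
    'd \<Rightarrow> int^'d \<Rightarrow> real \<Rightarrow> complex" where
  "advect u v j n t = (\<Sum>i\<in>UNIV. conv (u i) (d_coeff i (v j)) n t)"

lemma continuous_on_d_coeff:
  "continuous_on S (c n) \<Longrightarrow> continuous_on S (d_coeff i c n)"
  unfolding d_coeff_def[abs_def] by (intro continuous_intros)

lemma majorized_advect:
  assumes "\<And>j. majorized s T R (u j)" "\<And>j. majorized (Suc s) T Q (v j)"
  shows "majorized s T (of_nat CARD('d) * (R * Q)) (advect u v (j::'d::finite))"
  using majorized_sum[of UNIV s T "\<lambda>_. R * Q" "\<lambda>i. conv (u i) (d_coeff i (v j))",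
      OF _ majorized_conv[OF assms(1) majorized_d_coeff[OF assms(2)]]]
  by (simp add: advect_def[abs_def])

lemma continuous_on_advect:
  assumes "\<And>j. majorized s T R (u j)" "\<And>j. majorized (Suc s) T Q (v j)"
    and "\<And>j n. continuous_on {0..T} (u j n)" "\<And>j n. continuous_on {0..T} (v j n)"
  shows "continuous_on {0..T} (advect u v (j::'d::finite) n)"
  unfolding advect_def[abs_def]
  by (intro continuous_on_sum continuous_on_conv[OF assms(1) majorized_d_coeff[OF assms(2)]]
      assms(3,4) continuous_on_d_coeff)

text \<open>Bilinearity: add and subtract the mixed product. The bounds one order higher provide the
  summability of the differentiated factors that splitting the infinite sums needs.\<close>

lemma advect_diff:
  assumes u: "\<And>j. majorized (Suc s) T R (u j)" and v: "\<And>j. majorized (Suc s) T Q (v j)" and t: "t \<in> {0..T}"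
  shows "advect u u j n t - advect v v j n t =
    advect (\<lambda>j n t. u j n t - v j n t) u j n t + advect v (\<lambda>j n t. u j n t - v j n t) j n t"
proof -
  have "conv (u i) (d_coeff i (u j)) n t - conv (v i) (d_coeff i (v j)) n t =
      conv (\<lambda>n t. u i n t - v i n t) (d_coeff i (u j)) n t +
      conv (v i) (d_coeff i (\<lambda>n t. u j n t - v j n t)) n t" for i
  proof -
    have m: "majorized s T R (u i)" "majorized s T Q (\<lambda>n t. - v i n t)" "majorized s T Q (v i)"
        "majorized s T R (d_coeff i (u j))" "majorized s T Q (\<lambda>n t. - d_coeff i (v j) n t)"
      using majorized_weaken[OF u le_SucI[OF order_refl] order_refl]
        majorized_weaken[OF v le_SucI[OF order_refl] order_refl] u v
      by (auto intro!: majorized_uminus majorized_d_coeff)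
    have "d_coeff i (\<lambda>n t. u j n t - v j n t) = (\<lambda>n t. d_coeff i (u j) n t + - d_coeff i (v j) n t)"
      by (simp add: d_coeff_def fun_eq_iff algebra_simps)
    then show ?thesis
      using conv_add_left[OF m(1,2,4) t] conv_add_right[OF m(4,5,3) t] by (simp add: conv_uminus)
  qed
  then show ?thesis by (simp add: advect_def sum_subtractf[symmetric] sum.distrib[symmetric])
qed

section \<open>Coefficient symmetry of real functions\<close>

definition hermitian :: "(int^'d \<Rightarrow> real \<Rightarrow> complex) \<Rightarrow> bool" where
  "hermitian c \<longleftrightarrow> (\<forall>n t. c (- n) t = cnj (c n t))"

lemma hermitian_heat: "(\<And>n. c (- n) = cnj (c n)) \<Longrightarrow> hermitian (heat lam c)"
  by (simp add: hermitian_def heat_def)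

lemma hermitian_duhamel:
  assumes "hermitian g"
  shows "hermitian (duhamel lam g)"
proof -
  have "(\<lambda>s. exp (s * ks_symbol lam n) *\<^sub>R g (- n) s) = (\<lambda>s. cnj (exp (s * ks_symbol lam n) *\<^sub>R g n s))" for n
    using assms by (simp add: hermitian_def)
  then show ?thesis unfolding hermitian_def duhamel_def by (simp add: integral_cnj)
qed

lemma hermitian_conv:
  assumes "hermitian u" "hermitian v"
  shows "hermitian (conv u v)"
proof -
  have "conv u v (- n) t = cnj (conv u v n t)" for n t
  proof -
    have "conv u v (- n) t = (\<Sum>\<^sub>\<infinity>k. u (- k) t * v (- (n - k)) t)" unfolding conv_def
      by (rule infsum_reindex_bij_witness[of _ uminus uminus]) (simp_all add: minus_diff_commute[of n])
    also have "\<dots> = (\<Sum>\<^sub>\<infinity>k. cnj (u k t * v (n - k) t))"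
      using assms by (simp add: hermitian_def del: minus_diff_eq)
    also have "\<dots> = cnj (conv u v n t)" unfolding conv_def by (rule infsum_cnj)
    finally show ?thesis .
  qed
  then show ?thesis by (simp add: hermitian_def)
qed

lemma hermitian_d_coeff: "hermitian c \<Longrightarrow> hermitian (d_coeff i c)"
  by (simp add: hermitian_def d_coeff_def)

lemma hermitian_advect:
  "(\<And>j. hermitian (u j)) \<Longrightarrow> (\<And>j. hermitian (v j)) \<Longrightarrow> hermitian (advect u v (j::'d::finite))"
  using hermitian_conv[OF _ hermitian_d_coeff, of "u i" "v j" i for i]
  by (simp add: hermitian_def[of "advect u v j"] hermitian_def[of "conv _ _"] advect_def)



section \<open>Completeness of the norm and Picard iteration\<close>

lemma majorized_cong:
  assumes "majorized s T R c" "\<And>n t. t \<in> {0..T} \<Longrightarrow> d n t = c n t"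
  shows "majorized s T R d"
  using majorized_symbol[of s 0 T R c 1 d] assms by simp

text \<open>Completeness for the norm with the supremum inside the sum. A majorant is chosen for
  every step, and the sum of all majorants from index \<open>N\<close> on dominates the distance of
  the limit from \<open>c N\<close>. Exchanging the sums over steps and frequencies bounds its
  weighted sum by the geometric tail \<open>2 * C * (1/2)^N\<close>. The resulting convergence is
  uniform in \<open>t\<close>, so continuity survives.\<close>

lemma majorized_limit:
  fixes c :: "nat \<Rightarrow> int^'d \<Rightarrow> real \<Rightarrow> complex"
  assumes cont: "\<And>N n. continuous_on {0..T} (c N n)"
    and step: "\<And>N. majorized s T (C * (1/2)^N) (\<lambda>n t. c (Suc N) n t - c N n t)"
  obtains c' where "\<And>n. continuous_on {0..T} (c' n)"
    "\<And>N. majorized s T (2 * C * (1/2)^N) (\<lambda>n t. c' n t - c N n t)"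
    "\<And>n t. t \<in> {0..T} \<Longrightarrow> (\<lambda>N. c N n t) \<longlonglongrightarrow> c' n t"
proof -
  have C: "C \<ge> 0" using majorized_nonneg[OF step[of 0]] by simp
  define P where "P N a \<longleftrightarrow> (\<forall>n. \<forall>t\<in>{0..T}. cmod (c (Suc N) n t - c N n t) \<le> a n) \<and> (\<forall>n. 0 \<le> a n) \<and>
     (\<lambda>n. wt n ^ s * a n) summable_on UNIV \<and> (\<Sum>\<^sub>\<infinity>n. wt n ^ s * a n) \<le> C * (1/2)^N" for N and a :: "int^'d \<Rightarrow> real"
  have "\<exists>a. P N a" for N using step[of N] unfolding majorized_def P_def .
  then obtain a where "\<And>N. P N (a N)" by metis
  then have a: "\<And>N n t. t \<in> {0..T} \<Longrightarrow> cmod (c (Suc N) n t - c N n t) \<le> a N n" "\<And>N n. 0 \<le> a N n"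
     "\<And>N. (\<lambda>n. wt n ^ s * a N n) summable_on UNIV" "\<And>N. (\<Sum>\<^sub>\<infinity>n. wt n ^ s * a N n) \<le> C * (1/2)^N"
    unfolding P_def by auto
  have geom: "((\<lambda>M. C * (1/2)^(N + M)) has_sum (2 * C * (1/2)^N)) UNIV" for N
  proof -
    have "(\<lambda>M. C * (1/2)^N * (1/2)^M) sums (C * (1/2)^N * (1 / (1 - 1/2)))"
      by (intro sums_mult geometric_sums) auto
    then have "(\<lambda>M. C * (1/2)^(N + M)) sums (2 * C * (1/2)^N)" by (simp add: power_add mult_ac)
    then show ?thesis by (rule sums_nonneg_imp_has_sum) (simp add: C)
  qed
  have a_le: "a N n \<le> C * (1/2)^N" for N n
  proof -
    have "1 * a N n \<le> wt n ^ s * a N n" by (intro mult_right_mono a one_le_power wt_ge_1)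
    also have "\<dots> = (\<Sum>n\<in>{n}. wt n ^ s * a N n)" by simp
    also have "\<dots> \<le> (\<Sum>\<^sub>\<infinity>n. wt n ^ s * a N n)"
      by (rule finite_sum_le_infsum) (use a in \<open>auto intro!: wt_pow_mult_nonneg\<close>)
    finally show ?thesis using a(4)[of N] by simp
  qed
  have a_summ: "(\<lambda>M. a (N + M) n) summable_on UNIV" for N n
    by (rule summable_on_comparison_test[OF has_sum_imp_summable[OF geom[of N]]]) (use a a_le in auto)
  define m where "m N n = (\<Sum>\<^sub>\<infinity>M. a (N + M) n)" for N n
  have m0: "m N n \<ge> 0" for N n unfolding m_def by (rule infsum_nonneg) (use a in auto)
  have m: "(\<lambda>n. wt n ^ s * m N n) summable_on UNIV \<and> (\<Sum>\<^sub>\<infinity>n. wt n ^ s * m N n) \<le> 2 * C * (1/2)^N" for N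
  proof -
    define F where "F = (\<lambda>(M, n). wt n ^ s * a (N + M) n)"
    define g where "g M = (\<Sum>\<^sub>\<infinity>n. wt n ^ s * a (N + M) n)" for M
    have g: "((\<lambda>n. F (M, n)) has_sum g M) UNIV" for M
      unfolding F_def g_def prod.case by (rule has_sum_infsum[OF a(3)])
    have g0: "g M \<ge> 0" for M
      unfolding g_def by (rule infsum_nonneg) (use a in \<open>auto intro!: wt_pow_mult_nonneg\<close>)
    have gs: "g summable_on UNIV"
      by (rule summable_on_comparison_test[OF has_sum_imp_summable[OF geom[of N]]])
        (use a(4) g0 in \<open>auto simp: g_def\<close>)
    have F: "F summable_on UNIV \<times> UNIV"
      by (rule summable_on_SigmaI[OF g gs]) (use a in \<open>auto simp: F_def intro!: wt_pow_mult_nonneg\<close>)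
    have FS: "(F has_sum infsum g UNIV) (UNIV \<times> UNIV)"
      by (rule has_sum_SigmaI[OF g has_sum_infsum[OF gs] F])
    have swap: "((\<lambda>(n, M). F (M, n)) has_sum infsum g UNIV) (UNIV \<times> UNIV)"
      using FS has_sum_swap by blast
    have inner: "((\<lambda>M. wt n ^ s * a (N + M) n) has_sum (wt n ^ s * m N n)) UNIV" for n
      unfolding m_def by (intro has_sum_cmult_right has_sum_infsum a_summ)
    have *: "((\<lambda>n. wt n ^ s * m N n) has_sum infsum g UNIV) UNIV"
      by (rule has_sum_SigmaD[OF swap]) (simp add: F_def inner)
    have "infsum g UNIV \<le> 2 * C * (1/2)^N"
      by (rule has_sum_mono[OF has_sum_infsum[OF gs] geom[of N]]) (use a(4) in \<open>auto simp: g_def\<close>)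
    then show ?thesis using has_sum_imp_summable[OF *] infsumI[OF *] by simp
  qed
  have tele: "cmod (c (N + K) n t - c N n t) \<le> (\<Sum>M<K. a (N + M) n)" if "t \<in> {0..T}" for N K n t
  proof (induction K)
    case (Suc K)
    have "cmod (c (N + Suc K) n t - c N n t) \<le> cmod (c (Suc (N + K)) n t - c (N + K) n t) + cmod (c (N + K) n t - c N n t)"
      using norm_triangle_ineq[of "c (Suc (N + K)) n t - c (N + K) n t" "c (N + K) n t - c N n t"] by simp
    then show ?case using Suc a(1)[OF that, of "N + K" n] by simp
  qed simp
  have tele': "cmod (c (N + K) n t - c N n t) \<le> m N n" if "t \<in> {0..T}" for N K n t
  proof -
    have "(\<Sum>M<K. a (N + M) n) \<le> m N n"
      unfolding m_def by (rule finite_sum_le_infsum[OF a_summ]) (use a in auto)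
    then show ?thesis using tele[OF that, of N K n] by simp
  qed
  \<comment> \<open>Outside \<open>{0..T}\<close> nothing is known about convergence and
    \<open>lim\<close> has no meaning there, so every property of the limit is restricted to the
    interval.\<close>
  define c' where "c' n t = lim (\<lambda>N. c N n t)" for n t
  have lim: "(\<lambda>N. c N n t) \<longlonglongrightarrow> c' n t" if t: "t \<in> {0..T}" for n t
  proof -
    have "summable (\<lambda>N. c (Suc N) n t - c N n t)"
    proof (rule summable_comparison_test')
      show "summable (\<lambda>N. a N n)" using summable_on_imp_summable[OF a_summ[of 0 n]] by simp
    qed (use a t in auto)
    then have "(\<lambda>N. \<Sum>M<N. c (Suc M) n t - c M n t) \<longlonglongrightarrow> suminf (\<lambda>N. c (Suc N) n t - c N n t)"
      by (rule summable_LIMSEQ)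
    then have "(\<lambda>N. c N n t - c 0 n t) \<longlonglongrightarrow> suminf (\<lambda>N. c (Suc N) n t - c N n t)"
      by (simp only: sum_lessThan_telescope[where f = "\<lambda>N. c N n t"])
    from tendsto_add[OF this tendsto_const[of "c 0 n t"]]
    have "(\<lambda>N. c N n t) \<longlonglongrightarrow> suminf (\<lambda>N. c (Suc N) n t - c N n t) + c 0 n t" by simp
    then have "convergent (\<lambda>N. c N n t)" unfolding convergent_def by auto
    then show ?thesis unfolding c'_def by (simp add: convergent_LIMSEQ_iff)
  qed
  have dist: "cmod (c' n t - c N n t) \<le> m N n" if t: "t \<in> {0..T}" for n t N
  proof (rule LIMSEQ_le_const2)
    show "(\<lambda>K. cmod (c (N + K) n t - c N n t)) \<longlonglongrightarrow> cmod (c' n t - c N n t)"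
      using LIMSEQ_ignore_initial_segment[OF lim[OF t, of n], of N]
      by (intro tendsto_intros) (simp add: add.commute)
  qed (use tele'[OF t] in auto)
  have maj: "majorized s T (2 * C * (1/2)^N) (\<lambda>n t. c' n t - c N n t)" for N
    by (rule majorizedI[of T _ "m N"]) (use dist m m0 in auto)
  have "continuous_on {0..T} (c' n)" for n
  proof (rule uniform_limit_theorem[where F = sequentially])
    show "uniform_limit {0..T} (\<lambda>N t. c N n t) (c' n) sequentially"
    proof (rule uniform_limitI)
      fix e :: real assume "e > 0"
      have "(\<lambda>N. 2 * C * (1/2)^N) \<longlonglongrightarrow> 2 * C * 0"
        by (intro tendsto_mult tendsto_const LIMSEQ_realpow_zero) auto
      then have "\<forall>\<^sub>F N in sequentially. 2 * C * (1/2)^N < e"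
        using \<open>e > 0\<close> by (intro order_tendstoD) auto
      then show "\<forall>\<^sub>F N in sequentially. \<forall>t\<in>{0..T}. dist (c N n t) (c' n t) < e"
      proof eventually_elim
        case (elim N)
        show ?case
        proof
          fix t assume "t \<in> {0..T}"
          from majorized_bound[OF maj[of N] this, of n] elim
          show "dist (c N n t) (c' n t) < e" by (simp add: dist_norm norm_minus_commute)
        qed
      qed
    qed
  qed (use cont in auto)
  from that[OF this maj lim] show ?thesis .
qed

definition picard :: "real \<Rightarrow> ('d \<Rightarrow> int^'d \<Rightarrow> complex) \<Rightarrow> ('d \<Rightarrow> int^'d \<Rightarrow> real \<Rightarrow> complex) \<Rightarrow>
    'd \<Rightarrow> int^'d \<Rightarrow> real \<Rightarrow> complex" where
  "picard lam c0 u j n t = heat lam (c0 j) n t - duhamel lam (advect u u j) n t"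

lemma majorized_Suc: "majorized (Suc s) T R c \<Longrightarrow> majorized s T R c"
  by (rule majorized_weaken) auto

lemma continuous_on_picard:
  fixes u :: "'d::finite \<Rightarrow> int^'d \<Rightarrow> real \<Rightarrow> complex"
  assumes "\<And>j. majorized (Suc s) T R (u j)" "\<And>j n. continuous_on {0..T} (u j n)"
  shows "continuous_on {0..T} (picard lam c0 u j n)"
  unfolding picard_def[abs_def]
  by (intro continuous_on_diff continuous_on_heat continuous_on_duhamel
      continuous_on_advect[OF majorized_Suc[OF assms(1)] assms(1)] assms(2))

lemma majorized_picard:
  fixes u :: "'d::finite \<Rightarrow> int^'d \<Rightarrow> real \<Rightarrow> complex"
  assumes u: "\<And>j. majorized (Suc s) T R (u j)" "\<And>j n. continuous_on {0..T} (u j n)"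
    and T: "0 \<le> T" "T \<le> 1" and heat: "majorized (Suc s) T H (heat lam (c0 j))"
  shows "majorized (Suc s) T (H + exp (ks_shift lam) * sqrt T * (of_nat CARD('d) * (R * R))) (picard lam c0 u j)"
  unfolding picard_def[abs_def]
  by (intro majorized_diff heat majorized_duhamel T
      majorized_advect[OF majorized_Suc[OF u(1)] u(1)]
      continuous_on_advect[OF majorized_Suc[OF u(1)] u(1)] u(2))

text \<open>The linear evolution of the data cancels, and each of the two bilinear terms of
  \<open>advect_diff\<close> contributes \<open>R * \<delta>\<close>; the Duhamel integral restores
  the lost derivative and supplies \<open>sqrt T\<close>.\<close>

lemma picard_contraction:
  fixes u v :: "'d::finite \<Rightarrow> int^'d \<Rightarrow> real \<Rightarrow> complex"
  assumes u: "\<And>j. majorized (Suc s) T R (u j)" "\<And>j n. continuous_on {0..T} (u j n)"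
    and v: "\<And>j. majorized (Suc s) T R (v j)" "\<And>j n. continuous_on {0..T} (v j n)"
    and T: "0 \<le> T" "T \<le> 1"
    and uv: "\<And>j. majorized (Suc s) T \<delta> (\<lambda>n t. u j n t - v j n t)"
  shows "majorized (Suc s) T (exp (ks_shift lam) * sqrt T * (of_nat CARD('d) * (2 * R * \<delta>)))
    (\<lambda>n t. picard lam c0 u j n t - picard lam c0 v j n t)"
proof -
  let ?g = "\<lambda>n t. advect u u j n t - advect v v j n t"
  note cu = continuous_on_advect[OF majorized_Suc[OF u(1)] u(1) u(2) u(2)]
  note cv = continuous_on_advect[OF majorized_Suc[OF v(1)] v(1) v(2) v(2)]
  have "majorized s T (of_nat CARD('d) * (\<delta> * R) + of_nat CARD('d) * (R * \<delta>))
    (\<lambda>n t. advect (\<lambda>j n t. u j n t - v j n t) u j n t + advect v (\<lambda>j n t. u j n t - v j n t) j n t)"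
    by (intro majorized_add majorized_advect majorized_Suc[OF uv] u majorized_Suc[OF v(1)] uv)
  then have "majorized s T (of_nat CARD('d) * (\<delta> * R) + of_nat CARD('d) * (R * \<delta>)) ?g"
    by (rule majorized_cong) (rule advect_diff[OF u(1) v(1)])
  then have g: "majorized s T (of_nat CARD('d) * (2 * R * \<delta>)) ?g"
    by (simp add: algebra_simps)
  have "majorized (Suc s) T (exp (ks_shift lam) * sqrt T * (of_nat CARD('d) * (2 * R * \<delta>))) (\<lambda>n t. - duhamel lam ?g n t)"
    by (intro majorized_uminus majorized_duhamel[OF g] T continuous_on_diff cu cv)
  then show ?thesis
    by (rule majorized_cong)
      (use duhamel_diff[where g = "advect u u j" and h = "advect v v j", OF cu cv] in \<open>simp add: picard_def algebra_simps\<close>)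
qed

lemma hermitian_picard:
  assumes "\<And>j n. c0 j (- n) = cnj (c0 j n)" "\<And>j. hermitian (u j)"
  shows "hermitian (picard lam c0 u (j::'d::finite))"
  using hermitian_heat[of "c0 j" lam] hermitian_duhamel[OF hermitian_advect[of u u j], of lam] assms
  by (simp add: hermitian_def picard_def)

lemma mild_solution_exists:
  fixes c0 :: "'d::finite \<Rightarrow> int^'d \<Rightarrow> complex"
  assumes c0: "\<And>j. (\<lambda>n. wt n ^ Suc s * cmod (c0 j n)) summable_on UNIV"
    and herm: "\<And>j n. c0 j (- n) = cnj (c0 j n)"
  obtains T R u where "0 < T" "\<And>j. majorized (Suc s) T R (u j)" "\<And>j n. continuous_on {0..T} (u j n)"
    "\<And>j n t. t \<in> {0..T} \<Longrightarrow> u j (- n) t = cnj (u j n t)"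
    "\<And>j n t. t \<in> {0..T} \<Longrightarrow> u j n t = picard lam c0 u j n t"
proof -
  define K where "K = exp (ks_shift lam)"
  \<comment> \<open>\<open>H\<close> bounds the linear evolution of every component, a sum standing
    in for a maximum. The \<open>+ 1\<close> in \<open>P\<close> keeps it positive for zero data.
    The choice of \<open>e\<close>, which is \<open>sqrt T\<close>, gives
    \<open>K * e * D * P \<le> 1 / 4\<close>: the quadratic term is then at most
    \<open>P / 4\<close>, so the ball of radius \<open>P\<close> is preserved, and the Lipschitz
    constant is at most \<open>1 / 2\<close>.\<close>
  define H where "H = (\<Sum>j\<in>UNIV. K * (\<Sum>\<^sub>\<infinity>n. wt n ^ Suc s * cmod (c0 j n)))"
  define D where "D = real CARD('d)"
  define P where "P = 2 * (H + 1)"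
  define e where "e = min 1 (1 / (4 * K * D * P))"
  define T where "T = e\<^sup>2"
  have K: "K > 0" by (simp add: K_def)
  have D: "D > 0" by (simp add: D_def)
  have nn: "0 \<le> K * (\<Sum>\<^sub>\<infinity>n. wt n ^ Suc s * cmod (c0 j n))" for j
    using K by (intro mult_nonneg_nonneg infsum_nonneg wt_pow_mult_nonneg) auto
  have H: "H \<ge> 0" unfolding H_def by (intro sum_nonneg nn)
  have P: "P > 0" using H by (simp add: P_def)
  have e: "0 < e" "e \<le> 1" using K D P by (auto simp: e_def)
  have T: "0 < T" "0 \<le> T" "T \<le> 1" "sqrt T = e" using e by (auto simp: T_def power_le_one)
  have small: "K * e * (D * P) \<le> 1 / 4"
  proof -
    have "e \<le> 1 / (4 * K * D * P)" by (simp add: e_def)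
    then have "K * e * (D * P) \<le> K * (1 / (4 * K * D * P)) * (D * P)"
      using K D P by (intro mult_right_mono mult_left_mono) auto
    also have "\<dots> = 1 / 4" using K D P by (simp add: field_simps)
    finally show ?thesis .
  qed
  have heat: "majorized (Suc s) T H (heat lam (c0 j))" for j
  proof (rule majorized_weaken[OF majorized_heat[OF c0 T(3)] order_refl])
    show "exp (ks_shift lam) * (\<Sum>\<^sub>\<infinity>n. wt n ^ Suc s * cmod (c0 j n)) \<le> H"
      unfolding H_def K_def[symmetric]
      by (rule member_le_sum[where f = "\<lambda>j. K * (\<Sum>\<^sub>\<infinity>n. wt n ^ Suc s * cmod (c0 j n))"]) (use nn in auto)
  qed
  define U where "U N = ((picard lam c0) ^^ N) (\<lambda>_ _ _. 0)" for N
  have U0: "U 0 = (\<lambda>_ _ _. 0)" and USuc: "U (Suc N) = picard lam c0 (U N)" for N by (simp_all add: U_def)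
  have UP: "(\<forall>j. majorized (Suc s) T P (U N j)) \<and> (\<forall>j n. continuous_on {0..T} (U N j n))" for N
  proof (induction N)
    case 0
    then show ?case using majorized_weaken[OF majorized_zero order_refl, of P "Suc s" T] P by (simp add: U0)
  next
    case (Suc N)
    have "H + exp (ks_shift lam) * sqrt T * (of_nat CARD('d) * (P * P)) \<le> P"
    proof -
      have "K * e * (D * P) * P \<le> 1 / 4 * P" using small P by (intro mult_right_mono) auto
      then have "K * e * (D * (P * P)) \<le> 1 / 4 * P" by (simp only: mult.assoc)
      moreover have "H \<le> 3 / 4 * P" using H by (simp add: P_def)
      ultimately show ?thesis unfolding K_def[symmetric] T D_def[symmetric] by linarith
    qed
    note * = majorized_weaken[OF majorized_picard[OF _ _ T(2,3) heat] order_refl this]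
    have "majorized (Suc s) T P (U (Suc N) j)" for j
      unfolding USuc by (rule *) (use Suc in auto)
    moreover have "continuous_on {0..T} (U (Suc N) j n)" for j n
      unfolding USuc by (rule continuous_on_picard) (use Suc in auto)
    ultimately show ?case by blast
  qed
  have contr: "majorized (Suc s) T (1 / 2 * \<delta>) (\<lambda>n t. picard lam c0 u j n t - picard lam c0 v j n t)"
    if "\<And>j. majorized (Suc s) T P (u j)" "\<And>j n. continuous_on {0..T} (u j n)"
      "\<And>j. majorized (Suc s) T P (v j)" "\<And>j n. continuous_on {0..T} (v j n)"
      "\<And>j. majorized (Suc s) T \<delta> (\<lambda>n t. u j n t - v j n t)" for u v \<delta> j
  proof (rule majorized_weaken[OF picard_contraction[OF that(1-4) T(2,3) that(5)] order_refl])
    have "\<delta> \<ge> 0" using majorized_nonneg[OF that(5)] .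
    then have "K * e * (D * P) * (2 * \<delta>) \<le> 1 / 4 * (2 * \<delta>)" using small by (intro mult_right_mono) auto
    then show "exp (ks_shift lam) * sqrt T * (of_nat CARD('d) * (2 * P * \<delta>)) \<le> 1 / 2 * \<delta>"
      by (simp add: K_def[symmetric] T D_def[symmetric] mult_ac)
  qed
  have step: "majorized (Suc s) T ((H + 1) * (1/2)^N) (\<lambda>n t. U (Suc N) j n t - U N j n t)" for N j
  proof (induction N arbitrary: j)
    case 0
    have "majorized (Suc s) T (H + exp (ks_shift lam) * sqrt T * (of_nat CARD('d) * (0 * 0))) (picard lam c0 (U 0) j)"
      by (rule majorized_picard[OF _ _ T(2,3) heat]) (auto simp: U0 majorized_zero)
    then show ?case unfolding USuc by (auto simp: U0 intro: majorized_weaken)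
  next
    case (Suc N)
    have "majorized (Suc s) T (1 / 2 * ((H + 1) * (1/2)^N)) (\<lambda>n t. U (Suc (Suc N)) j n t - U (Suc N) j n t)"
      unfolding USuc[of "Suc N"] USuc[of N]
      by (rule contr[OF _ _ _ _ Suc[unfolded USuc]]) (use UP[of N] UP[of "Suc N", unfolded USuc] in auto)
    then show ?case by simp
  qed
  define Q where "Q j c' \<longleftrightarrow> (\<forall>n. continuous_on {0..T} (c' n)) \<and>
    (\<forall>N. majorized (Suc s) T (2 * (H + 1) * (1/2)^N) (\<lambda>n t. c' n t - U N j n t)) \<and>
    (\<forall>n. \<forall>t\<in>{0..T}. (\<lambda>N. U N j n t) \<longlonglongrightarrow> c' n t)" for j c'
  have "\<exists>c'. Q j c'" for j
  proof -
    have "continuous_on {0..T} (U N j n)" for N n using UP by simp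
    note * = majorized_limit[where c = "\<lambda>N. U N j", OF this step]
    obtain c' where "\<And>n. continuous_on {0..T} (c' n)"
      "\<And>N. majorized (Suc s) T (2 * (H + 1) * (1/2)^N) (\<lambda>n t. c' n t - U N j n t)"
      "\<And>n t. t \<in> {0..T} \<Longrightarrow> (\<lambda>N. U N j n t) \<longlonglongrightarrow> c' n t"
      by (rule *) (rule that)
    then show ?thesis unfolding Q_def by (intro exI[of _ c']) simp
  qed
  from choice[OF allI[OF this]] obtain u where "\<forall>j. Q j (u j)" ..
  then have u: "\<And>j n. continuous_on {0..T} (u j n)"
    "\<And>j N. majorized (Suc s) T (2 * (H + 1) * (1/2)^N) (\<lambda>n t. u j n t - U N j n t)"
    "\<And>j n t. t \<in> {0..T} \<Longrightarrow> (\<lambda>N. U N j n t) \<longlonglongrightarrow> u j n t"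
    unfolding Q_def by auto
  \<comment> \<open>As \<open>U 0 = 0\<close>, the error estimate at \<open>N = 0\<close> reads
    \<open>2 * (H + 1) = P\<close>, so the limit lies in the ball where the contraction estimate is
    available.\<close>
  have uP: "majorized (Suc s) T P (u j)" for j using u(2)[of 0 j] by (simp add: U0 P_def)
  have fix_eq: "u j n t = picard lam c0 u j n t" if t: "t \<in> {0..T}" for j n t
  proof -
    \<comment> \<open>Both sides are compared with \<open>U (Suc N)\<close>: one by convergence of
      the iterates, the other by the contraction applied to \<open>u\<close> and
      \<open>U N\<close>.\<close>
    have "cmod (u j n t - picard lam c0 u j n t) \<le> (P + P) * (1/2)^N" for N
    proof -
      have "majorized (Suc s) T (1 / 2 * (2 * (H + 1) * (1/2)^N)) (\<lambda>n t. picard lam c0 u j n t - picard lam c0 (U N) j n t)"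
        by (rule contr) (use u uP UP in auto)
      then have "cmod (picard lam c0 u j n t - U (Suc N) j n t) \<le> 1 / 2 * (2 * (H + 1) * (1/2)^N)"
        unfolding USuc[symmetric] by (rule majorized_bound[OF _ t])
      moreover have "cmod (u j n t - U (Suc N) j n t) \<le> 2 * (H + 1) * (1/2)^Suc N"
        by (rule majorized_bound[OF u(2) t])
      moreover have "cmod (u j n t - picard lam c0 u j n t) \<le>
          cmod (u j n t - U (Suc N) j n t) + cmod (picard lam c0 u j n t - U (Suc N) j n t)"
        using norm_triangle_ineq4[of "u j n t - U (Suc N) j n t" "picard lam c0 u j n t - U (Suc N) j n t"] by simp
      moreover have "0 \<le> (H + 1) * (1/2)^N" using H by simp
      ultimately show ?thesis by (simp add: P_def algebra_simps)
    qed
    moreover have "(\<lambda>N. (P + P) * (1/2)^N) \<longlonglongrightarrow> (P + P) * 0"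
      by (intro tendsto_mult tendsto_const LIMSEQ_realpow_zero) auto
    ultimately have "cmod (u j n t - picard lam c0 u j n t) \<le> (P + P) * 0"
      by (intro LIMSEQ_le_const) auto
    then show ?thesis by simp
  qed
  \<comment> \<open>The iterates are symmetric at all real times; the limit inherits this only where
    convergence is known, on \<open>{0..T}\<close>.\<close>
  have UH: "hermitian (U N j)" for N j
    by (induction N arbitrary: j) (auto simp: U0 USuc hermitian_def[of "\<lambda>_ _. 0"] intro!: hermitian_picard herm)
  have "u j (- n) t = cnj (u j n t)" if t: "t \<in> {0..T}" for j n t
  proof (rule LIMSEQ_unique[OF u(3)[OF t]])
    show "(\<lambda>N. U N j (- n) t) \<longlonglongrightarrow> cnj (u j n t)"
      using tendsto_cnj[OF u(3)[OF t, of j n]] UH by (simp add: hermitian_def)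
  qed
  from that[OF T(1) uP u(1) this fix_eq] show ?thesis .
qed



section \<open>Regularity in time\<close>

text \<open>The qualitative form of \<open>majorized\<close>: once existence is settled, only
  finiteness of the norm matters, together with continuity in time.\<close>

definition wiener :: "nat \<Rightarrow> real \<Rightarrow> (int^'d \<Rightarrow> real \<Rightarrow> complex) \<Rightarrow> bool" where
  "wiener s T c \<longleftrightarrow> (\<forall>n. continuous_on {0..T} (c n)) \<and> (\<exists>R. majorized s T R c)"

lemma wiener_mono: "wiener s T c \<Longrightarrow> r \<le> s \<Longrightarrow> wiener r T c"
  unfolding wiener_def using majorized_weaken[OF _ _ order_refl] by blast

lemma wiener_add: "wiener s T c \<Longrightarrow> wiener s T d \<Longrightarrow> wiener s T (\<lambda>n t. c n t + d n t)"
  unfolding wiener_def by (auto intro!: continuous_on_add intro: majorized_add)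

lemma wiener_conv: "wiener s T u \<Longrightarrow> wiener s T v \<Longrightarrow> wiener s T (conv u v)"
  unfolding wiener_def using continuous_on_conv majorized_conv by blast

lemma wiener_symbol:
  assumes "wiener (s + q) T c" "K \<ge> 0" "\<And>n. cmod (p n) \<le> K * wt n ^ q"
  shows "wiener s T (\<lambda>n t. p n * c n t)"
proof -
  obtain R where "majorized (s + q) T R c" using assms(1) by (auto simp: wiener_def)
  then have "majorized s T (K * R) (\<lambda>n t. p n * c n t)"
    by (rule majorized_symbol[OF _ assms(2)]) (simp add: norm_mult mult_right_mono assms(3))
  then show ?thesis using assms(1) unfolding wiener_def by (auto intro!: continuous_intros)
qed

lemma wiener_d_coeff: "wiener (Suc s) T c \<Longrightarrow> wiener s T (d_coeff i c)"
  unfolding wiener_def using majorized_d_coeff continuous_on_d_coeff by blast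

text \<open>Each time derivative costs four powers of the weight. The subtraction is truncated, so that
  the definition is meaningful as intended for \<open>4 * j \<le> s\<close>.\<close>

primrec smooth_coeff :: "nat \<Rightarrow> nat \<Rightarrow> real \<Rightarrow> (int^'d \<Rightarrow> real \<Rightarrow> complex) \<Rightarrow> bool" where
  "smooth_coeff 0 s T c \<longleftrightarrow> wiener s T c"
| "smooth_coeff (Suc j) s T c \<longleftrightarrow> wiener s T c \<and>
     (\<exists>c'. (\<forall>n. \<forall>t\<in>{0..T}. (c n has_vector_derivative c' n t) (at t within {0..T})) \<and>
           smooth_coeff j (s - 4) T c')"

lemma smooth_coeff_SucI:
  assumes "wiener s T c" "smooth_coeff j (s - 4) T c'"
    and "\<And>n t. t \<in> {0..T} \<Longrightarrow> (c n has_vector_derivative c' n t) (at t within {0..T})"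
  shows "smooth_coeff (Suc j) s T c"
  unfolding smooth_coeff.simps using assms by (intro conjI exI[of _ c']) auto

lemma smooth_coeff_SucE:
  assumes "smooth_coeff (Suc j) s T c"
  obtains c' where "wiener s T c" "smooth_coeff j (s - 4) T c'"
    "\<And>n t. t \<in> {0..T} \<Longrightarrow> (c n has_vector_derivative c' n t) (at t within {0..T})"
proof -
  from assms obtain c' where "wiener s T c" "smooth_coeff j (s - 4) T c'"
    "\<forall>n. \<forall>t\<in>{0..T}. (c n has_vector_derivative c' n t) (at t within {0..T})"
    unfolding smooth_coeff.simps by (elim conjE exE)
  with that[of c'] show ?thesis by simp
qed

lemma smooth_coeff_wiener: "smooth_coeff j s T c \<Longrightarrow> wiener s T c"
  by (cases j) auto

lemma smooth_coeff_mono: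
  assumes "smooth_coeff j s T c" "i \<le> j" "r \<le> s"
  shows "smooth_coeff i r T c"
  using assms
proof (induction i arbitrary: j r s c)
  case 0
  then show ?case using wiener_mono[OF smooth_coeff_wiener] by simp
next
  case (Suc i)
  then obtain j' where j: "j = Suc j'" "i \<le> j'" by (cases j) auto
  obtain c' where c': "wiener s T c" "smooth_coeff j' (s - 4) T c'"
    "\<And>n t. t \<in> {0..T} \<Longrightarrow> (c n has_vector_derivative c' n t) (at t within {0..T})"
    by (rule smooth_coeff_SucE[OF Suc.prems(1)[unfolded j(1)]]) (rule that)
  have "smooth_coeff i (r - 4) T c'" using Suc.IH[OF c'(2) j(2)] Suc.prems(3) by simp
  then show ?case
    by (rule smooth_coeff_SucI[OF wiener_mono[OF c'(1) Suc.prems(3)]]) (rule c'(3))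
qed

lemma smooth_coeff_add:
  "smooth_coeff j s T c \<Longrightarrow> smooth_coeff j s T d \<Longrightarrow> smooth_coeff j s T (\<lambda>n t. c n t + d n t)"
proof (induction j arbitrary: s c d)
  case (Suc j)
  obtain c' where c': "wiener s T c" "smooth_coeff j (s - 4) T c'"
    "\<And>n t. t \<in> {0..T} \<Longrightarrow> (c n has_vector_derivative c' n t) (at t within {0..T})"
    by (rule smooth_coeff_SucE[OF Suc.prems(1)]) (rule that)
  obtain d' where d': "wiener s T d" "smooth_coeff j (s - 4) T d'"
    "\<And>n t. t \<in> {0..T} \<Longrightarrow> (d n has_vector_derivative d' n t) (at t within {0..T})"
    by (rule smooth_coeff_SucE[OF Suc.prems(2)]) (rule that)
  show ?case
    by (rule smooth_coeff_SucI[OF wiener_add[OF c'(1) d'(1)] Suc.IH[OF c'(2) d'(2)]])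
      (intro has_vector_derivative_add c'(3) d'(3))
qed (simp add: wiener_add)

text \<open>A multiplier independent of time commutes with the time derivative, which drives the
  induction. The bound \<open>4 * j + q \<le> s\<close> makes every truncated difference met in the
  recursion a true one.\<close>

lemma smooth_coeff_symbol:
  assumes "smooth_coeff j s T c" "4 * j + q \<le> s" "K \<ge> 0" "\<And>n. cmod (p n) \<le> K * wt n ^ q"
  shows "smooth_coeff j (s - q) T (\<lambda>n t. p n * c n t)"
  using assms(1,2)
proof (induction j arbitrary: s c)
  case 0
  then show ?case using wiener_symbol[of "s - q" q T c K p] assms(3,4) by simp
next
  case (Suc j)
  obtain c' where c': "wiener s T c" "smooth_coeff j (s - 4) T c'"
    "\<And>n t. t \<in> {0..T} \<Longrightarrow> (c n has_vector_derivative c' n t) (at t within {0..T})"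
    by (rule smooth_coeff_SucE[OF Suc.prems(1)]) (rule that)
  have "smooth_coeff j (s - 4 - q) T (\<lambda>n t. p n * c' n t)"
    by (rule Suc.IH[OF c'(2)]) (use Suc.prems in simp)
  moreover have "s - 4 - q = s - q - 4" by simp
  ultimately have *: "smooth_coeff j (s - q - 4) T (\<lambda>n t. p n * c' n t)" by (simp only:)
  have "wiener (s - q) T (\<lambda>n t. p n * c n t)"
    using wiener_symbol[of "s - q" q T c K p] Suc.prems c'(1) assms(3,4) by simp
  then show ?case
    by (rule smooth_coeff_SucI[OF _ *]) (intro has_vector_derivative_mult_right c'(3))
qed

lemma smooth_coeff_d_coeff:
  assumes "smooth_coeff j s T c" "4 * j + 1 \<le> s"
  shows "smooth_coeff j (s - 1) T (d_coeff i c)"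
proof -
  have "smooth_coeff j (s - 1) T (\<lambda>n t. \<i> * of_int (n $ i) * c n t)"
    by (rule smooth_coeff_symbol[where K = 1]) (use assms abs_index_le_wt in \<open>auto simp: norm_mult\<close>)
  then show ?thesis by (simp add: d_coeff_def[abs_def])
qed

text \<open>The product rule term by term; the two majorants from
  \<open>conv_terms_majorant\<close>, uniform in time, dominate the differentiated series.\<close>

lemma conv_has_vector_derivative:
  assumes w: "wiener 0 T u" "wiener 0 T v" "wiener 0 T u'" "wiener 0 T v'"
    and d: "\<And>n t. t \<in> {0..T} \<Longrightarrow> (u n has_vector_derivative u' n t) (at t within {0..T})"
      "\<And>n t. t \<in> {0..T} \<Longrightarrow> (v n has_vector_derivative v' n t) (at t within {0..T})"
    and t: "t \<in> {0..T}"
  shows "(conv u v n has_vector_derivative conv u' v n t + conv u v' n t) (at t within {0..T})"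
proof -
  obtain R Q R' Q' where m: "majorized 0 T R u" "majorized 0 T Q v" "majorized 0 T R' u'" "majorized 0 T Q' v'"
    using w by (auto simp: wiener_def)
  obtain a where a: "a summable_on UNIV" "\<And>k t. t \<in> {0..T} \<Longrightarrow> cmod (u' k t * v (n - k) t) \<le> a k"
    by (rule conv_terms_majorant[OF m(3,2)]) (rule that)
  obtain b where b: "b summable_on UNIV" "\<And>k t. t \<in> {0..T} \<Longrightarrow> cmod (u k t * v' (n - k) t) \<le> b k"
    by (rule conv_terms_majorant[OF m(1,4)]) (rule that)
  have "((\<lambda>t. \<Sum>\<^sub>\<infinity>k. u k t * v (n - k) t) has_vector_derivative (\<Sum>\<^sub>\<infinity>k. u k t * v' (n - k) t + u' k t * v (n - k) t))
      (at t within {0..T})"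
  proof (rule has_vector_derivative_infsum[where M = "\<lambda>k. b k + a k"])
    show "((\<lambda>t. u k t * v (n - k) t) has_vector_derivative u k t * v' (n - k) t + u' k t * v (n - k) t) (at t within {0..T})"
      if "t \<in> {0..T}" for k t by (intro has_vector_derivative_mult d that)
    show "cmod (u k t * v' (n - k) t + u' k t * v (n - k) t) \<le> b k + a k" if "t \<in> {0..T}" for k t
      by (intro norm_triangle_mono a b that)
    show "(\<lambda>k. b k + a k) summable_on UNIV" by (intro summable_on_add a b)
    show "(\<lambda>k. u k t * v (n - k) t) summable_on UNIV" if "t \<in> {0..T}" for t
      by (rule conv_terms_summable[OF m(1,2) that])
  qed (use t in auto)
  moreover have "(\<Sum>\<^sub>\<infinity>k. u k t * v' (n - k) t + u' k t * v (n - k) t) = conv u' v n t + conv u v' n t"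
    unfolding conv_def
    using infsum_add[OF conv_terms_summable[OF m(1,4) t] conv_terms_summable[OF m(3,2) t]] by (simp add: add.commute)
  ultimately show ?thesis by (simp add: conv_def[abs_def])
qed

lemma smooth_coeff_conv:
  "smooth_coeff j s T u \<Longrightarrow> smooth_coeff j s T v \<Longrightarrow> smooth_coeff j s T (conv u v)"
proof (induction j arbitrary: s u v)
  case 0
  then show ?case by (simp add: wiener_conv)
next
  case (Suc j)
  obtain u' where u': "wiener s T u" "smooth_coeff j (s - 4) T u'"
    "\<And>n t. t \<in> {0..T} \<Longrightarrow> (u n has_vector_derivative u' n t) (at t within {0..T})"
    by (rule smooth_coeff_SucE[OF Suc.prems(1)]) (rule that)
  obtain v' where v': "wiener s T v" "smooth_coeff j (s - 4) T v'"
    "\<And>n t. t \<in> {0..T} \<Longrightarrow> (v n has_vector_derivative v' n t) (at t within {0..T})"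
    by (rule smooth_coeff_SucE[OF Suc.prems(2)]) (rule that)
  \<comment> \<open>The undifferentiated factor is regarded at the lower order too, so that both
    terms of the product rule fall under the induction hypothesis.\<close>
  have uv: "smooth_coeff j (s - 4) T u" "smooth_coeff j (s - 4) T v"
    by (rule smooth_coeff_mono[OF Suc.prems(1)] smooth_coeff_mono[OF Suc.prems(2)]; simp)+
  have "smooth_coeff j (s - 4) T (\<lambda>n t. conv u' v n t + conv u v' n t)"
    by (intro smooth_coeff_add Suc.IH u' v' uv)
  moreover have "wiener 0 T u" "wiener 0 T v" "wiener 0 T u'" "wiener 0 T v'"
    using wiener_mono[OF u'(1)] wiener_mono[OF v'(1)] wiener_mono[OF smooth_coeff_wiener[OF u'(2)]]
      wiener_mono[OF smooth_coeff_wiener[OF v'(2)]] by simp_all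
  ultimately show ?case
    using smooth_coeff_SucI[OF wiener_conv[OF u'(1) v'(1)]] conv_has_vector_derivative u'(3) v'(3) by blast
qed

lemma smooth_coeff_sum:
  assumes "finite I" "I \<noteq> {}" "\<And>i. i \<in> I \<Longrightarrow> smooth_coeff j s T (c i)"
  shows "smooth_coeff j s T (\<lambda>n t. \<Sum>i\<in>I. c i n t)"
  using assms by (induction I rule: finite_ne_induct) (auto intro: smooth_coeff_add)

text \<open>The true loss is one power of the weight. It is recorded as four, the loss of the linear
  part, so that both terms of the equation have the same order.\<close>

lemma smooth_coeff_advect:
  fixes u :: "'d::finite \<Rightarrow> int^'d \<Rightarrow> real \<Rightarrow> complex"
  assumes "\<And>j. smooth_coeff i s T (u j)" "4 * i + 4 \<le> s"
  shows "smooth_coeff i (s - 4) T (advect u u j)"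
proof -
  have "smooth_coeff i (s - 1) T (conv (u l) (d_coeff l (u j)))" for l
    by (intro smooth_coeff_conv smooth_coeff_d_coeff smooth_coeff_mono[OF assms(1)] assms(1))
      (use assms(2) in auto)
  then have "smooth_coeff i (s - 1) T (advect u u j)"
    unfolding advect_def[abs_def] by (intro smooth_coeff_sum) auto
  then show ?thesis by (rule smooth_coeff_mono) auto
qed

section \<open>Time derivatives obtained from the equation\<close>

definition mild_solution :: "real \<Rightarrow> real \<Rightarrow> ('d \<Rightarrow> int^'d \<Rightarrow> complex) \<Rightarrow> ('d \<Rightarrow> int^'d \<Rightarrow> real \<Rightarrow> complex) \<Rightarrow> bool" where
  "mild_solution lam T c0 u \<longleftrightarrow> (\<forall>j n. \<forall>t\<in>{0..T}. u j n t = picard lam c0 u j n t)"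

definition ks_rhs :: "real \<Rightarrow> ('d \<Rightarrow> int^'d \<Rightarrow> real \<Rightarrow> complex) \<Rightarrow> 'd \<Rightarrow> int^'d \<Rightarrow> real \<Rightarrow> complex" where
  "ks_rhs lam u j n t = (- ks_symbol lam n) *\<^sub>R u j n t - advect u u j n t"

lemma mild_solution_has_vector_derivative:
  fixes u :: "'d::finite \<Rightarrow> int^'d \<Rightarrow> real \<Rightarrow> complex"
  assumes sol: "mild_solution lam T c0 u" and w: "\<And>j. wiener 1 T (u j)" and t: "t \<in> {0..T}"
  shows "(u j n has_vector_derivative ks_rhs lam u j n t) (at t within {0..T})"
proof -
  obtain R where R: "\<And>j. majorized 1 T (R j) (u j)" using w unfolding wiener_def by metis
  \<comment> \<open>The advection estimates take one bound for all components, so the maximum over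
    the finitely many components is used.\<close>
  have R': "majorized (Suc 0) T (Max (range R)) (u j)" for j
    using majorized_weaken[OF R order_refl] by auto
  have cont: "continuous_on {0..T} (advect u u j n)"
    by (rule continuous_on_advect[OF majorized_Suc[OF R'] R']) (use w in \<open>auto simp: wiener_def\<close>)
  have "(picard lam c0 u j n has_vector_derivative - ks_symbol lam n *\<^sub>R heat lam (c0 j) n t -
      (advect u u j n t - ks_symbol lam n *\<^sub>R duhamel lam (advect u u j) n t)) (at t within {0..T})"
    unfolding picard_def[abs_def]
    by (intro has_vector_derivative_diff heat_has_vector_derivative duhamel_has_vector_derivative cont t)
  moreover have "- ks_symbol lam n *\<^sub>R heat lam (c0 j) n t -
      (advect u u j n t - ks_symbol lam n *\<^sub>R duhamel lam (advect u u j) n t) = ks_rhs lam u j n t"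
  proof -
    have "u j n t = heat lam (c0 j) n t - duhamel lam (advect u u j) n t"
      using sol t by (simp add: mild_solution_def picard_def)
    then show ?thesis by (simp only: ks_rhs_def) (simp add: algebra_simps)
  qed
  ultimately show ?thesis
    using has_vector_derivative_transform[OF t, of "u j n" "picard lam c0 u j n"] sol
    by (simp add: mild_solution_def)
qed

lemma abs_ks_symbol_le: "\<bar>ks_symbol lam n\<bar> \<le> (1 + \<bar>lam\<bar>) * wt n ^ 4"
proof -
  define x where "x = norm (of_int_vec n)"
  have x: "0 \<le> x" "x \<le> wt n" "1 \<le> wt n" using wt_ge_1[of n] by (auto simp: x_def wt_def)
  have "\<bar>x ^ 4 - lam * x ^ 2\<bar> \<le> x ^ 4 + \<bar>lam\<bar> * x ^ 2"
    using abs_triangle_ineq4[of "x ^ 4" "lam * x ^ 2"] by (simp add: abs_mult)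
  moreover have "x ^ 4 \<le> wt n ^ 4" by (intro power_mono x)
  moreover have "x ^ 2 \<le> wt n ^ 4" using power_mono[OF x(2,1), of 2] power_increasing[OF _ x(3), of 2 4] by simp
  then have "\<bar>lam\<bar> * x ^ 2 \<le> \<bar>lam\<bar> * wt n ^ 4" by (intro mult_left_mono) auto
  ultimately show ?thesis by (simp add: ks_symbol_def x_def[symmetric] distrib_right)
qed

lemma smooth_coeff_ks_rhs:
  fixes u :: "'d::finite \<Rightarrow> int^'d \<Rightarrow> real \<Rightarrow> complex"
  assumes u: "\<And>j. smooth_coeff i s T (u j)" and s: "4 * i + 4 \<le> s"
  shows "smooth_coeff i (s - 4) T (ks_rhs lam u j)"
proof -
  have "smooth_coeff i (s - 4) T (\<lambda>n t. of_real (- ks_symbol lam n) * u j n t)"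
    by (rule smooth_coeff_symbol[OF u s, where K = "1 + \<bar>lam\<bar>"]) (use abs_ks_symbol_le in auto)
  moreover have "smooth_coeff i (s - 4 - 0) T (\<lambda>n t. - 1 * advect u u j n t)"
    by (rule smooth_coeff_symbol[where K = 1, OF smooth_coeff_advect[OF u s]]) (use s in auto)
  ultimately have "smooth_coeff i (s - 4) T (\<lambda>n t. of_real (- ks_symbol lam n) * u j n t + - 1 * advect u u j n t)"
    by (intro smooth_coeff_add) auto
  then show ?thesis by (simp add: ks_rhs_def[abs_def] scaleR_conv_of_real)
qed

text \<open>Bootstrapping in time: the right-hand side has as many time derivatives as
  \<open>u\<close> at four orders less, and it is the time derivative of \<open>u\<close>. The
  spatial order of \<open>u\<close> itself stays \<open>4 * k\<close> throughout.\<close>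

lemma mild_solution_smooth:
  fixes u :: "'d::finite \<Rightarrow> int^'d \<Rightarrow> real \<Rightarrow> complex"
  assumes sol: "mild_solution lam T c0 u" and w: "\<And>j. wiener (4 * k) T (u j)" and "i \<le> k"
  shows "smooth_coeff i (4 * k) T (u j)"
  using \<open>i \<le> k\<close>
proof (induction i arbitrary: j)
  case (Suc i)
  have *: "smooth_coeff i (4 * k - 4) T (ks_rhs lam u j)"
    by (rule smooth_coeff_ks_rhs) (use Suc in auto)
  have w1: "wiener 1 T (u j)" for j by (rule wiener_mono[OF w]) (use Suc.prems in auto)
  show ?case
    by (rule smooth_coeff_SucI[OF w *]) (rule mild_solution_has_vector_derivative[OF sol w1])
qed (simp add: w)



section \<open>Fourier series in space\<close>

definition fser :: "(int^'d \<Rightarrow> real \<Rightarrow> complex) \<Rightarrow> (real^'d) \<times> real \<Rightarrow> complex" where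
  "fser c p = (\<Sum>\<^sub>\<infinity>n. c n (snd p) * cis (of_int_vec n \<bullet> fst p))"

text \<open>Real parts make the field real-valued for arbitrary coefficients, so linear facts need
  no symmetry; for symmetric coefficients nothing is discarded, by \<open>fser_real\<close>.\<close>

definition fourier_field :: "('n \<Rightarrow> int^'d \<Rightarrow> real \<Rightarrow> complex) \<Rightarrow> (real^'d) \<times> real \<Rightarrow> real^'n" where
  "fourier_field u p = (\<chi> j. Re (fser (u j) p))"

lemma wiener_majorant:
  assumes "wiener 0 T c"
  obtains a where "a summable_on UNIV" "\<And>n t. t \<in> {0..T} \<Longrightarrow> cmod (c n t) \<le> a n"
proof -
  obtain R where "majorized 0 T R c" using assms by (auto simp: wiener_def)
  then obtain a where "\<forall>n. \<forall>t\<in>{0..T}. cmod (c n t) \<le> a n" "(\<lambda>n. wt n ^ 0 * a n) summable_on UNIV"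
    unfolding majorized_def by (elim exE conjE)
  with that[of a] show ?thesis by simp
qed

lemma fser_summable:
  assumes "wiener 0 T c" "snd p \<in> {0..T}"
  shows "(\<lambda>n. norm (c n (snd p) * cis (of_int_vec n \<bullet> fst p))) summable_on UNIV"
proof -
  obtain a where "a summable_on UNIV" "\<And>n t. t \<in> {0..T} \<Longrightarrow> cmod (c n t) \<le> a n"
    by (rule wiener_majorant[OF assms(1)]) (rule that)
  then show ?thesis
    using assms(2) by (intro Infinite_Sum.abs_summable_on_comparison_test'[where g = a]) (simp_all add: norm_mult)
qed

lemma continuous_on_fser:
  assumes "wiener 0 T c"
  shows "continuous_on (UNIV \<times> {0..T}) (fser c)"
proof -
  obtain a where a: "a summable_on UNIV" "\<And>n t. t \<in> {0..T} \<Longrightarrow> cmod (c n t) \<le> a n"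
    by (rule wiener_majorant[OF assms(1)]) (rule that)
  have c: "continuous_on (UNIV \<times> {0..T}) (\<lambda>p. c n (snd p))" for n
    by (rule continuous_on_compose2[where f = snd and s = "UNIV \<times> {0..T}" and t = "{0..T}"])
      (use assms in \<open>auto simp: wiener_def intro!: continuous_intros\<close>)
  show ?thesis unfolding fser_def[abs_def]
    by (rule continuous_on_infsum[OF _ _ a(1)])
      (use a(2) in \<open>auto simp: norm_mult intro!: continuous_intros c\<close>)
qed

lemma cis_line_has_vector_derivative:
  "((\<lambda>s. cis (a + s * b)) has_vector_derivative \<i> * of_real b * cis (a + s * b)) (at s within S)"
proof -
  have "((\<lambda>z. exp (\<i> * (of_real a + z * of_real b))) has_field_derivative
      \<i> * of_real b * exp (\<i> * (of_real a + of_real s * of_real b))) (at (of_real s))"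
    by (auto intro!: derivative_eq_intros)
  from has_vector_derivative_real_field[OF this] show ?thesis by (simp add: cis_conv_exp)
qed

lemma fser_dx:
  assumes "wiener 1 T c" "t \<in> {0..T}"
  shows "((\<lambda>s. fser c (x + s *\<^sub>R axis i 1, t)) has_vector_derivative fser (d_coeff i c) (x, t)) (at 0)"
proof -
  have w: "wiener 0 T (d_coeff i c)" "wiener 0 T c"
    using wiener_d_coeff[of 0 T c i] wiener_mono[OF assms(1), of 0] assms(1) by simp_all
  obtain a where a: "a summable_on UNIV" "\<And>n t. t \<in> {0..T} \<Longrightarrow> cmod (d_coeff i c n t) \<le> a n"
    by (rule wiener_majorant[OF w(1)]) (rule that)
  have cis': "((\<lambda>s. cis (of_int_vec n \<bullet> (x + s *\<^sub>R axis i 1))) has_vector_derivative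
      \<i> * of_int (n $ i) * cis (of_int_vec n \<bullet> (x + s *\<^sub>R axis i 1))) (at s)" for n s
  proof -
    have "of_int_vec n \<bullet> (x + s *\<^sub>R axis i 1) = of_int_vec n \<bullet> x + s * of_int (n $ i)" for s :: real
      by (simp add: inner_add_right inner_axis of_int_vec_nth)
    then show ?thesis
      using cis_line_has_vector_derivative[of "of_int_vec n \<bullet> x" "of_int (n $ i)" s UNIV] by simp
  qed
  have "((\<lambda>s. \<Sum>\<^sub>\<infinity>n. c n t * cis (of_int_vec n \<bullet> (x + s *\<^sub>R axis i 1))) has_vector_derivative
      (\<Sum>\<^sub>\<infinity>n. c n t * (\<i> * of_int (n $ i) * cis (of_int_vec n \<bullet> (x + 0 *\<^sub>R axis i 1))))) (at 0 within UNIV)"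
  proof (rule has_vector_derivative_infsum[where M = a])
    show "(\<lambda>n. c n t * cis (of_int_vec n \<bullet> (x + s *\<^sub>R axis i 1))) summable_on UNIV" for s
      using abs_summable_summable[OF fser_summable[OF w(2), of "(x + s *\<^sub>R axis i 1, t)"]] assms by simp
    show "cmod (c n t * (\<i> * of_int (n $ i) * cis (of_int_vec n \<bullet> (x + s *\<^sub>R axis i 1)))) \<le> a n" for n s
      using a(2)[OF assms(2), of n] by (simp add: d_coeff_def norm_mult mult_ac)
    show "((\<lambda>s. c n t * cis (of_int_vec n \<bullet> (x + s *\<^sub>R axis i 1))) has_vector_derivative
        c n t * (\<i> * of_int (n $ i) * cis (of_int_vec n \<bullet> (x + s *\<^sub>R axis i 1)))) (at s)" for n s
      by (rule has_vector_derivative_mult_right[OF cis'])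
  qed (use a in auto)
  then show ?thesis by (simp add: fser_def d_coeff_def mult_ac)
qed

text \<open>Partial derivatives are taken at parameter 0 along a line, while coefficients are
  differentiated at \<open>t\<close> within \<open>{0..T}\<close>. This passes from one form to the
  other, in both directions.\<close>

lemma has_vector_derivative_shift:
  fixes f :: "real \<Rightarrow> 'b::real_normed_vector"
  assumes "(f has_vector_derivative f') (at (a + t) within S)"
  shows "((\<lambda>s. f (a + s)) has_vector_derivative f') (at t within {s. a + s \<in> S})"
proof -
  have "((f \<circ> (\<lambda>s. a + s)) has_vector_derivative (1 *\<^sub>R f')) (at t within {s. a + s \<in> S})"
  proof (rule vector_diff_chain_within)
    show "((\<lambda>s. a + s) has_vector_derivative 1) (at t within {s. a + s \<in> S})"
      by (auto intro!: derivative_eq_intros)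
    have "(\<lambda>s. a + s) ` {s. a + s \<in> S} = S"
    proof
      show "S \<subseteq> (\<lambda>s. a + s) ` {s. a + s \<in> S}"
      proof
        fix r assume "r \<in> S"
        then show "r \<in> (\<lambda>s. a + s) ` {s. a + s \<in> S}" by (intro image_eqI[of _ _ "r - a"]) simp_all
      qed
    qed blast
    then show "(f has_vector_derivative f') (at (a + t) within (\<lambda>s. a + s) ` {s. a + s \<in> S})"
      using assms by simp
  qed
  then show ?thesis by (simp add: o_def)
qed

lemma fser_dt:
  assumes w: "wiener 0 T c" "wiener 0 T c'"
    and d: "\<And>n t. t \<in> {0..T} \<Longrightarrow> (c n has_vector_derivative c' n t) (at t within {0..T})"
    and t: "t \<in> {0..T}"
  shows "((\<lambda>s. fser c (x, t + s)) has_vector_derivative fser c' (x, t)) (at 0 within {s. t + s \<in> {0..T}})"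
proof -
  obtain a where a: "a summable_on UNIV" "\<And>n t. t \<in> {0..T} \<Longrightarrow> cmod (c' n t) \<le> a n"
    by (rule wiener_majorant[OF w(2)]) (rule that)
  have "((\<lambda>t. \<Sum>\<^sub>\<infinity>n. c n t * cis (of_int_vec n \<bullet> x)) has_vector_derivative
      (\<Sum>\<^sub>\<infinity>n. c' n t * cis (of_int_vec n \<bullet> x))) (at t within {0..T})"
  proof (rule has_vector_derivative_infsum[where M = a])
    show "(\<lambda>n. c n t * cis (of_int_vec n \<bullet> x)) summable_on UNIV" if "t \<in> {0..T}" for t
      using abs_summable_summable[OF fser_summable[OF w(1), of "(x, t)"]] that by simp
    show "((\<lambda>t. c n t * cis (of_int_vec n \<bullet> x)) has_vector_derivative c' n t * cis (of_int_vec n \<bullet> x)) (at t within {0..T})"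
      if "t \<in> {0..T}" for n t
      by (rule has_vector_derivative_mult_left[OF d[OF that]])
  qed (use a t in \<open>auto simp: norm_mult\<close>)
  then show ?thesis
    using has_vector_derivative_shift[where a = t and t = 0 and S = "{0..T}"] by (simp add: fser_def)
qed

lemma of_int_vec_inner_axis: "of_int_vec n \<bullet> axis i (2 * pi) = 2 * pi * of_int (n $ i)"
  by (simp add: inner_axis of_int_vec_nth)

lemma cis_add_period: "cis (of_int_vec n \<bullet> (x + axis i (2 * pi))) = cis (of_int_vec n \<bullet> x)"
proof -
  have "cis (2 * pi * of_int (n $ i)) = 1" by (rule cis_multiple_2pi) simp
  then show ?thesis
    by (simp add: inner_add_right of_int_vec_inner_axis cis_mult[symmetric])
qed

lemma torus_periodic_field: "torus_periodic (\<lambda>x. fourier_field u (x, t))"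
  by (simp add: torus_periodic_def fourier_field_def fser_def cis_add_period)

text \<open>The characters satisfy \<open>cis (k \<bullet> x) * cis ((n - k) \<bullet> x) = cis (n
  \<bullet> x)\<close>, so the Cauchy product of two absolutely convergent series collects exactly
  the coefficients of the convolution.\<close>

lemma fser_mult:
  assumes "wiener 0 T u" "wiener 0 T v" "snd p \<in> {0..T}"
  shows "fser u p * fser v p = fser (conv u v) p"
proof -
  have eq: "u k (snd p) * cis (of_int_vec k \<bullet> fst p) * (v (n - k) (snd p) * cis (of_int_vec (n - k) \<bullet> fst p)) =
      u k (snd p) * v (n - k) (snd p) * cis (of_int_vec n \<bullet> fst p)" for n k
  proof -
    have "of_int_vec n \<bullet> fst p = of_int_vec k \<bullet> fst p + of_int_vec (n - k) \<bullet> fst p"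
      by (simp add: of_int_vec_diff inner_diff_left)
    then show ?thesis by (simp add: cis_mult[symmetric])
  qed
  have "fser u p * fser v p = (\<Sum>\<^sub>\<infinity>n. \<Sum>\<^sub>\<infinity>k. u k (snd p) * cis (of_int_vec k \<bullet> fst p) *
      (v (n - k) (snd p) * cis (of_int_vec (n - k) \<bullet> fst p)))"
    unfolding fser_def
    by (rule infsumI[OF has_sum_convolution[OF fser_summable fser_summable], symmetric])
      (use assms in auto)
  also have "\<dots> = fser (conv u v) p"
    by (simp only: eq fser_def conv_def infsum_cmult_left')
  finally show ?thesis .
qed

lemma fser_real:
  assumes "\<And>n. c (- n) (snd p) = cnj (c n (snd p))"
  shows "fser c p \<in> \<real>"
proof -
  have "cnj (fser c p) = (\<Sum>\<^sub>\<infinity>n. cnj (c n (snd p) * cis (of_int_vec n \<bullet> fst p)))"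
    unfolding fser_def by (rule infsum_cnj[symmetric])
  also have "\<dots> = (\<Sum>\<^sub>\<infinity>n. c (- n) (snd p) * cis (of_int_vec (- n) \<bullet> fst p))"
    by (simp add: assms of_int_vec_uminus cis_cnj)
  also have "\<dots> = fser c p" unfolding fser_def
    by (rule infsum_reindex_bij_witness[of _ uminus uminus]) auto
  finally show ?thesis by (simp add: Reals_cnj_iff)
qed

lemma fser_add:
  assumes "wiener 0 T u" "wiener 0 T v" "snd p \<in> {0..T}"
  shows "fser (\<lambda>n t. u n t + v n t) p = fser u p + fser v p"
  unfolding fser_def distrib_right
  by (rule infsum_add[OF abs_summable_summable[OF fser_summable[OF assms(1,3)]]
        abs_summable_summable[OF fser_summable[OF assms(2,3)]]])

lemma fser_cmult: "fser (\<lambda>n t. a * u n t) p = a * fser u p"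
  by (simp add: fser_def mult.assoc infsum_cmult_right')

section \<open>Partial derivatives\<close>

abbreviation slab :: "real \<Rightarrow> ((real^'d) \<times> real) set" where
  "slab T \<equiv> UNIV \<times> {0..T}"

text \<open>A relation in place of the function \<open>pd\<close>: it asserts existence along with
  the value, whereas \<open>pd\<close> is a choice that is meaningful only once existence and
  uniqueness are known.\<close>

definition has_pd :: "real \<Rightarrow> (real^'d) \<times> real \<Rightarrow> ((real^'d) \<times> real \<Rightarrow> 'b::real_normed_vector) \<Rightarrow>
    ((real^'d) \<times> real \<Rightarrow> 'b) \<Rightarrow> bool" where
  "has_pd T v f f' \<longleftrightarrow> (\<forall>p\<in>slab T. ((\<lambda>s. f (p + s *\<^sub>R v)) has_vector_derivative f' p)
     (at 0 within {s. p + s *\<^sub>R v \<in> slab T}))"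

lemma slab_line_x: "p \<in> slab T \<Longrightarrow> {s. p + s *\<^sub>R (axis i 1, 0) \<in> slab T} = UNIV"
  by (auto simp: mem_Times_iff)

lemma slab_line_t: "{s. p + s *\<^sub>R (0, 1) \<in> slab T} = {s. snd p + s \<in> {0..T}}"
  by (auto simp: mem_Times_iff)

lemma at_within_line_t_nontrivial:
  fixes t T :: real
  assumes "0 < T" "t \<in> {0..T}"
  shows "at 0 within {s. t + s \<in> {0..T}} \<noteq> bot"
proof -
  have "{s. t + s \<in> {0..T}} = {- t..T - t}" by auto
  then show ?thesis using assms by (simp add: trivial_limit_within)
qed

text \<open>A derivative within a set is unique if 0 is a limit point of the admissible parameters.
  In the time direction this needs \<open>0 < T\<close>, also at the two ends.\<close>

lemma pd_eqI:
  assumes "has_pd T v f f'" "p \<in> slab T" "0 < T" "v = (0, 1) \<or> v \<in> range (\<lambda>i. (axis i 1, 0))"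
  shows "pd (slab T) v f p = f' p"
  unfolding pd_def
proof (rule vector_derivative_within)
  show "at 0 within {s. p + s *\<^sub>R v \<in> slab T} \<noteq> bot"
    using assms(4)
  proof
    assume "v = (0, 1)"
    then show ?thesis using assms at_within_line_t_nontrivial[of T "snd p"] by (auto simp: slab_line_t mem_Times_iff)
  next
    assume "v \<in> range (\<lambda>i. (axis i 1, 0))"
    then show ?thesis using slab_line_x[OF assms(2)] by auto
  qed
qed (use assms in \<open>auto simp: has_pd_def\<close>)

text \<open>The difference quotient at a point of the slab only involves values on the slab.
  Iterated derivatives are known explicitly only there, and this allows the inner one to be
  replaced.\<close>

lemma pd_cong:
  assumes "\<And>q. q \<in> slab T \<Longrightarrow> f q = g q" "p \<in> slab T"
  shows "pd (slab T) v f p = pd (slab T) v g p"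
proof -
  have "((\<lambda>s. f (p + s *\<^sub>R v)) has_vector_derivative d) (at 0 within {s. p + s *\<^sub>R v \<in> slab T}) \<longleftrightarrow>
      ((\<lambda>s. g (p + s *\<^sub>R v)) has_vector_derivative d) (at 0 within {s. p + s *\<^sub>R v \<in> slab T})" for d
    by (rule iffI; erule has_vector_derivative_transform[rotated 2]; simp only: mem_Collect_eq assms scaleR_zero_left add_0_right)
  then show ?thesis by (simp add: pd_def vector_derivative_def)
qed

lemma has_pd_cong:
  fixes v :: "(real^'d) \<times> real"
  assumes "\<And>q. q \<in> slab T \<Longrightarrow> f q = g q" "has_pd T v g f'"
  shows "has_pd T v f f'"
  unfolding has_pd_def
proof
  fix p :: "(real^'d) \<times> real" assume p: "p \<in> slab T"
  have "((\<lambda>s. g (p + s *\<^sub>R v)) has_vector_derivative f' p) (at 0 within {s. p + s *\<^sub>R v \<in> slab T})"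
    using assms(2) p unfolding has_pd_def by blast
  then show "((\<lambda>s. f (p + s *\<^sub>R v)) has_vector_derivative f' p) (at 0 within {s. p + s *\<^sub>R v \<in> slab T})"
    by (rule has_vector_derivative_transform[rotated 2]) (use p assms(1) in auto)
qed

lemma has_pd_exists: "has_pd T v f f' \<Longrightarrow> pd_exists (slab T) v f"
  unfolding has_pd_def pd_exists_def by (auto intro: differentiableI_vector)

lemma has_vector_derivative_vec_Re:
  assumes "\<And>j. (f j has_vector_derivative f' j) (at x within S)"
  shows "((\<lambda>s. \<chi> j. Re (f j s)) has_vector_derivative (\<chi> j. Re (f' j))) (at x within S)"
  unfolding has_vector_derivative_def
proof (subst has_derivative_componentwise_within, rule ballI)
  fix b :: "real^'a" assume "b \<in> Basis"
  then obtain j where b: "b = axis j 1" by (auto simp: Basis_vec_def)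
  have "((\<lambda>s. Re (f j s)) has_derivative (\<lambda>h. Re (h *\<^sub>R f' j))) (at x within S)"
    using assms[of j] unfolding has_vector_derivative_def by (rule has_derivative_Re)
  then show "((\<lambda>s. (\<chi> j. Re (f j s)) \<bullet> b) has_derivative (\<lambda>h. (h *\<^sub>R (\<chi> j. Re (f' j))) \<bullet> b)) (at x within S)"
    by (simp add: b inner_axis)
qed

lemma continuous_on_field:
  assumes "\<And>j. wiener 0 T (u j)"
  shows "continuous_on (slab T) (fourier_field u)"
  unfolding fourier_field_def[abs_def] by (intro continuous_intros continuous_on_fser assms)

lemma has_pd_field_x:
  fixes u :: "'n::finite \<Rightarrow> int^'d \<Rightarrow> real \<Rightarrow> complex"
  assumes "\<And>j. wiener 1 T (u j)"
  shows "has_pd T (axis i 1, 0) (fourier_field u) (fourier_field (\<lambda>j. d_coeff i (u j)))"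
  unfolding has_pd_def
proof
  fix p :: "(real^'d) \<times> real" assume p: "p \<in> slab T"
  obtain x t where [simp]: "p = (x, t)" by (cases p)
  show "((\<lambda>s. fourier_field u (p + s *\<^sub>R (axis i 1, 0))) has_vector_derivative fourier_field (\<lambda>j. d_coeff i (u j)) p)
      (at 0 within {s. p + s *\<^sub>R (axis i 1, 0) \<in> slab T})"
    unfolding slab_line_x[OF p] fourier_field_def
    using fser_dx[OF assms, of t _ x i] p by (intro has_vector_derivative_vec_Re) auto
qed

lemma has_pd_field_t:
  fixes u :: "'n::finite \<Rightarrow> int^'d \<Rightarrow> real \<Rightarrow> complex"
  assumes w: "\<And>j. wiener 0 T (u j)" "\<And>j. wiener 0 T (u' j)"
    and d: "\<And>j n t. t \<in> {0..T} \<Longrightarrow> (u j n has_vector_derivative u' j n t) (at t within {0..T})"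
  shows "has_pd T (0, 1) (fourier_field u) (fourier_field u')"
  unfolding has_pd_def
proof
  fix p :: "(real^'d) \<times> real" assume p: "p \<in> slab T"
  obtain x t where [simp]: "p = (x, t)" by (cases p)
  show "((\<lambda>s. fourier_field u (p + s *\<^sub>R (0, 1))) has_vector_derivative fourier_field u' p)
      (at 0 within {s. p + s *\<^sub>R (0, 1) \<in> slab T})"
    unfolding slab_line_t fourier_field_def
    using fser_dt[OF w d, of t _ x] p by (intro has_vector_derivative_vec_Re) auto
qed

definition dxs_coeff :: "'d list \<Rightarrow> ('n \<Rightarrow> int^'d \<Rightarrow> real \<Rightarrow> complex) \<Rightarrow> 'n \<Rightarrow> int^'d \<Rightarrow> real \<Rightarrow> complex" where
  "dxs_coeff is u = foldr (\<lambda>i w j. d_coeff i (w j)) is u"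

lemma wiener_dxs_coeff:
  "(\<And>j. wiener (length is + s) T (u j)) \<Longrightarrow> wiener s T (dxs_coeff is u j)"
proof (induction "is" arbitrary: s j)
  case (Cons i "is")
  have "wiener (Suc s) T (dxs_coeff is u j)" for j by (rule Cons.IH) (use Cons.prems in simp)
  then show ?case by (simp add: dxs_coeff_def wiener_d_coeff)
qed (simp add: dxs_coeff_def)

text \<open>Existence and value are proved together, because the next derivative can be formed only
  after the previous one is identified with a Fourier field on the slab.\<close>

lemma C_along_field:
  assumes "0 < T" "\<And>j. wiener (length is) T (u j)"
  shows "C_along (slab T) (map (\<lambda>i. (axis i 1, 0)) is) (fourier_field u) \<and>
    (\<forall>p\<in>slab T. pds (slab T) (map (\<lambda>i. (axis i 1, 0)) is) (fourier_field u) p = fourier_field (dxs_coeff is u) p)"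
  using assms(2)
proof (induction "is")
  case Nil
  then show ?case by (simp add: dxs_coeff_def continuous_on_field)
next
  case (Cons i "is")
  let ?f = "pds (slab T) (map (\<lambda>i. (axis i 1, 0)) is) (fourier_field u)"
  have "wiener (length is) T (u j)" for j by (rule wiener_mono[OF Cons.prems]) simp
  then have IH: "C_along (slab T) (map (\<lambda>i. (axis i 1, 0)) is) (fourier_field u)"
      "\<And>p. p \<in> slab T \<Longrightarrow> ?f p = fourier_field (dxs_coeff is u) p"
    using Cons.IH by auto
  have w: "wiener 1 T (dxs_coeff is u j)" for j by (rule wiener_dxs_coeff) (use Cons.prems in simp)
  have hp: "has_pd T (axis i 1, 0) ?f (fourier_field (dxs_coeff (i # is) u))"
    by (rule has_pd_cong[OF IH(2)]) (use has_pd_field_x[OF w, of i] in \<open>simp_all add: dxs_coeff_def\<close>)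
  have eq: "pd (slab T) (axis i 1, 0) ?f p = fourier_field (dxs_coeff (i # is) u) p" if "p \<in> slab T" for p
    by (rule pd_eqI[OF hp that assms(1)]) simp
  have "continuous_on (slab T) (fourier_field (dxs_coeff (i # is) u))"
    by (intro continuous_on_field wiener_dxs_coeff) (use Cons.prems in simp)
  then have "continuous_on (slab T) (pd (slab T) (axis i 1, 0) ?f)"
    by (rule continuous_on_eq) (rule eq[symmetric])
  with IH has_pd_exists[OF hp] eq show ?case by simp
qed



section \<open>The equation in physical space\<close>

lemma fser_sum:
  assumes "finite I" "\<And>i. i \<in> I \<Longrightarrow> wiener 0 T (c i)" "snd p \<in> {0..T}"
  shows "fser (\<lambda>n t. \<Sum>i\<in>I. c i n t) p = (\<Sum>i\<in>I. fser (c i) p)"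
proof -
  have "((\<lambda>n. \<Sum>i\<in>I. c i n (snd p) * cis (of_int_vec n \<bullet> fst p)) has_sum (\<Sum>i\<in>I. fser (c i) p)) UNIV"
    using assms(1,2)
  proof (induction I rule: finite_induct)
    case (insert i I)
    have "((\<lambda>n. c i n (snd p) * cis (of_int_vec n \<bullet> fst p)) has_sum fser (c i) p) UNIV"
      unfolding fser_def
      by (rule has_sum_infsum[OF abs_summable_summable[OF fser_summable[OF insert.prems assms(3)]]]) simp
    from has_sum_add[OF this insert.IH[OF insert.prems]] insert.hyps show ?case by simp
  qed simp
  then show ?thesis by (simp add: fser_def[of "\<lambda>n t. \<Sum>i\<in>I. c i n t"] sum_distrib_right infsumI)
qed

definition lap_coeff :: "('n \<Rightarrow> int^'d \<Rightarrow> real \<Rightarrow> complex) \<Rightarrow> 'n \<Rightarrow> int^'d \<Rightarrow> real \<Rightarrow> complex" where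
  "lap_coeff u j n t = of_real (- (norm (of_int_vec n))\<^sup>2) * u j n t"

lemma sum_d_coeff_twice: "(\<Sum>i\<in>UNIV. d_coeff i (d_coeff i c) n t) = of_real (- (norm (of_int_vec n))\<^sup>2) * c n t"
proof -
  have "(norm (of_int_vec n))\<^sup>2 = (\<Sum>i\<in>UNIV. (of_int (n $ i))\<^sup>2)"
    by (simp add: norm_vec_def L2_set_def sum_nonneg of_int_vec_nth)
  then show ?thesis
    by (simp add: d_coeff_def power2_eq_square sum_distrib_right sum_distrib_left sum_negf algebra_simps)
qed

lemma wiener_lap_coeff:
  assumes "wiener (s + 2) T (u j)"
  shows "wiener s T (lap_coeff u j)"
proof -
  have "wiener s T (\<lambda>n t. of_real (- (norm (of_int_vec n))\<^sup>2) * u j n t)"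
    by (rule wiener_symbol[OF assms, of 1]) (auto simp: wt_def power_mono norm_power)
  then show ?thesis by (simp add: lap_coeff_def[abs_def])
qed

text \<open>Stated for any \<open>f\<close> that agrees with a field on the slab, so that it can be
  applied a second time to the Laplacian itself.\<close>

lemma laplacian_field:
  fixes u :: "'n::finite \<Rightarrow> int^'d \<Rightarrow> real \<Rightarrow> complex"
  assumes T: "0 < T" and w: "\<And>j. wiener 2 T (u j)" and p: "p \<in> slab T"
    and f: "\<And>q. q \<in> slab T \<Longrightarrow> f q = fourier_field u q"
  shows "laplacian T f p = fourier_field (lap_coeff u) p"
proof -
  have w1: "wiener 1 T (u j)" for j by (rule wiener_mono[OF w]) simp
  have wd: "wiener 1 T (d_coeff i (u j))" for i j using wiener_d_coeff[of 1 T "u j"] w by (simp add: numeral_2_eq_2)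
  have dx1: "dx T i f q = fourier_field (\<lambda>j. d_coeff i (u j)) q" if "q \<in> slab T" for q i
    unfolding dx_def using pd_cong[where f = f and g = "fourier_field u", OF f that]
      pd_eqI[OF has_pd_field_x[where u = u and i = i, OF w1] that T] by simp
  have "dx T i (dx T i f) p = fourier_field (\<lambda>j. d_coeff i (d_coeff i (u j))) p" for i
  proof -
    have "dx T i (dx T i f) p = pd (slab T) (axis i 1, 0) (dx T i f) p" by (simp only: dx_def)
    also have "\<dots> = pd (slab T) (axis i 1, 0) (fourier_field (\<lambda>j. d_coeff i (u j))) p"
      by (rule pd_cong[OF dx1 p])
    also have "\<dots> = fourier_field (\<lambda>j. d_coeff i (d_coeff i (u j))) p"
      by (rule pd_eqI[OF has_pd_field_x[where u = "\<lambda>j. d_coeff i (u j)" and i = i, OF wd] p T]) simp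
    finally show ?thesis .
  qed
  then have "laplacian T f p = (\<Sum>i\<in>UNIV. fourier_field (\<lambda>j. d_coeff i (d_coeff i (u j))) p)"
    by (simp add: laplacian_def)
  also have "\<dots> = fourier_field (lap_coeff u) p"
  proof (rule vec_eq_iff[THEN iffD2], rule allI)
    fix j
    have "fser (\<lambda>n t. \<Sum>i\<in>UNIV. d_coeff i (d_coeff i (u j)) n t) p = (\<Sum>i\<in>UNIV. fser (d_coeff i (d_coeff i (u j))) p)"
      by (rule fser_sum[where T = T]) (use p wiener_d_coeff[of 0 T] wd in \<open>auto simp: mem_Times_iff\<close>)
    then show "(\<Sum>i\<in>UNIV. fourier_field (\<lambda>j. d_coeff i (d_coeff i (u j))) p) $ j = fourier_field (lap_coeff u) p $ j"
      by (simp add: fourier_field_def sum_d_coeff_twice lap_coeff_def[abs_def] flip: Re_sum)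
  qed
  finally show ?thesis .
qed

text \<open>The one nonlinear identity, and the place where the symmetry of the coefficients enters:
  a product of real parts is the real part of the product because both factors are real.\<close>

lemma advection_field:
  fixes u :: "'d::finite \<Rightarrow> int^'d \<Rightarrow> real \<Rightarrow> complex"
  assumes T: "0 < T" and w: "\<And>j. wiener 1 T (u j)" and p: "p \<in> slab T"
    and herm: "\<And>j n t. t \<in> {0..T} \<Longrightarrow> u j (- n) t = cnj (u j n t)"
  shows "advection T (fourier_field u) p = fourier_field (advect u u) p"
proof (rule vec_eq_iff[THEN iffD2], rule allI)
  fix j
  have t: "snd p \<in> {0..T}" using p by (auto simp: mem_Times_iff)
  have w0: "wiener 0 T (u j)" "wiener 0 T (d_coeff i (u j))" for i j
    using wiener_mono[OF w, of 0] wiener_d_coeff[of 0 T "u j" i] w by simp_all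
  have dx: "dx T i (fourier_field u) p = fourier_field (\<lambda>j. d_coeff i (u j)) p" for i
    unfolding dx_def using pd_eqI[OF has_pd_field_x[where u = u and i = i, OF w] p T] by simp
  have real: "fser (u i) p \<in> \<real>" "fser (d_coeff i (u j)) p \<in> \<real>" for i
    by (rule fser_real; use herm[OF t] in \<open>simp add: d_coeff_def\<close>)+
  have mult: "Re (fser (u i) p) * Re (fser (d_coeff i (u j)) p) = Re (fser (conv (u i) (d_coeff i (u j))) p)" for i
    using real[of i] unfolding fser_mult[OF w0(1) w0(2) t, symmetric] by (simp add: complex_is_Real_iff)
  have "fser (\<lambda>n t. \<Sum>i\<in>UNIV. conv (u i) (d_coeff i (u j)) n t) p = (\<Sum>i\<in>UNIV. fser (conv (u i) (d_coeff i (u j))) p)"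
    by (rule fser_sum[where T = T]) (use t w0 in \<open>auto intro!: wiener_conv\<close>)
  then show "advection T (fourier_field u) p $ j = fourier_field (advect u u) p $ j"
    by (simp add: advection_def dx fourier_field_def mult advect_def[abs_def])
qed

theorem mild_solution_classical:
  fixes u :: "'d::finite \<Rightarrow> int^'d \<Rightarrow> real \<Rightarrow> complex"
  assumes T: "0 < T" and w: "\<And>j. wiener 4 T (u j)" and sol: "mild_solution lam T c0 u"
    and herm: "\<And>j n t. t \<in> {0..T} \<Longrightarrow> u j (- n) t = cnj (u j n t)"
  shows "KS_classical_solution lam T (fourier_field u)"
proof -
  have w': "wiener s T (u j)" if "s \<le> 4" for s j by (rule wiener_mono[OF w that])
  have rhs: "wiener 0 T (ks_rhs lam u j)" for j
    using smooth_coeff_ks_rhs[of 0 4 T u lam j] w by simp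
  have hp: "has_pd T (0, 1) (fourier_field u) (fourier_field (ks_rhs lam u))"
    by (rule has_pd_field_t) (use w'[of 0] w'[of 1] rhs mild_solution_has_vector_derivative[OF sol] in simp_all)
  have dt: "pd (slab T) (0, 1) (fourier_field u) p = fourier_field (ks_rhs lam u) p" if "p \<in> slab T" for p
    by (rule pd_eqI[OF hp that T]) simp
  have "continuous_on (slab T) (fourier_field (ks_rhs lam u))" by (rule continuous_on_field[OF rhs])
  then have "continuous_on (slab T) (pd (slab T) (0, 1) (fourier_field u))"
    by (rule continuous_on_eq) (rule dt[symmetric])
  then have C1: "C_along (slab T) [(0, 1)] (fourier_field u)"
    using has_pd_exists[OF hp] continuous_on_field[of T u] w'[of 0] by simp
  have C4: "C_along (slab T) vs (fourier_field u)" if vs: "set vs \<subseteq> range (\<lambda>i. (axis i 1, 0))" "length vs \<le> 4" for vs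
  proof -
    obtain "is" where "vs = map (\<lambda>i. (axis i 1, 0)) is" 
    proof -
      have "\<exists>is. vs = map (\<lambda>i. (axis i 1, 0)) is" unfolding ex_map_conv using vs(1) by blast
      then show ?thesis using that by blast
    qed
    then show ?thesis using C_along_field[where u = u, OF T w'[of "length is"]] vs(2) by simp
  qed
  have "dt T (fourier_field u) p + advection T (fourier_field u) p + lam *\<^sub>R laplacian T (fourier_field u) p
      + laplacian T (laplacian T (fourier_field u)) p = 0" if p: "p \<in> slab T" for p
  proof -
    have t: "snd p \<in> {0..T}" using p by (auto simp: mem_Times_iff)
    have lap: "laplacian T (fourier_field u) q = fourier_field (lap_coeff u) q" if "q \<in> slab T" for q
      by (rule laplacian_field[OF T w' that]) simp_all
    have wl: "wiener 2 T (lap_coeff u j)" for j by (rule wiener_lap_coeff) (simp add: w)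
    have lap2: "laplacian T (laplacian T (fourier_field u)) p = fourier_field (lap_coeff (lap_coeff u)) p"
      by (rule laplacian_field[OF T wl p lap])
    have wll: "wiener 0 T (lap_coeff (lap_coeff u) j)" for j by (rule wiener_lap_coeff) (use wl in \<open>simp add: numeral_2_eq_2\<close>)
    have adv: "advection T (fourier_field u) p = fourier_field (advect u u) p"
      by (rule advection_field[OF T w' p herm]) simp_all
    have wa: "wiener 0 T (advect u u j)" for j
      using smooth_coeff_advect[of 0 4 T u j] w by simp
    have wl0: "wiener 0 T (\<lambda>n t. of_real lam * lap_coeff u j n t)" for j
      by (rule wiener_symbol[where q = 0 and K = "\<bar>lam\<bar>"]) (use wiener_mono[OF wl, of 0] in simp_all)
    have "fser (ks_rhs lam u j) p + fser (advect u u j) p + of_real lam * fser (lap_coeff u j) p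
        + fser (lap_coeff (lap_coeff u) j) p = 0" for j
    proof -
      have "fser (ks_rhs lam u j) p + fser (advect u u j) p + of_real lam * fser (lap_coeff u j) p
          + fser (lap_coeff (lap_coeff u) j) p =
        fser (\<lambda>n t. ((ks_rhs lam u j n t + advect u u j n t) + of_real lam * lap_coeff u j n t)
           + lap_coeff (lap_coeff u) j n t) p"
        by (simp only: fser_add[OF wiener_add[OF wiener_add[OF rhs wa] wl0] wll t]
            fser_add[OF wiener_add[OF rhs wa] wl0 t] fser_add[OF rhs wa t] fser_cmult)
      \<comment> \<open>The coefficients cancel identically by the definition of the symbol. Zero is
        written as a multiple of \<open>u\<close> so that \<open>fser_cmult\<close> evaluates its
        series.\<close>
      also have "(\<lambda>n t. ((ks_rhs lam u j n t + advect u u j n t) + of_real lam * lap_coeff u j n t)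
           + lap_coeff (lap_coeff u) j n t) = (\<lambda>n t. 0 * u j n t)"
        by (simp add: fun_eq_iff ks_rhs_def ks_symbol_def lap_coeff_def scaleR_conv_of_real
            power2_eq_square power4_eq_xxxx algebra_simps)
      finally show ?thesis by (simp only: fser_cmult) simp
    qed
    note sum0 = this
    have "Re (fser (ks_rhs lam u j) p) + Re (fser (advect u u j) p) + lam * Re (fser (lap_coeff u j) p)
        + Re (fser (lap_coeff (lap_coeff u) j) p) = 0" for j
    proof -
      have "Re (of_real lam * fser (lap_coeff u j) p) = lam * Re (fser (lap_coeff u j) p)" by simp
      with arg_cong[OF sum0[of j], of Re] show ?thesis by simp
    qed
    then show ?thesis
      unfolding lap[OF p] lap2 adv dt_def dt[OF p] by (simp add: vec_eq_iff fourier_field_def)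
  qed
  then show ?thesis
    unfolding KS_classical_solution_def using torus_periodic_field C1 C4 by blast
qed

section \<open>Continuous space-time derivatives\<close>

primrec creg :: "nat \<Rightarrow> real \<Rightarrow> ((real^'d) \<times> real \<Rightarrow> real^'n) \<Rightarrow> bool" where
  "creg 0 T f \<longleftrightarrow> continuous_on (slab T) f \<and> (\<forall>t\<in>{0..T}. torus_periodic (\<lambda>x. f (x, t)))"
| "creg (Suc r) T f \<longleftrightarrow>
     (continuous_on (slab T) f \<and> (\<forall>t\<in>{0..T}. torus_periodic (\<lambda>x. f (x, t)))) \<and>
     (\<forall>v\<in>Basis. \<exists>f'. has_pd T v f f' \<and> creg r T f')"

lemma Basis_space_time:
  "(Basis :: ((real^'d) \<times> real) set) = insert (0, 1) (range (\<lambda>i. (axis i 1, 0)))"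
  by (auto simp: Basis_prod_def Basis_vec_def)

text \<open>Every derivative, in space or in time, is charged four powers of the weight: exact for
  time, generous for space. This is why order \<open>k\<close> in space-time matches the weight
  \<open>4 * k\<close>.\<close>

lemma creg_field:
  fixes u :: "'n::finite \<Rightarrow> int^'d \<Rightarrow> real \<Rightarrow> complex"
  assumes "\<And>j. smooth_coeff r (4 * r) T (u j)"
  shows "creg r T (fourier_field u)"
  using assms
proof (induction r arbitrary: u)
  case 0
  then show ?case by (simp add: continuous_on_field torus_periodic_field)
next
  case (Suc r)
  have w: "wiener (4 * Suc r) T (u j)" for j using smooth_coeff_wiener[OF Suc.prems] .
  have w0: "wiener 0 T (u j)" and w1: "wiener 1 T (u j)" for j using wiener_mono[OF w] by simp_all
  have "\<exists>c'. (\<forall>n. \<forall>t\<in>{0..T}. (u j n has_vector_derivative c' n t) (at t within {0..T})) \<and>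
      smooth_coeff r (4 * r) T c'" for j
    using Suc.prems[of j] by simp
  from choice[OF allI[OF this]] obtain u' where
    "\<forall>j. (\<forall>n. \<forall>t\<in>{0..T}. (u j n has_vector_derivative u' j n t) (at t within {0..T})) \<and>
      smooth_coeff r (4 * r) T (u' j)" ..
  then have u': "\<And>j n t. t \<in> {0..T} \<Longrightarrow> (u j n has_vector_derivative u' j n t) (at t within {0..T})"
    "\<And>j. smooth_coeff r (4 * r) T (u' j)" by simp_all
  have w0': "wiener 0 T (u' j)" for j using wiener_mono[OF smooth_coeff_wiener[OF u'(2)]] by simp
  have t: "has_pd T (0, 1) (fourier_field u) (fourier_field u')" by (rule has_pd_field_t[OF w0 w0' u'(1)])
  have x: "has_pd T (axis i 1, 0) (fourier_field u) (fourier_field (\<lambda>j. d_coeff i (u j)))" for i by (rule has_pd_field_x[OF w1])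
  have "smooth_coeff r (4 * Suc r - 1) T (d_coeff i (u j))" for i j
    by (rule smooth_coeff_d_coeff[OF smooth_coeff_mono[OF Suc.prems]]) simp_all
  then have "smooth_coeff r (4 * r) T (d_coeff i (u j))" for i j
    by (rule smooth_coeff_mono) simp_all
  then have "creg r T (fourier_field (\<lambda>j. d_coeff i (u j)))" for i by (rule Suc.IH)
  with x have "\<exists>f'. has_pd T (axis i 1, 0) (fourier_field u) f' \<and> creg r T f'" for i
    by (intro exI conjI)
  moreover have "\<exists>f'. has_pd T (0, 1) (fourier_field u) f' \<and> creg r T f'"
    by (intro exI conjI) (rule t, rule Suc.IH[OF u'(2)])
  moreover have "continuous_on (slab T) (fourier_field u) \<and> (\<forall>t\<in>{0..T}. torus_periodic (\<lambda>x. fourier_field u (x, t)))"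
    using w0 by (simp add: continuous_on_field torus_periodic_field)
  ultimately show ?case unfolding creg.simps(2) Basis_space_time by (simp only: ball_simps ball_UNIV simp_thms) blast
qed



section \<open>Weak derivatives\<close>

abbreviation torus_corner :: "real^'d" where
  "torus_corner \<equiv> \<chi> i. 2 * pi"

text \<open>The shifted cell is cut at \<open>x_i = 2 * pi\<close>. The part beyond the cut is, one
  period back, the part of the original cell with \<open>x_i \<le> h\<close> that the shift has
  left.\<close>

lemma torus_integral_translation:
  fixes g :: "real^'d \<Rightarrow> 'b::banach"
  assumes cont: "continuous_on UNIV g" and per: "torus_periodic g" and h: "0 \<le> h" "h \<le> 2 * pi"
  shows "integral torus_cell (\<lambda>x. g (x + h *\<^sub>R axis i 1)) = integral torus_cell g"
proof -
  define e where "e = (axis i 1 :: real^'d)"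
  define c where "c = (torus_corner :: real^'d)"
  have e: "e \<in> Basis" by (simp add: e_def)
  have xe: "x \<bullet> e = x $ i" for x by (simp add: e_def inner_axis)
  have nth: "(h *\<^sub>R e) $ j = (if j = i then h else 0)" "c $ j = 2 * pi"
    "(c + h *\<^sub>R e) $ j = (if j = i then 2 * pi + h else 2 * pi)"
    "(c + h *\<^sub>R e - (2 * pi) *\<^sub>R e) $ j = (if j = i then h else 2 * pi)"
    "((2 * pi) *\<^sub>R e) $ j = (if j = i then 2 * pi else 0)" for j
    by (auto simp: e_def c_def axis_def)
  have int: "g integrable_on cbox a b" for a b
    by (rule integrable_continuous[OF continuous_on_subset[OF cont]]) simp
  have s1: "cbox 0 c \<inter> {x. x \<bullet> e \<le> h} = cbox 0 (c + h *\<^sub>R e - (2 * pi) *\<^sub>R e)"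
    using h unfolding set_eq_iff Int_iff mem_Collect_eq mem_box_cart nth xe by (auto split: if_splits intro: order_trans)
  have s2: "cbox 0 c \<inter> {x. x \<bullet> e \<ge> h} = cbox (h *\<^sub>R e) c"
    using h unfolding set_eq_iff Int_iff mem_Collect_eq mem_box_cart nth xe by (auto split: if_splits intro: order_trans)
  have s3: "cbox (h *\<^sub>R e) (c + h *\<^sub>R e) \<inter> {x. x \<bullet> e \<le> 2 * pi} = cbox (h *\<^sub>R e) c"
    using h unfolding set_eq_iff Int_iff mem_Collect_eq mem_box_cart nth xe by (auto split: if_splits; force)
  have s4: "cbox (h *\<^sub>R e) (c + h *\<^sub>R e) \<inter> {x. x \<bullet> e \<ge> 2 * pi} = cbox ((2 * pi) *\<^sub>R e) (c + h *\<^sub>R e)"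
    using h unfolding set_eq_iff Int_iff mem_Collect_eq mem_box_cart nth xe by (auto split: if_splits; force)
  have shift: "integral (cbox a b) g = integral (cbox (a - d) (b - d)) (\<lambda>x. g (x + d))" for a b d
    using has_integral_affinity'[OF integrable_integral[OF int[of a b]], of 1 d] by (simp add: integral_unique)
  have "integral torus_cell (\<lambda>x. g (x + h *\<^sub>R axis i 1)) = integral (cbox (h *\<^sub>R e) (c + h *\<^sub>R e)) g"
    using shift[of "h *\<^sub>R e" "c + h *\<^sub>R e" "h *\<^sub>R e"] by (simp add: torus_cell_def c_def e_def)
  also have "\<dots> = integral (cbox (h *\<^sub>R e) c) g + integral (cbox ((2 * pi) *\<^sub>R e) (c + h *\<^sub>R e)) g"
    using integral_split[OF int e, of "h *\<^sub>R e" "c + h *\<^sub>R e" "2 * pi"] unfolding s3 s4 .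
  also have "integral (cbox ((2 * pi) *\<^sub>R e) (c + h *\<^sub>R e)) g =
      integral (cbox 0 (c + h *\<^sub>R e - (2 * pi) *\<^sub>R e)) (\<lambda>x. g (x + (2 * pi) *\<^sub>R e))"
    using shift[of "(2 * pi) *\<^sub>R e" "c + h *\<^sub>R e" "(2 * pi) *\<^sub>R e"] by simp
  also have "(\<lambda>x. g (x + (2 * pi) *\<^sub>R e)) = g"
  proof -
    have "(2 * pi) *\<^sub>R e = axis i (2 * pi)" by (simp add: e_def axis_def vec_eq_iff)
    then show ?thesis using per by (simp add: torus_periodic_def)
  qed
  also have "integral (cbox (h *\<^sub>R e) c) g + integral (cbox 0 (c + h *\<^sub>R e - (2 * pi) *\<^sub>R e)) g = integral (cbox 0 c) g"
    using integral_split[OF int e, of 0 c h] unfolding s1 s2 by simp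
  finally show ?thesis by (simp add: torus_cell_def c_def)
qed

text \<open>By periodicity the integral of a translate does not depend on the shift; differentiating
  under the integral sign at shift 0 gives the claim without iterated integrals.\<close>

lemma torus_integral_derivative:
  fixes g :: "real^'d \<Rightarrow> 'b::banach"
  assumes cont: "continuous_on UNIV g" "continuous_on UNIV g'" and per: "torus_periodic g"
    and d: "\<And>x. ((\<lambda>s. g (x + s *\<^sub>R axis i 1)) has_vector_derivative g' x) (at 0)"
  shows "integral torus_cell g' = 0"
proof -
  \<comment> \<open>Shifts in a one-sided interval lie in the range of the translation lemma, and
    the derivative at 0 within it is still unique.\<close>
  let ?U = "{0..1::real}"
  have d': "((\<lambda>s. g (x + s *\<^sub>R axis i 1)) has_vector_derivative g' (x + s *\<^sub>R axis i 1)) (at s within ?U)" for x s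
  proof -
    have "((\<lambda>r. g (x + s *\<^sub>R axis i 1 + r *\<^sub>R axis i 1)) has_vector_derivative g' (x + s *\<^sub>R axis i 1)) (at (- s + s) within UNIV)"
      using d by simp
    from has_vector_derivative_shift[OF this]
    have "((\<lambda>r. g (x + r *\<^sub>R axis i 1)) has_vector_derivative g' (x + s *\<^sub>R axis i 1)) (at s)"
      by (simp add: algebra_simps)
    then show ?thesis by (rule has_vector_derivative_at_within)
  qed
  have "((\<lambda>s. integral (cbox 0 torus_corner) (\<lambda>x. g (x + s *\<^sub>R axis i 1))) has_vector_derivative
      integral (cbox 0 torus_corner) (\<lambda>x. g' (x + 0 *\<^sub>R axis i 1))) (at 0 within ?U)"
  proof (rule leibniz_rule_vector_derivative[OF d'])
    show "(\<lambda>x. g (x + s *\<^sub>R axis i 1)) integrable_on cbox 0 torus_corner" for s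
      by (intro integrable_continuous continuous_on_compose2[OF cont(1)] continuous_intros) auto
    show "continuous_on (?U \<times> cbox 0 torus_corner) (\<lambda>(s, x). g' (x + s *\<^sub>R axis i 1))"
      unfolding case_prod_beta by (intro continuous_on_compose2[OF cont(2)] continuous_intros) auto
  qed auto
  moreover have "((\<lambda>s. integral (cbox 0 torus_corner) (\<lambda>x. g (x + s *\<^sub>R axis i 1))) has_vector_derivative 0) (at 0 within ?U)"
  proof (rule has_vector_derivative_transform)
    show "((\<lambda>s. integral torus_cell g) has_vector_derivative 0) (at 0 within ?U)" by simp
    show "integral (cbox 0 torus_corner) (\<lambda>x. g (x + s *\<^sub>R axis i 1)) = integral torus_cell g" if "s \<in> ?U" for s
      using torus_integral_translation[OF cont(1) per, of s i] that pi_ge_two by (simp add: torus_cell_def)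
  qed simp
  moreover have "at (0::real) within ?U \<noteq> bot" by (simp add: trivial_limit_within)
  ultimately have "integral (cbox 0 torus_corner) (\<lambda>x. g' (x + 0 *\<^sub>R axis i 1)) = 0"
    using vector_derivative_unique_within by blast
  then show ?thesis by (simp add: torus_cell_def)
qed

lemma space_time_cell:
  fixes T :: real
  shows "torus_cell \<times> {0..T} = cbox (0, 0) (torus_corner, T)"
  unfolding torus_cell_def by (simp add: cbox_Pair_eq)

lemma continuous_on_slab_cell:
  "continuous_on (slab T) f \<Longrightarrow> continuous_on (cbox (0, 0) (torus_corner, T)) f"
  unfolding space_time_cell[symmetric] by (erule continuous_on_subset) auto

lemma space_time_set_integrable:
  fixes f :: "(real^'d) \<times> real \<Rightarrow> 'b::euclidean_space"
  assumes "continuous_on (slab T) f"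
  shows "set_integrable lebesgue (torus_cell \<times> {0..T}) f"
  unfolding space_time_cell by (rule absolutely_integrable_continuous[OF continuous_on_slab_cell[OF assms]])

lemma space_time_integral:
  fixes f :: "(real^'d) \<times> real \<Rightarrow> 'b::euclidean_space"
  assumes "continuous_on (slab T) f"
  shows "(LINT p:torus_cell \<times> {0..T}|lebesgue. f p) = integral (cbox (0, 0) (torus_corner, T)) f"
  using set_lebesgue_integral_eq_integral(2)[OF space_time_set_integrable[OF assms]] by (simp add: space_time_cell)

lemma L2_on_continuous:
  fixes f :: "(real^'d) \<times> real \<Rightarrow> 'b::euclidean_space"
  assumes "continuous_on (slab T) f"
  shows "L2_on (torus_cell \<times> {0..T}) f"
  unfolding L2_on_def
proof
  show "set_borel_measurable lebesgue (torus_cell \<times> {0..T}) f"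
    using space_time_set_integrable[OF assms] unfolding set_integrable_def set_borel_measurable_def
    by (rule borel_measurable_integrable)
  show "set_integrable lebesgue (torus_cell \<times> {0..T}) (\<lambda>p. (norm (f p))\<^sup>2)"
    by (intro space_time_set_integrable continuous_intros assms)
qed

text \<open>In the time direction the fundamental theorem meets vanishing end values; in a space
  direction each time slice integrates to zero by periodicity. Continuity justifies the order of
  integration.\<close>

lemma space_time_integral_derivative:
  fixes G :: "(real^'d) \<times> real \<Rightarrow> 'b::euclidean_space"
  assumes T: "0 \<le> T" and v: "v \<in> Basis" and G: "has_pd T v G G'"
    and cont: "continuous_on (slab T) G" "continuous_on (slab T) G'"
    and per: "\<And>t. t \<in> {0..T} \<Longrightarrow> torus_periodic (\<lambda>x. G (x, t))"
    and ends: "\<And>x. G (x, 0) = 0" "\<And>x. G (x, T) = 0"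
  shows "integral (cbox (0, 0) (torus_corner, T)) G' = 0"
proof -
  have iter: "integral (cbox (0, 0) (torus_corner, T)) G' =
      integral (cbox 0 torus_corner) (\<lambda>x. integral (cbox 0 T) (\<lambda>t. G' (x, t)))"
    by (rule integral_prod_continuous[OF continuous_on_slab_cell[OF cont(2)]])
  have sub: "continuous_on UNIV (\<lambda>x. F (x, t))"
    if "continuous_on (slab T) F" "t \<in> {0..T}" for F :: "(real^'d) \<times> real \<Rightarrow> 'b" and t
    by (rule continuous_on_compose2[OF that(1)]) (use that(2) in \<open>auto intro!: continuous_intros\<close>)
  consider "v = (0, 1)" | i where "v = (axis i 1, 0)" using v unfolding Basis_space_time by blast
  then show ?thesis
  proof cases
    case 1
    have "((\<lambda>t. G' (x, t)) has_integral (G (x, T) - G (x, 0))) {0..T}" for x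
    proof (rule fundamental_theorem_of_calculus[OF T])
      fix t assume t: "t \<in> {0..T}"
      have "((\<lambda>s. G (x, t + s)) has_vector_derivative G' (x, t)) (at (- t + t) within {s. t + s \<in> {0..T}})"
        using G t unfolding has_pd_def 1 slab_line_t by (force simp: mem_Times_iff)
      moreover have "{s. - t + s \<in> {s. t + s \<in> {0..T}}} = {0..T}" by auto
      ultimately show "((\<lambda>s. G (x, s)) has_vector_derivative G' (x, t)) (at t within {0..T})"
        using has_vector_derivative_shift[where a = "- t" and t = t and S = "{s. t + s \<in> {0..T}}"] by fastforce
    qed
    then have "integral (cbox 0 T) (\<lambda>t. G' (x, t)) = 0" for x
      using integral_unique by (fastforce simp: ends)
    then show ?thesis unfolding iter by simp
  next
    case (2 i)
    have "integral (cbox 0 torus_corner) (\<lambda>x. integral (cbox 0 T) (\<lambda>t. G' (x, t))) =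
        integral (cbox 0 T) (\<lambda>t. integral (cbox 0 torus_corner) (\<lambda>x. G' (x, t)))"
      by (rule integral_swap_continuous) (use continuous_on_slab_cell[OF cont(2)] in \<open>simp add: case_prod_eta\<close>)
    also have "\<dots> = integral (cbox 0 T) (\<lambda>t. 0)"
    proof (rule Henstock_Kurzweil_Integration.integral_cong)
      fix t assume "t \<in> cbox 0 T"
      then have t: "t \<in> {0..T}" by simp
      have "integral torus_cell (\<lambda>x. G' (x, t)) = 0"
      proof (rule torus_integral_derivative[OF sub[OF cont(1) t] sub[OF cont(2) t] per[OF t]])
        fix x :: "real^'d"
        have p: "(x, t) \<in> slab T" using t by simp
        from G p have "((\<lambda>s. G ((x, t) + s *\<^sub>R v)) has_vector_derivative G' (x, t))
            (at 0 within {s. (x, t) + s *\<^sub>R v \<in> slab T})"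
          unfolding has_pd_def by blast
        then show "((\<lambda>s. G (x + s *\<^sub>R axis i 1, t)) has_vector_derivative G' (x, t)) (at 0)"
          unfolding 2 slab_line_x[OF p] by simp
      qed
      then show "integral (cbox 0 torus_corner) (\<lambda>x. G' (x, t)) = 0" by (simp add: torus_cell_def)
    qed
    finally show ?thesis unfolding iter by simp
  qed
qed

section \<open>Test functions and integration by parts\<close>

lemma pds_append: "pds S (ws @ [v]) f = pds S ws (pd S v f)"
  by (induction ws) auto

text \<open>The head of a list is the outermost derivative, so differentiating the function itself
  corresponds to an entry at the end. Smoothness thus passes to partial derivatives.\<close>

lemma C_along_append: "C_along S (ws @ [v]) f \<Longrightarrow> C_along S ws (pd S v f)"
  by (induction ws) (auto simp: pds_append)

lemma C_infinity_pd: "C_infinity f \<Longrightarrow> v \<in> Basis \<Longrightarrow> C_infinity (pd UNIV v f)"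
  unfolding C_infinity_def
proof (intro allI impI)
  fix vs :: "'a list" assume *: "\<forall>vs. set vs \<subseteq> Basis \<longrightarrow> C_along UNIV vs f" "v \<in> Basis" "set vs \<subseteq> Basis"
  then have "C_along UNIV (vs @ [v]) f" by simp
  then show "C_along UNIV vs (pd UNIV v f)" by (rule C_along_append)
qed

lemma C_infinity_has_vector_derivative:
  assumes "C_infinity f" "v \<in> Basis"
  shows "((\<lambda>s. f (p + s *\<^sub>R v)) has_vector_derivative pd UNIV v f p) (at 0)"
proof -
  have "C_along UNIV [v] f" using assms unfolding C_infinity_def by (auto dest!: spec[of _ "[v]"] simp del: C_along.simps)
  then have "(\<lambda>s. f (p + s *\<^sub>R v)) differentiable (at 0)" by (simp add: pd_exists_def)
  then show ?thesis unfolding pd_def by (simp add: vector_derivative_works)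
qed

lemma C_infinity_continuous: "C_infinity f \<Longrightarrow> continuous_on S f"
  using continuous_on_subset[of UNIV f S] by (auto simp: C_infinity_def dest: spec[of _ "[]"])

lemma test_function_pd:
  assumes \<phi>: "test_function T \<phi>" and v: "v \<in> Basis"
  shows "test_function T (pd UNIV v \<phi>)"
  unfolding test_function_def
proof (intro conjI allI)
  have C: "C_infinity \<phi>" using \<phi> by (simp add: test_function_def)
  show "C_infinity (pd UNIV v \<phi>)" by (rule C_infinity_pd[OF C v])
  show "torus_periodic (\<lambda>x. pd UNIV v \<phi> (x, t))" for t
  proof -
    have per: "\<phi> (x + axis i (2 * pi), t) = \<phi> (x, t)" for x i t
      using \<phi> by (simp add: test_function_def torus_periodic_def)
    obtain a b where v': "v = (a, b)" by (cases v)
    have "\<phi> (x + axis i (2 * pi) + s *\<^sub>R a, t + s * b) = \<phi> (x + s *\<^sub>R a, t + s * b)" for x i s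
      using per[of "x + s *\<^sub>R a" i "t + s * b"] by (simp add: algebra_simps)
    then show ?thesis by (simp add: torus_periodic_def pd_def v')
  qed
  obtain a b where ab: "0 < a" "b < T" "\<And>x t. t \<notin> {a..b} \<Longrightarrow> \<phi> (x, t) = 0"
    using \<phi> by (auto simp: test_function_def)
  have "pd UNIV v \<phi> (x, t) = 0" if t: "t \<notin> {a..b}" for x t
  proof -
    \<comment> \<open>\<open>U\<close> consists of the parameters whose points on the line have time
      outside the closed interval \<open>{a..b}\<close>. It is an open neighbourhood of 0 on which
      the test function vanishes.\<close>
    define U where "U = {s. t + s * snd v \<notin> {a..b}}"
    have "U = (\<lambda>s. t + s * snd v) -` (- {a..b})" by (auto simp: U_def)
    moreover have "open \<dots>" by (intro open_vimage continuous_intros; simp)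
    ultimately have "open U" by simp
    have "((\<lambda>s. \<phi> ((x, t) + s *\<^sub>R v)) has_vector_derivative 0) (at 0)"
      by (rule has_vector_derivative_transform_within_open[OF _ \<open>open U\<close>, of "\<lambda>_. 0"])
        (use t ab(3) in \<open>auto simp: U_def plus_prod_def\<close>)
    then show ?thesis
      using C_infinity_has_vector_derivative[OF C v, of "(x, t)"] vector_derivative_unique_at by blast
  qed
  with ab show "\<exists>a b. 0 < a \<and> b < T \<and> (\<forall>x t. t \<notin> {a..b} \<longrightarrow> pd UNIV v \<phi> (x, t) = 0)" by blast
qed

lemma test_function_pds: "test_function T \<phi> \<Longrightarrow> set vs \<subseteq> Basis \<Longrightarrow> test_function T (pds UNIV vs \<phi>)"
  by (induction vs) (auto intro: test_function_pd)

text \<open>The product rule turns the claim into a vanishing integral of a derivative of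
  \<open>\<phi> p *\<^sub>R f p\<close>. The time support of \<open>\<phi>\<close> removes the end
  values, so one-sided time derivatives of \<open>f\<close> suffice.\<close>

lemma integration_by_parts:
  fixes f :: "(real^'d) \<times> real \<Rightarrow> real^'n"
  assumes T: "0 < T" and v: "v \<in> Basis" and f: "has_pd T v f f'"
    and cont: "continuous_on (slab T) f" "continuous_on (slab T) f'"
    and per: "\<And>t. t \<in> {0..T} \<Longrightarrow> torus_periodic (\<lambda>x. f (x, t))"
    and \<phi>: "test_function T \<phi>"
  shows "(LINT p:torus_cell \<times> {0..T}|lebesgue. pd UNIV v \<phi> p *\<^sub>R f p) =
    - (LINT p:torus_cell \<times> {0..T}|lebesgue. \<phi> p *\<^sub>R f' p)"
proof -
  have C: "C_infinity \<phi>" "C_infinity (pd UNIV v \<phi>)"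
    using \<phi> test_function_pd[OF \<phi> v] by (simp_all add: test_function_def)
  note c\<phi> = C[THEN C_infinity_continuous]
  have cf: "continuous_on (slab T) (\<lambda>p. pd UNIV v \<phi> p *\<^sub>R f p)" "continuous_on (slab T) (\<lambda>p. \<phi> p *\<^sub>R f' p)"
    "continuous_on (slab T) (\<lambda>p. \<phi> p *\<^sub>R f p)"
    by (intro continuous_intros cont c\<phi>)+
  obtain a b where ab: "0 < a" "b < T" "\<And>x t. t \<notin> {a..b} \<Longrightarrow> \<phi> (x, t) = 0"
    using \<phi> by (auto simp: test_function_def)
  have "integral (cbox (0, 0) (torus_corner, T)) (\<lambda>p. \<phi> p *\<^sub>R f' p + pd UNIV v \<phi> p *\<^sub>R f p) = 0"
  proof (rule space_time_integral_derivative[where G = "\<lambda>p. \<phi> p *\<^sub>R f p" and v = v])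
    show "has_pd T v (\<lambda>p. \<phi> p *\<^sub>R f p) (\<lambda>p. \<phi> p *\<^sub>R f' p + pd UNIV v \<phi> p *\<^sub>R f p)"
      unfolding has_pd_def
    proof
      fix p :: "(real^'d) \<times> real" assume p: "p \<in> slab T"
      have 1: "((\<lambda>s. \<phi> (p + s *\<^sub>R v)) has_real_derivative pd UNIV v \<phi> p) (at 0 within {s. p + s *\<^sub>R v \<in> slab T})"
        unfolding has_real_derivative_iff_has_vector_derivative
        by (rule has_vector_derivative_at_within[OF C_infinity_has_vector_derivative[OF C(1) v]])
      have 2: "((\<lambda>s. f (p + s *\<^sub>R v)) has_vector_derivative f' p) (at 0 within {s. p + s *\<^sub>R v \<in> slab T})"
        using f p unfolding has_pd_def by blast
      show "((\<lambda>s. \<phi> (p + s *\<^sub>R v) *\<^sub>R f (p + s *\<^sub>R v)) has_vector_derivative \<phi> p *\<^sub>R f' p + pd UNIV v \<phi> p *\<^sub>R f p)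
          (at 0 within {s. p + s *\<^sub>R v \<in> slab T})"
        using has_vector_derivative_scaleR[OF 1 2] by simp
    qed
    show "torus_periodic (\<lambda>x. \<phi> (x, t) *\<^sub>R f (x, t))" if "t \<in> {0..T}" for t
      using per[OF that] \<phi> by (simp add: torus_periodic_def test_function_def)
  qed (use T v cf ab in \<open>auto intro: continuous_on_add\<close>)
  then have "integral (cbox (0, 0) (torus_corner, T)) (\<lambda>p. \<phi> p *\<^sub>R f' p)
      + integral (cbox (0, 0) (torus_corner, T)) (\<lambda>p. pd UNIV v \<phi> p *\<^sub>R f p) = 0"
    by (subst (asm) Henstock_Kurzweil_Integration.integral_add)
      (use cf in \<open>auto intro!: integrable_continuous continuous_on_slab_cell\<close>)
  then show ?thesis unfolding space_time_integral[OF cf(1)] space_time_integral[OF cf(2)]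
    by (simp add: add_eq_0_iff2 add.commute)
qed

text \<open>The outermost derivative of the test function is the first to move, and becomes the
  first derivative of \<open>f\<close>; \<open>creg\<close> unfolds in just this order, and each
  move contributes a factor \<open>- 1\<close>.\<close>

lemma creg_weak_pds:
  fixes f :: "(real^'d) \<times> real \<Rightarrow> real^'n"
  assumes T: "0 < T"
  shows "creg r T f \<Longrightarrow> set vs \<subseteq> Basis \<Longrightarrow> length vs \<le> r \<Longrightarrow> \<exists>g. continuous_on (slab T) g \<and> weak_pds T vs f g"
proof (induction vs arbitrary: r f)
  case Nil
  then have "continuous_on (slab T) f" by (cases r) auto
  then show ?case by (auto simp: weak_pds_def)
next
  case (Cons v vs)
  then obtain r' where r: "r = Suc r'" "length vs \<le> r'" by (cases r) auto
  obtain f' where f': "has_pd T v f f'" "creg r' T f'"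
    using Cons.prems unfolding r creg.simps(2) by auto
  obtain g where g: "continuous_on (slab T) g" "weak_pds T vs f' g"
    using Cons.IH[OF f'(2) _ r(2)] Cons.prems by auto
  have cf: "continuous_on (slab T) f" "\<And>t. t \<in> {0..T} \<Longrightarrow> torus_periodic (\<lambda>x. f (x, t))"
    using Cons.prems(1) unfolding r creg.simps(2) by auto
  have cf': "continuous_on (slab T) f'" using f'(2) by (cases r') auto
  have "weak_pds T (v # vs) f g"
    unfolding weak_pds_def
  proof (intro allI impI)
    fix \<phi> :: "(real^'d) \<times> real \<Rightarrow> real" assume \<phi>: "test_function T \<phi>"
    have \<psi>: "test_function T (pds UNIV vs \<phi>)" by (rule test_function_pds[OF \<phi>]) (use Cons.prems in simp)
    have v: "v \<in> Basis" using Cons.prems by simp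
    have "(LINT p:torus_cell \<times> {0..T}|lebesgue. pds UNIV (v # vs) \<phi> p *\<^sub>R f p) =
        - (LINT p:torus_cell \<times> {0..T}|lebesgue. pds UNIV vs \<phi> p *\<^sub>R f' p)"
      using integration_by_parts[OF T v f'(1) cf(1) cf' cf(2) \<psi>] by simp
    also have "\<dots> = - ((-1) ^ length vs *\<^sub>R (LINT p:torus_cell \<times> {0..T}|lebesgue. \<phi> p *\<^sub>R g p))"
      using g(2) \<phi> unfolding weak_pds_def by simp
    finally show "(LINT p:torus_cell \<times> {0..T}|lebesgue. pds UNIV (v # vs) \<phi> p *\<^sub>R f p) =
        (-1) ^ length (v # vs) *\<^sub>R (LINT p:torus_cell \<times> {0..T}|lebesgue. \<phi> p *\<^sub>R g p)" by simp
  qed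
  with g(1) show ?case by blast
qed

lemma creg_sobolev_spacetime:
  assumes T: "0 < T" and f: "creg k T f"
  shows "sobolev_spacetime k T f"
proof -
  have "continuous_on (slab T) f \<and> (\<forall>t\<in>{0..T}. torus_periodic (\<lambda>x. f (x, t)))"
    using f by (cases k) auto
  then show ?thesis
    unfolding sobolev_spacetime_def using creg_weak_pds[OF T f] L2_on_continuous by blast
qed



section \<open>Fourier coefficients determine an integrable function\<close>

lemma compact_torus_cell: "compact (torus_cell :: (real^'d) set)"
  by (simp add: torus_cell_def compact_cbox)

lemma set_integrable_bounded_mult:
  fixes f :: "'a::euclidean_space \<Rightarrow> real" and h :: "'a \<Rightarrow> 'b::euclidean_space"
  assumes f: "set_integrable lebesgue A f" and h: "continuous_on UNIV h" and B: "\<And>x. norm (h x) \<le> B"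
  shows "set_integrable lebesgue A (\<lambda>x. f x *\<^sub>R h x)"
  unfolding set_integrable_def
proof (rule Bochner_Integration.integrable_bound)
  show "integrable lebesgue (\<lambda>x. B * (indicator A x *\<^sub>R f x))"
    using f unfolding set_integrable_def by (rule integrable_mult_right)
  have [measurable]: "h \<in> borel_measurable lebesgue"
    by (rule measurable_completion) (simp add: borel_measurable_continuous_onI h)
  have [measurable]: "(\<lambda>x. indicator A x *\<^sub>R f x) \<in> borel_measurable lebesgue"
    using f unfolding set_integrable_def by (rule borel_measurable_integrable)
  have "(\<lambda>x. (indicator A x *\<^sub>R f x) *\<^sub>R h x) \<in> borel_measurable lebesgue" by measurable
  then show "(\<lambda>x. indicator A x *\<^sub>R f x *\<^sub>R h x) \<in> borel_measurable lebesgue" by simp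
  have "0 \<le> B" using B[of 0] norm_ge_zero order_trans by blast
  have "norm (indicator A x *\<^sub>R f x *\<^sub>R h x) \<le> norm (B * (indicator A x *\<^sub>R f x))" for x
  proof -
    have "norm (indicator A x *\<^sub>R f x *\<^sub>R h x) = norm (h x) * \<bar>indicator A x *\<^sub>R f x\<bar>"
      by (simp add: mult_ac abs_mult)
    also have "\<dots> \<le> B * \<bar>indicator A x *\<^sub>R f x\<bar>" by (rule mult_right_mono[OF B]) simp
    finally show ?thesis using \<open>0 \<le> B\<close> by (simp add: abs_mult)
  qed
  then show "AE x in lebesgue. norm (indicator A x *\<^sub>R f x *\<^sub>R h x) \<le> norm (B * (indicator A x *\<^sub>R f x))"
    by simp
qed

section \<open>Trigonometric polynomials and the embedding of the torus\<close>

inductive trig_poly :: "(real^'d \<Rightarrow> complex) \<Rightarrow> bool" where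
  mono: "trig_poly (\<lambda>x. a * cis (of_int_vec n \<bullet> x))"
| add: "trig_poly p \<Longrightarrow> trig_poly q \<Longrightarrow> trig_poly (\<lambda>x. p x + q x)"

lemma trig_poly_mult:
  assumes "trig_poly p" "trig_poly q"
  shows "trig_poly (\<lambda>x. p x * q x)"
  using assms(1)
proof (induction p rule: trig_poly.induct)
  case (mono a n)
  show ?case using assms(2)
  proof (induction q rule: trig_poly.induct)
    case (mono b m)
    have "(\<lambda>x. a * cis (of_int_vec n \<bullet> x) * (b * cis (of_int_vec m \<bullet> x))) =
        (\<lambda>x. (a * b) * cis (of_int_vec (n + m) \<bullet> x))"
      by (simp add: fun_eq_iff of_int_vec_add inner_add_left cis_mult[symmetric])
    then show ?case by (simp only: trig_poly.mono)
  next
    case (add p q)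
    then show ?case using trig_poly.add by (simp add: distrib_left)
  qed
next
  case (add p q)
  then show ?case using trig_poly.add by (simp add: distrib_right)
qed

lemma trig_poly_const: "trig_poly (\<lambda>x. a)"
  using trig_poly.mono[of a 0] by (simp add: of_int_vec_zero)

lemma trig_poly_sum: "finite I \<Longrightarrow> (\<And>i. i \<in> I \<Longrightarrow> trig_poly (p i)) \<Longrightarrow> trig_poly (\<lambda>x. \<Sum>i\<in>I. p i x)"
  by (induction I rule: finite_induct) (auto intro: trig_poly_const trig_poly.add)

lemma trig_poly_cis_coordinate:
  "trig_poly (\<lambda>x. a * cis (x $ i))" "trig_poly (\<lambda>x. a * cis (- (x $ i)))"
proof -
  have "of_int_vec (axis i 1) \<bullet> x = x $ i" for x :: "real^'a"
  proof -
    have "of_int_vec (axis i 1) = axis i 1" by (simp add: of_int_vec_def vec_eq_iff axis_def)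
    then show ?thesis by (simp add: inner_axis')
  qed
  then show "trig_poly (\<lambda>x. a * cis (x $ i))" "trig_poly (\<lambda>x. a * cis (- (x $ i)))"
    using trig_poly.mono[of a "axis i 1"] trig_poly.mono[of a "- axis i 1"] by (simp_all add: of_int_vec_uminus)
qed

lemma trig_poly_cos_sin:
  "trig_poly (\<lambda>x. of_real (cos (x $ i)))" "trig_poly (\<lambda>x. of_real (sin (x $ i)))"
proof -
  have "of_real (cos t) = 1/2 * cis t + 1/2 * cis (- t)" "of_real (sin t) = - \<i>/2 * cis t + \<i>/2 * cis (- t)" for t
    by (simp_all add: complex_eq_iff)
  then show "trig_poly (\<lambda>x. of_real (cos (x $ i)))" "trig_poly (\<lambda>x. of_real (sin (x $ i)))"
    by (simp_all only: trig_poly.add trig_poly_cis_coordinate)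
qed

text \<open>Embeds the torus as a compact subset of Euclidean space, where the Stone-Weierstrass
  theorem for polynomials applies. The real coordinates are cosines and sines of the
  \<open>x $ i\<close>, so polynomials pull back to trigonometric polynomials.\<close>

definition torus_map :: "real^'d \<Rightarrow> complex^'d" where
  "torus_map x = (\<chi> i. cis (x $ i))"

lemma continuous_on_torus_map: "continuous_on S torus_map"
  unfolding torus_map_def[abs_def] by (intro continuous_intros)

lemma torus_map_expand:
  "torus_map x = (\<Sum>i\<in>UNIV. cos (x $ i) *\<^sub>R axis i 1 + sin (x $ i) *\<^sub>R axis i \<i>)"
proof (rule vec_eq_iff[THEN iffD2], rule allI)
  fix j
  have "(\<Sum>i\<in>UNIV. cos (x $ i) *\<^sub>R axis i 1 + sin (x $ i) *\<^sub>R axis i \<i>) $ j =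
      (\<Sum>i\<in>UNIV. if i = j then cis (x $ i) else 0)"
    unfolding sum_component by (rule sum.cong) (auto simp: axis_def complex_eq_iff)
  then show "torus_map x $ j = (\<Sum>i\<in>UNIV. cos (x $ i) *\<^sub>R axis i 1 + sin (x $ i) *\<^sub>R axis i \<i>) $ j"
    by (simp add: torus_map_def)
qed

lemma trig_poly_real_polynomial:
  "real_polynomial_function p \<Longrightarrow> trig_poly (\<lambda>x. of_real (p (torus_map x)))"
proof (induction p rule: real_polynomial_function.induct)
  case (linear f)
  then have lin: "linear f" by (simp add: bounded_linear.linear)
  have "f (torus_map x) = (\<Sum>i\<in>UNIV. cos (x $ i) * f (axis i 1) + sin (x $ i) * f (axis i \<i>))" for x
    unfolding torus_map_expand by (simp add: linear_sum[OF lin] linear_add[OF lin] linear_cmul[OF lin])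
  then have eq: "(\<lambda>x. complex_of_real (f (torus_map x))) =
      (\<lambda>x. \<Sum>i\<in>UNIV. of_real (cos (x $ i)) * of_real (f (axis i 1)) + of_real (sin (x $ i)) * of_real (f (axis i \<i>)))"
    by simp
  show ?case unfolding eq
    by (intro trig_poly_sum trig_poly.add trig_poly_mult trig_poly_cos_sin trig_poly_const) auto
next
  case (const c)
  show ?case by (rule trig_poly_const)
next
  case (add f g)
  then show ?case using trig_poly.add by simp
next
  case (mult f g)
  then show ?case using trig_poly_mult by simp
qed

lemma trig_poly_continuous: "trig_poly p \<Longrightarrow> continuous_on UNIV p"
  by (induction p rule: trig_poly.induct) (auto intro!: continuous_intros)

lemma trig_poly_bounded: "trig_poly p \<Longrightarrow> \<exists>B. \<forall>x. norm (p x) \<le> B"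
proof (induction p rule: trig_poly.induct)
  case (mono a n)
  then show ?case by (intro exI[of _ "norm a"]) (simp add: norm_mult)
next
  case (add p q)
  then obtain B C where "\<forall>x. norm (p x) \<le> B" "\<forall>x. norm (q x) \<le> C" by blast
  then show ?case by (intro exI[of _ "B + C"]) (blast intro: norm_triangle_mono)
qed

lemma sigma_finite_measure_lebesgue: "sigma_finite_measure (lebesgue :: 'a::euclidean_space measure)"
proof
  have un: "\<Union> (range (\<lambda>n::nat. cball (0::'a) n)) = UNIV"
    using real_arch_simple by (auto simp: set_eq_iff)
  moreover have fin: "emeasure lebesgue (cball (0::'a) r) \<noteq> \<infinity>" for r
    using fmeasurableD2[OF lmeasurable_cball] by simp
  ultimately show "\<exists>A::'a set set. countable A \<and> A \<subseteq> sets lebesgue \<and> \<Union> A = space lebesgue \<and>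
      (\<forall>a\<in>A. emeasure lebesgue a \<noteq> \<infinity>)"
    by - (rule exI[of _ "range (\<lambda>n::nat. cball (0::'a) n)"], use un fin in auto)
qed

context
  fixes f :: "real^'d \<Rightarrow> real"
  assumes f: "set_integrable lebesgue torus_cell f"
    and coeff: "\<And>n. fourier_coeff f n = 0"
begin

lemma integral_trig_poly_eq_0:
  "trig_poly p \<Longrightarrow> (LINT x:torus_cell|lebesgue. f x *\<^sub>R p x) = 0"
proof (induction p rule: trig_poly.induct)
  case (mono a n)
  have "(LINT x:torus_cell|lebesgue. f x *\<^sub>R cis (- (of_int_vec (- n) \<bullet> x))) = 0"
    using coeff[of "- n"] by (simp add: fourier_coeff_def)
  then have eq0: "(LINT x:torus_cell|lebesgue. f x *\<^sub>R cis (of_int_vec n \<bullet> x)) = 0"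
    by (simp add: of_int_vec_uminus)
  have "(LINT x:torus_cell|lebesgue. f x *\<^sub>R (a * cis (of_int_vec n \<bullet> x))) =
      (LINT x:torus_cell|lebesgue. a * (f x *\<^sub>R cis (of_int_vec n \<bullet> x)))"
    by (simp only: mult_scaleR_right)
  also have "\<dots> = a * (LINT x:torus_cell|lebesgue. f x *\<^sub>R cis (of_int_vec n \<bullet> x))"
    by (rule set_integral_mult_right)
  finally show ?case using eq0 by simp
next
  case (add p q)
  have i: "set_integrable lebesgue torus_cell (\<lambda>x. f x *\<^sub>R r x)" if "trig_poly r" for r :: "real^'d \<Rightarrow> complex"
    using trig_poly_bounded[OF that] set_integrable_bounded_mult[OF f trig_poly_continuous[OF that]] by blast
  show ?case using set_integral_add(2)[OF i[OF add.hyps(1)] i[OF add.hyps(2)]] add.IH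
    by (simp add: scaleR_add_right)
qed

text \<open>Polynomials integrate to zero against \<open>f\<close>, and a polynomial uniformly
  \<open>e\<close>-close to \<open>h\<close> on the compact image changes the integral by at most
  \<open>e\<close> times the integral of the absolute value of \<open>f\<close>.\<close>

lemma integral_torus_continuous_eq_0:
  assumes h: "continuous_on UNIV h"
  shows "(LINT x:torus_cell|lebesgue. f x * h (torus_map x)) = 0"
proof -
  define K where "K = torus_map ` (torus_cell :: (real^'d) set)"
  have K: "compact K"
    unfolding K_def by (rule compact_continuous_image[OF continuous_on_torus_map compact_torus_cell])
  define N where "N = (LINT x:torus_cell|lebesgue. norm (f x))"
  have absf: "set_integrable lebesgue torus_cell (\<lambda>x. norm (f x))" by (rule set_integrable_norm[OF f])
  have tc: "continuous_on UNIV (\<lambda>x. q (torus_map x))" if "continuous_on UNIV q" for q :: "complex^'d \<Rightarrow> real"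
    by (rule continuous_on_compose2[OF that continuous_on_torus_map]) simp
  have bdd: "\<exists>B. \<forall>x. norm (q (torus_map x)) \<le> B" if "continuous_on UNIV q" for q :: "complex^'d \<Rightarrow> real"
  proof -
    \<comment> \<open>The integrability lemma wants a bound on all of space, not just the cell; the
      map takes every point into this polydisc, which lies in a compact ball.\<close>
    define C where "C = {z :: complex^'d. \<forall>i. cmod (z $ i) \<le> 1}"
    have "C \<subseteq> cball 0 (real CARD('d))"
    proof
      fix z assume "z \<in> C"
      then have "norm z \<le> (\<Sum>i\<in>(UNIV::'d set). 1)"
        unfolding C_def by (intro order_trans[OF L2_set_le_sum[of UNIV "\<lambda>i. norm (z $ i)", folded norm_vec_def]] sum_mono) auto
      then show "z \<in> cball 0 (real CARD('d))" by simp
    qed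
    then have "\<exists>B. \<forall>z\<in>cball (0::complex^'d) (real CARD('d)). norm (q z) \<le> B"
      using compact_imp_bounded[OF compact_continuous_image[OF continuous_on_subset[OF that] compact_cball]]
      by (auto simp: bounded_iff)
    moreover have "torus_map x \<in> C" for x by (simp add: C_def torus_map_def)
    ultimately show ?thesis using \<open>C \<subseteq> _\<close> by blast
  qed
  have int: "set_integrable lebesgue torus_cell (\<lambda>x. f x * q (torus_map x))" if "continuous_on UNIV q" for q
    using bdd[OF that] set_integrable_bounded_mult[OF f tc[OF that]] by force
  have "\<bar>LINT x:torus_cell|lebesgue. f x * h (torus_map x)\<bar> \<le> e * N" if e: "e > 0" for e
  proof -
    obtain p where p: "real_polynomial_function p" "\<And>z. z \<in> K \<Longrightarrow> \<bar>h z - p z\<bar> < e"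
      using Stone_Weierstrass_real_polynomial_function[OF K continuous_on_subset[OF h] e] by blast
    have cp: "continuous_on UNIV p"
      using p(1) by (simp add: continuous_on_polymonial_function real_polynomial_function_eq)
    have "complex_of_real (LINT x:torus_cell|lebesgue. f x * p (torus_map x)) = 0"
      using integral_trig_poly_eq_0[OF trig_poly_real_polynomial[OF p(1)]]
      by (simp add: set_integral_complex_of_real[symmetric] scaleR_conv_of_real)
    then have "(LINT x:torus_cell|lebesgue. f x * h (torus_map x)) =
        (LINT x:torus_cell|lebesgue. f x * h (torus_map x)) - (LINT x:torus_cell|lebesgue. f x * p (torus_map x))"
      by simp
    also have "\<dots> = (LINT x:torus_cell|lebesgue. f x * h (torus_map x) - f x * p (torus_map x))"
      by (rule set_integral_diff(2)[OF int[OF h] int[OF cp], symmetric])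
    also have "\<bar>\<dots>\<bar> \<le> (LINT x:torus_cell|lebesgue. norm (f x * h (torus_map x) - f x * p (torus_map x)))"
      using set_integral_norm_bound[OF set_integral_diff(1)[OF int[OF h] int[OF cp]]] by simp
    also have "\<dots> \<le> (LINT x:torus_cell|lebesgue. e * norm (f x))"
    proof (rule set_integral_mono)
      show "set_integrable lebesgue torus_cell (\<lambda>x. norm (f x * h (torus_map x) - f x * p (torus_map x)))"
        by (rule set_integrable_norm[OF set_integral_diff(1)[OF int[OF h] int[OF cp]]])
      show "set_integrable lebesgue torus_cell (\<lambda>x. e * norm (f x))" using absf by simp
      fix x :: "real^'d" assume "x \<in> torus_cell"
      then have "\<bar>h (torus_map x) - p (torus_map x)\<bar> \<le> e" using p(2)[of "torus_map x"] by (force simp: K_def)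
      then have "\<bar>f x\<bar> * \<bar>h (torus_map x) - p (torus_map x)\<bar> \<le> \<bar>f x\<bar> * e" by (rule mult_left_mono) simp
      then show "norm (f x * h (torus_map x) - f x * p (torus_map x)) \<le> e * norm (f x)"
        by (simp add: right_diff_distrib[symmetric] abs_mult mult.commute)
    qed
    also have "\<dots> = e * N" by (simp add: N_def)
    finally show ?thesis .
  qed
  then have "\<bar>LINT x:torus_cell|lebesgue. f x * h (torus_map x)\<bar> \<le> 0 + d" if "d > 0" for d
  proof -
    \<comment> \<open>Dividing by \<open>N + 1\<close> rather than \<open>N\<close> covers the case
      \<open>N = 0\<close>.\<close>
    have "N \<ge> 0" unfolding N_def set_lebesgue_integral_def by (rule integral_nonneg_AE) auto
    then have "d / (N + 1) * N \<le> d" using that by (simp add: field_simps)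
    moreover have "d / (N + 1) > 0" using that \<open>N \<ge> 0\<close> by simp
    ultimately show ?thesis
      using \<open>\<And>e. e > 0 \<Longrightarrow> \<bar>LINT x:torus_cell|lebesgue. f x * h (torus_map x)\<bar> \<le> e * N\<close>[of "d / (N + 1)"] by linarith
  qed
  then have "\<bar>LINT x:torus_cell|lebesgue. f x * h (torus_map x)\<bar> \<le> 0" by (rule field_le_epsilon)
  then show ?thesis by simp
qed

text \<open>An open arc of the circle is cut out by a half plane, so the indicator of a box in the cell
  is a limit of continuous functions of the point \<open>torus_map x\<close>.\<close>

lemma cos_arc_iff:
  assumes "0 \<le> a" "a \<le> b" "b \<le> 2 * pi" "0 \<le> x" "x \<le> 2 * pi"
  shows "cos ((b - a) / 2) < cos (x - (a + b) / 2) \<longleftrightarrow> a < x \<and> x < b"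
proof -
  define r where "r = (b - a) / 2"
  define y where "y = \<bar>x - (a + b) / 2\<bar>"
  have ab: "a = (a + b) / 2 - r" "b = (a + b) / 2 + r" by (simp_all add: r_def field_simps)
  have r: "0 \<le> r" "r \<le> pi" using assms by (auto simp: r_def)
  have y: "0 \<le> y" "y \<le> 2 * pi - r" using assms ab unfolding y_def by linarith+
  have "cos r < cos y \<longleftrightarrow> y < r"
  proof (cases "y \<le> pi")
    case True
    then show ?thesis using r y by (simp add: cos_mono_less_eq)
  next
    case False
    have "cos (2 * pi - y) \<le> cos r" using False r y by (intro cos_monotone_0_pi_le) auto
    moreover have "cos (2 * pi - y) = cos y" by (simp add: cos_diff)
    ultimately show ?thesis using False r by auto
  qed
  moreover have "cos y = cos (x - (a + b) / 2)" by (simp add: y_def)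
  moreover have "y < r \<longleftrightarrow> a < x \<and> x < b" using ab unfolding y_def by linarith
  ultimately show ?thesis by (simp add: r_def)
qed

lemma tendsto_truncated_indicator:
  "(\<lambda>N. min 1 (real N * max 0 q)) \<longlonglongrightarrow> (if 0 < q then 1 else 0)"
proof (cases "0 < q")
  case True
  have "\<forall>\<^sub>F N in sequentially. min 1 (real N * max 0 q) = 1"
    using eventually_ge_at_top[of "nat \<lceil>1 / q\<rceil>"]
  proof eventually_elim
    case (elim N)
    then have "1 / q \<le> real N" using nat_ceiling_le_eq by blast
    then show ?case using True by (simp add: field_simps)
  qed
  then show ?thesis using True by (simp add: tendsto_eventually)
qed simp

text \<open>Products over the coordinates of truncated multiples of the arc functions converge
  pointwise on the cell to the indicator of the open box and stay between 0 and 1, so dominated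
  convergence applies with the absolute value of \<open>f\<close>.\<close>

lemma integral_subbox_eq_0:
  assumes "\<And>i. 0 \<le> a $ i" "\<And>i. a $ i \<le> b $ i" "\<And>i. b $ i \<le> 2 * pi"
  shows "(LINT x:box a b|lebesgue. f x) = 0"
proof -
  \<comment> \<open>The half plane for coordinate \<open>i\<close> is orthogonal to the midpoint
    \<open>cis ((a $ i + b $ i) / 2)\<close> of the arc, at distance the cosine of the half
    width.\<close>
  define q where "q i z = Re (z $ i * cnj (cis ((a $ i + b $ i) / 2))) - cos ((b $ i - a $ i) / 2)" for i and z :: "complex^'d"
  define h where "h N z = (\<Prod>i\<in>UNIV. min 1 (real N * max 0 (q i z)))" for N z
  have hc: "continuous_on UNIV (h N)" for N
    unfolding h_def[abs_def] q_def by (intro continuous_intros)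
  have q: "q i (torus_map x) = cos (x $ i - (a $ i + b $ i) / 2) - cos ((b $ i - a $ i) / 2)" for i x
    by (simp add: q_def torus_map_def cis_cnj cis_mult)
  have ind: "(\<Prod>i\<in>UNIV. if 0 < q i (torus_map x) then 1 else 0) = (indicator (box a b) x :: real)" if "x \<in> torus_cell" for x
  proof -
    have "0 \<le> x $ i \<and> x $ i \<le> 2 * pi" for i using that by (auto simp: torus_cell_def mem_box_cart)
    then have "0 < q i (torus_map x) \<longleftrightarrow> a $ i < x $ i \<and> x $ i < b $ i" for i
      using cos_arc_iff[of "a $ i" "b $ i" "x $ i"] assms[of i] by (simp add: q)
    then have eq: "(if 0 < q i (torus_map x) then 1 else 0 :: real) = (if a $ i < x $ i \<and> x $ i < b $ i then 1 else 0)" for i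
      by (simp only:)
    show ?thesis
    proof (cases "x \<in> box a b")
      case True
      then show ?thesis unfolding eq by (simp add: mem_box_cart)
    next
      case False
      then obtain i where "\<not> (a $ i < x $ i \<and> x $ i < b $ i)" by (auto simp: mem_box_cart)
      then have "(\<Prod>i\<in>UNIV. if a $ i < x $ i \<and> x $ i < b $ i then 1 else 0 :: real) = 0"
        by (intro prod_zero) auto
      then show ?thesis unfolding eq using False by simp
    qed
  qed
  have h01: "0 \<le> h N z" "h N z \<le> 1" for N z
    unfolding h_def by (auto intro!: prod_nonneg prod_le_1)
  have fm: "integrable lebesgue (\<lambda>x. indicator torus_cell x *\<^sub>R f x)" using f by (simp add: set_integrable_def)
  have [measurable]: "(\<lambda>x. indicator torus_cell x *\<^sub>R f x) \<in> borel_measurable lebesgue"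
    using fm by (rule borel_measurable_integrable)
  have [measurable]: "(\<lambda>x. h N (torus_map x)) \<in> borel_measurable lebesgue" for N
    by (intro measurable_completion)
      (simp add: borel_measurable_continuous_onI continuous_on_compose2[OF hc continuous_on_torus_map])
  have [measurable]: "box a b \<in> sets lebesgue" by simp
  have "(\<lambda>N. LINT x|lebesgue. (indicator torus_cell x *\<^sub>R f x) * h N (torus_map x)) \<longlonglongrightarrow>
      (LINT x|lebesgue. (indicator torus_cell x *\<^sub>R f x) * indicator (box a b) x)"
  proof (rule integral_dominated_convergence[where w = "\<lambda>x. \<bar>indicator torus_cell x *\<^sub>R f x\<bar>"])
    show "integrable lebesgue (\<lambda>x. \<bar>indicator torus_cell x *\<^sub>R f x\<bar>)" using fm by (rule integrable_abs)
    show "AE x in lebesgue. (\<lambda>N. (indicator torus_cell x *\<^sub>R f x) * h N (torus_map x)) \<longlonglongrightarrow>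
        (indicator torus_cell x *\<^sub>R f x) * indicator (box a b) x"
    proof (rule AE_I2)
      fix x :: "real^'d"
      have "(\<lambda>N. h N (torus_map x)) \<longlonglongrightarrow> (\<Prod>i\<in>UNIV. if 0 < q i (torus_map x) then 1 else 0)"
        unfolding h_def by (intro tendsto_prod tendsto_truncated_indicator)
      then show "(\<lambda>N. (indicator torus_cell x *\<^sub>R f x) * h N (torus_map x)) \<longlonglongrightarrow>
        (indicator torus_cell x *\<^sub>R f x) * indicator (box a b) x"
        using ind[of x] by (cases "x \<in> torus_cell") (auto intro!: tendsto_mult)
    qed
    have "\<bar>c * h N z\<bar> \<le> \<bar>c\<bar>" for c N z
      using mult_left_mono[OF h01(2) abs_ge_zero, of c N z] h01(1)[of N z] by (simp add: abs_mult)
    then show "AE x in lebesgue. norm ((indicator torus_cell x *\<^sub>R f x) * h N (torus_map x)) \<le> \<bar>indicator torus_cell x *\<^sub>R f x\<bar>" for N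
      by (intro AE_I2) (simp only: real_norm_def)
  qed measurable
  moreover have "(LINT x|lebesgue. (indicator torus_cell x *\<^sub>R f x) * h N (torus_map x)) = 0" for N
    using integral_torus_continuous_eq_0[OF hc, of N] by (simp add: set_lebesgue_integral_def mult.assoc)
  ultimately have "(LINT x|lebesgue. (indicator torus_cell x *\<^sub>R f x) * indicator (box a b) x) = 0"
    by (simp add: LIMSEQ_const_iff)
  moreover have eq: "(indicator torus_cell x *\<^sub>R f x) * indicator (box a b) x = indicator (box a b) x *\<^sub>R f x" for x
  proof -
    have "x \<in> torus_cell" if "x \<in> box a b"
      unfolding torus_cell_def mem_box_cart
    proof
      fix i
      have "a $ i < x $ i" "x $ i < b $ i" using that by (simp_all add: mem_box_cart)
      then show "0 $ i \<le> x $ i \<and> x $ i \<le> torus_corner $ i" using assms(1,3)[of i] by simp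
    qed
    then show ?thesis by (auto simp: indicator_def)
  qed
  ultimately show ?thesis unfolding set_lebesgue_integral_def eq by blast
qed

text \<open>Boxes form an intersection-stable generator, so vanishing integrals pass from boxes to
  Borel sets, then to Lebesgue sets up to null sets, and a density with zero integral over every set
  vanishes almost everywhere.\<close>

theorem fourier_coeff_zero_imp_AE_zero: "AE x in lebesgue. x \<in> torus_cell \<longrightarrow> f x = 0"
proof -
  define C where "C = (box 0 torus_corner :: (real^'d) set)"
  \<comment> \<open>Cutting off to the open cell turns the integral over any box into one over a
    sub-box of the cell, and the total integral, needed for complements, into that over
    \<open>C\<close>. Only the negligible frontier of the cell is lost.\<close>
  define g where "g x = indicator C x *\<^sub>R f x" for x
  have CT: "C \<subseteq> torus_cell" unfolding C_def torus_cell_def by (rule box_subset_cbox)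
  have g: "integrable lebesgue g"
  proof -
    have "set_integrable lebesgue C f" by (rule set_integrable_subset[OF f _ CT]) (simp add: C_def)
    then show ?thesis by (simp add: set_integrable_def g_def[abs_def])
  qed
  have gA: "set_integrable lebesgue A g" if "A \<in> sets lebesgue" for A
    unfolding set_integrable_def by (rule integrable_mult_indicator[OF that g])
  have basic: "(LINT x:box a b|lebesgue. g x) = 0" for a b
  proof -
    define a' where "a' = (\<chi> i. max (a $ i) 0)"
    define b' where "b' = (\<chi> i. min (b $ i) (2 * pi))"
    have int: "box a b \<inter> C = box a' b'"
      unfolding C_def a'_def b'_def set_eq_iff Int_iff mem_box_cart by (simp add: all_conj_distrib conj_ac)
    have "(LINT x:box a b|lebesgue. g x) = (LINT x:box a' b'|lebesgue. f x)"
      unfolding set_lebesgue_integral_def g_def int[symmetric] by (simp only: indicator_inter_arith scaleR_scaleR)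
    also have "\<dots> = 0"
    proof (cases "\<forall>i. a' $ i \<le> b' $ i")
      case True
      show ?thesis
      proof (rule integral_subbox_eq_0)
        show "a' $ i \<le> b' $ i" for i using True by blast
      qed (simp_all add: a'_def b'_def)
    next
      case False
      then obtain i where "b' $ i < a' $ i" by (auto simp: not_le)
      then have "box a' b' = {}" unfolding interval_eq_empty_cart by (intro exI[of _ i]) simp
      then show ?thesis by (simp add: set_lebesgue_integral_def)
    qed
    finally show ?thesis .
  qed
  let ?G = "range (\<lambda>(a, b). box a b) :: (real^'d) set set"
  have borel_sets: "sets borel = sigma_sets UNIV ?G"
    unfolding borel_eq_box by (rule sets_measure_of) simp
  have lebesgue_sets: "B \<in> sets lebesgue" if "B \<in> sigma_sets UNIV ?G" for B
    using that unfolding borel_sets[symmetric] by simp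
  have stable: "Int_stable ?G"
  proof (rule Int_stableI)
    fix A B :: "(real^'d) set" assume "A \<in> ?G" "B \<in> ?G"
    then obtain a b c d where AB: "A = box a b" "B = box c d" by (elim rangeE) (simp add: case_prod_beta)
    show "A \<inter> B \<in> ?G" unfolding AB box_Int_box by (rule range_eqI[of _ _ "(_, _)"]) (simp only: prod.case)
  qed
  have total: "(LINT x:UNIV|lebesgue. g x) = 0"
  proof -
    have "(LINT x:UNIV|lebesgue. g x) = (LINT x:C|lebesgue. g x)"
      unfolding set_lebesgue_integral_def g_def by (rule Bochner_Integration.integral_cong) (auto simp: indicator_def)
    then show ?thesis unfolding C_def by (simp only: basic)
  qed
  have dynkin: "(LINT x:A|lebesgue. g x) = 0" if "A \<in> sigma_sets UNIV ?G" for A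
  proof (rule sigma_sets_induct_disjoint[OF stable _ that, where P = "\<lambda>A. (LINT x:A|lebesgue. g x) = 0"])
    show "?G \<subseteq> Pow UNIV" by simp
    show "(LINT x:A|lebesgue. g x) = 0" if "A \<in> ?G" for A
      using that basic by (elim rangeE) (simp add: case_prod_beta)
    show "(LINT x:{}|lebesgue. g x) = 0" by (simp add: set_lebesgue_integral_def)
    show "(LINT x:UNIV - A|lebesgue. g x) = 0"
      if "A \<in> sigma_sets UNIV ?G" and A0: "(LINT x:A|lebesgue. g x) = 0" for A
    proof -
      have A: "A \<in> sets lebesgue" "UNIV - A \<in> sets lebesgue" using lebesgue_sets[OF that(1)] by auto
      have "(LINT x:A \<union> (UNIV - A)|lebesgue. g x) = (LINT x:A|lebesgue. g x) + (LINT x:UNIV - A|lebesgue. g x)"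
        by (rule set_integral_Un[OF _ gA[OF A(1)] gA[OF A(2)]]) simp
      moreover have "A \<union> (UNIV - A) = UNIV" by simp
      ultimately show ?thesis using total A0 by simp
    qed
    show "(LINT x:(\<Union>i. A i)|lebesgue. g x) = 0"
      if "disjoint_family A" "range A \<subseteq> sigma_sets UNIV ?G" and A0: "\<And>i. (LINT x:A i|lebesgue. g x) = 0" for A :: "nat \<Rightarrow> _"
    proof -
      have A: "A i \<in> sets lebesgue" for i using lebesgue_sets that(2) by blast
      have "(LINT x:(\<Union>i. A i)|lebesgue. g x) = (\<Sum>i. (LINT x:A i|lebesgue. g x))"
      proof (rule lebesgue_integral_countable_add[OF A])
        show "A i \<inter> A j = {}" if "i \<noteq> j" for i j
          using \<open>disjoint_family A\<close> that by (simp add: disjoint_family_on_def)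
        show "set_integrable lebesgue (\<Union>i. A i) g" by (rule gA) (use A in blast)
      qed
      then show ?thesis by (simp add: A0)
    qed
  qed
  have borel: "(LINT x:A|lebesgue. g x) = 0" if "A \<in> sets borel" for A
    by (rule dynkin[OF that[unfolded borel_sets]])
  have "AE x in lebesgue. g x = 0"
  proof (rule sigma_finite_measure.density_zero[OF sigma_finite_measure_lebesgue g])
    fix A :: "(real^'d) set" assume A: "A \<in> sets lebesgue"
    \<comment> \<open>A Lebesgue set is a countable union of closed sets plus a null set, which
      reduces it to the Borel case.\<close>
    then obtain D N where D: "fsigma D" "N \<in> null_sets lebesgue" "D \<union> N = A" "disjnt D N"
      by (rule lebesgue_set_almost_fsigma)
    have Db: "D \<in> sets borel" using D(1) by (cases rule: fsigma.cases) auto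
    have "(LINT x:A|lebesgue. g x) = (LINT x:D|lebesgue. g x)"
    proof (rule set_integral_null_delta[OF g A])
      show "D \<in> sets lebesgue" using Db by simp
      have "(A - D) \<union> (D - A) = N" using D(3,4) by (auto simp: disjnt_def)
      then show "(A - D) \<union> (D - A) \<in> null_sets lebesgue" using D(2) by simp
    qed
    then show "(LINT x:A|lebesgue. g x) = 0" using borel[OF Db] by simp
  qed
  moreover have "AE x in lebesgue. x \<notin> torus_cell - C"
    unfolding torus_cell_def C_def
    by (rule AE_not_in) (rule negligible_frontier_interval[unfolded negligible_iff_null_sets])
  ultimately show ?thesis
  proof eventually_elim
    case (elim x)
    then show ?case by (cases "x \<in> C") (simp_all add: g_def)
  qed
qed

end



section \<open>Fourier coefficients of absolutely convergent series\<close>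

lemma torus_integral_cis:
  "integral torus_cell (\<lambda>x. cis (of_int_vec (n::int^'d) \<bullet> x)) = (if n = 0 then of_real ((2 * pi) ^ CARD('d)) else 0)"
proof (cases "n = 0")
  case True
  have "cbox (0::real^'d) torus_corner \<noteq> {}" by (simp add: interval_eq_empty_cart not_less)
  then have "measure lebesgue (cbox (0::real^'d) torus_corner) = (2 * pi) ^ CARD('d)"
    by (simp add: content_cbox_cart)
  then show ?thesis using True by (simp add: of_int_vec_zero torus_cell_def scaleR_conv_of_real)
next
  case False
  then obtain i where i: "n $ i \<noteq> 0" by (auto simp: vec_eq_iff)
  have "integral torus_cell (\<lambda>x. \<i> * of_int (n $ i) * cis (of_int_vec n \<bullet> x)) = 0"
  proof (rule torus_integral_derivative[where g = "\<lambda>x. cis (of_int_vec n \<bullet> x)" and i = i])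
    show "torus_periodic (\<lambda>x. cis (of_int_vec n \<bullet> x))" by (simp add: torus_periodic_def cis_add_period)
    show "((\<lambda>s. cis (of_int_vec n \<bullet> (x + s *\<^sub>R axis i 1))) has_vector_derivative
        \<i> * of_int (n $ i) * cis (of_int_vec n \<bullet> x)) (at 0)" for x
      using cis_line_has_vector_derivative[of "of_int_vec n \<bullet> x" "of_int (n $ i)" 0 UNIV]
      by (simp add: inner_add_right inner_axis of_int_vec_nth)
  qed (intro continuous_intros)+
  then have "\<i> * of_int (n $ i) * integral torus_cell (\<lambda>x. cis (of_int_vec n \<bullet> x)) = 0"
    by (simp only: Henstock_Kurzweil_Integration.integral_mult_right)
  then show ?thesis using False i by simp
qed

lemma torus_cell_integral:
  fixes f :: "real^'d \<Rightarrow> 'b::euclidean_space"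
  assumes "continuous_on UNIV f"
  shows "set_integrable lebesgue torus_cell f" "(LINT x:torus_cell|lebesgue. f x) = integral torus_cell f"
proof -
  show "set_integrable lebesgue torus_cell f" unfolding torus_cell_def
    by (rule absolutely_integrable_continuous[OF continuous_on_subset[OF assms]]) simp
  then show "(LINT x:torus_cell|lebesgue. f x) = integral torus_cell f"
    by (rule set_lebesgue_integral_eq_integral(2))
qed

text \<open>Uniform convergence permits integration of the partial sums, and orthogonality makes
  their integrals constant once the index set contains \<open>n\<close>. Since
  \<open>fourier_coeff\<close> takes real functions, reality of \<open>F\<close> lets the series
  replace its real part under the integral.\<close>

lemma fourier_coeff_series:
  fixes c :: "int^'d \<Rightarrow> complex"
  defines "F \<equiv> \<lambda>x. \<Sum>\<^sub>\<infinity>k. c k * cis (of_int_vec k \<bullet> x)"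
  assumes c: "(\<lambda>k. norm (c k)) summable_on UNIV" and real: "\<And>x. F x \<in> \<real>"
  shows "continuous_on UNIV F" "fourier_coeff (\<lambda>x. Re (F x)) n = c n"
proof -
  show cont: "continuous_on UNIV F"
    unfolding F_def by (rule continuous_on_infsum[OF _ _ c]) (auto simp: norm_mult intro!: continuous_intros)
  define I where "I X = (\<Sum>k\<in>X. if k = n then c n * of_real ((2 * pi) ^ CARD('d)) else 0)" for X
  have shift: "c k * cis (of_int_vec k \<bullet> x) * cis (- (of_int_vec n \<bullet> x)) = c k * cis (of_int_vec (k - n) \<bullet> x)" for k x
    by (simp add: cis_mult of_int_vec_diff inner_diff_left)
  have lim: "uniform_limit (cbox 0 torus_corner) (\<lambda>X x. \<Sum>k\<in>X. c k * cis (of_int_vec (k - n) \<bullet> x))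
      (\<lambda>x. \<Sum>\<^sub>\<infinity>k. c k * cis (of_int_vec (k - n) \<bullet> x)) (finite_subsets_at_top UNIV)"
    by (rule Weierstrass_m_test_general[OF _ c]) (simp add: norm_mult)
  obtain J K where JK: "\<And>X. ((\<lambda>x. \<Sum>k\<in>X. c k * cis (of_int_vec (k - n) \<bullet> x)) has_integral J X) (cbox 0 torus_corner)"
      "((\<lambda>x. \<Sum>\<^sub>\<infinity>k. c k * cis (of_int_vec (k - n) \<bullet> x)) has_integral K) (cbox 0 torus_corner)"
      "(J \<longlongrightarrow> K) (finite_subsets_at_top UNIV)"
    by (rule uniform_limit_integral_cbox[OF lim]) (auto intro!: continuous_intros that)
  have "J X = I X" if "finite X" for X
  proof -
    have "J X = integral torus_cell (\<lambda>x. \<Sum>k\<in>X. c k * cis (of_int_vec (k - n) \<bullet> x))"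
      using JK(1)[of X] by (simp add: torus_cell_def integral_unique)
    also have "\<dots> = (\<Sum>k\<in>X. integral torus_cell (\<lambda>x. c k * cis (of_int_vec (k - n) \<bullet> x)))"
      unfolding torus_cell_def
      by (rule integral_sum[OF that]) (intro integrable_continuous continuous_intros)
    also have "\<dots> = I X" unfolding I_def
      by (rule sum.cong) (auto simp: torus_integral_cis)
    finally show ?thesis .
  qed
  moreover have "I X = c n * of_real ((2 * pi) ^ CARD('d))" if "finite X" "n \<in> X" for X
    using that by (simp add: I_def)
  ultimately have "J X = c n * of_real ((2 * pi) ^ CARD('d))" if "finite X" "{n} \<subseteq> X" for X
    using that by simp
  then have "\<forall>\<^sub>F X in finite_subsets_at_top UNIV. J X = c n * of_real ((2 * pi) ^ CARD('d))"
    unfolding eventually_finite_subsets_at_top by (intro exI[of _ "{n}"]) simp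
  then have "(J \<longlongrightarrow> c n * of_real ((2 * pi) ^ CARD('d))) (finite_subsets_at_top UNIV)"
    by (rule tendsto_eventually)
  then have K: "K = c n * of_real ((2 * pi) ^ CARD('d))" using JK(3) by (intro tendsto_unique) auto
  have "Re (F x) *\<^sub>R cis (- (of_int_vec n \<bullet> x)) = (\<Sum>\<^sub>\<infinity>k. c k * cis (of_int_vec (k - n) \<bullet> x))" for x
  proof -
    have "Re (F x) *\<^sub>R cis (- (of_int_vec n \<bullet> x)) = F x * cis (- (of_int_vec n \<bullet> x))"
      using real[of x] by (simp add: scaleR_conv_of_real)
    also have "\<dots> = (\<Sum>\<^sub>\<infinity>k. c k * cis (of_int_vec k \<bullet> x) * cis (- (of_int_vec n \<bullet> x)))"
      unfolding F_def by (rule infsum_cmult_left'[symmetric])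
    finally show ?thesis by (simp only: shift)
  qed
  moreover have "(LINT x:torus_cell|lebesgue. Re (F x) *\<^sub>R cis (- (of_int_vec n \<bullet> x))) =
      integral torus_cell (\<lambda>x. Re (F x) *\<^sub>R cis (- (of_int_vec n \<bullet> x)))"
    by (rule torus_cell_integral) (intro continuous_intros cont)
  ultimately have "(LINT x:torus_cell|lebesgue. Re (F x) *\<^sub>R cis (- (of_int_vec n \<bullet> x))) = K"
    using JK(2) by (simp add: torus_cell_def integral_unique)
  then show "fourier_coeff (\<lambda>x. Re (F x)) n = c n"
    by (simp add: fourier_coeff_def K)
qed

lemma fourier_coeff_diff:
  assumes "set_integrable lebesgue torus_cell f" "set_integrable lebesgue torus_cell g"
  shows "fourier_coeff (\<lambda>x. f x - g x) n = fourier_coeff f n - fourier_coeff g n"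
proof -
  have i: "set_integrable lebesgue torus_cell (\<lambda>x. h x *\<^sub>R cis (- (of_int_vec n \<bullet> x)))"
    if "set_integrable lebesgue torus_cell h" for h
    by (rule set_integrable_bounded_mult[OF that, of _ 1]) (auto intro!: continuous_intros)
  show ?thesis
    using set_integral_diff(2)[OF i[OF assms(1)] i[OF assms(2)]]
    by (simp add: fourier_coeff_def scaleR_diff_left diff_divide_distrib)
qed

lemma fourier_coeff_uminus: "fourier_coeff f (- n) = cnj (fourier_coeff f n)"
proof -
  have "(LINT x:torus_cell|lebesgue. f x *\<^sub>R cis (- (of_int_vec (- n) \<bullet> x))) =
      cnj (LINT x:torus_cell|lebesgue. f x *\<^sub>R cis (- (of_int_vec n \<bullet> x)))"
    unfolding set_lebesgue_integral_def Bochner_Integration.integral_cnj[symmetric]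
    by (simp add: of_int_vec_uminus cis_cnj)
  then show ?thesis by (simp add: fourier_coeff_def)
qed

text \<open>The cell has finite measure, and \<open>\<bar>y\<bar> \<le> 1 + y^2\<close>.\<close>

lemma L2_on_component_integrable:
  fixes f :: "real^'d \<Rightarrow> real^'n"
  assumes "L2_on torus_cell f"
  shows "set_integrable lebesgue torus_cell (\<lambda>x. f x $ j)"
  unfolding set_integrable_def
proof (rule Bochner_Integration.integrable_bound)
  have "set_integrable lebesgue torus_cell (\<lambda>x::real^'d. 1::real)"
    by (rule torus_cell_integral) simp
  then show "integrable lebesgue (\<lambda>x. indicator torus_cell x *\<^sub>R (1 + (norm (f x))\<^sup>2))"
    using assms set_integral_add(1) unfolding L2_on_def set_integrable_def[symmetric] by blast
  have [measurable]: "(\<lambda>x. indicator torus_cell x *\<^sub>R f x) \<in> borel_measurable lebesgue"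
    using assms by (simp add: L2_on_def set_borel_measurable_def)
  have "(\<lambda>x. (indicator torus_cell x *\<^sub>R f x) \<bullet> axis j 1) \<in> borel_measurable lebesgue" by measurable
  then show "(\<lambda>x. indicator torus_cell x *\<^sub>R (f x $ j)) \<in> borel_measurable lebesgue"
    by (simp add: inner_axis)
  have "\<bar>f x $ j\<bar> \<le> 1 + (norm (f x))\<^sup>2" for x
  proof -
    have "\<bar>f x $ j\<bar> \<le> norm (f x)" by (rule component_le_norm_cart)
    moreover have "0 \<le> (norm (f x) - 1)\<^sup>2" "0 \<le> (norm (f x))\<^sup>2" by simp_all
    ultimately show ?thesis by (simp add: power2_diff)
  qed
  then show "AE x in lebesgue. norm (indicator torus_cell x *\<^sub>R (f x $ j)) \<le>
      norm (indicator torus_cell x *\<^sub>R (1 + (norm (f x))\<^sup>2))"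
    by (intro AE_I2) (auto simp: indicator_def intro: order_trans)
qed

section \<open>From the period cell to the whole space\<close>

lemma torus_periodic_int:
  assumes "torus_periodic f"
  shows "f (x + (2 * pi) *\<^sub>R of_int_vec z) = f (x::real^'d)"
proof -
  have nat: "f (x + axis i (2 * pi * real k)) = f x" for x i k
  proof (induction k)
    case 0
    have "axis i (2 * pi * real 0) = 0" by (simp add: axis_def vec_eq_iff)
    then show ?case by (simp only: add_0_right)
  next
    case (Suc k)
    have "x + axis i (2 * pi * real (Suc k)) = (x + axis i (2 * pi * real k)) + axis i (2 * pi)"
      by (simp add: axis_def vec_eq_iff algebra_simps)
    moreover have "f ((x + axis i (2 * pi * real k)) + axis i (2 * pi)) = f (x + axis i (2 * pi * real k))"
      using assms unfolding torus_periodic_def by blast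
    ultimately show ?case using Suc by (simp only:)
  qed
  have int: "f (x + axis i (2 * pi * of_int k)) = f x" for x i k
  proof (cases "0 \<le> k")
    case True
    then show ?thesis using nat[of x i "nat k"] by simp
  next
    case False
    have eq: "(x + axis i (2 * pi * of_int k)) + axis i (2 * pi * real (nat (- k))) = x"
      using False by (simp add: axis_def vec_eq_iff)
    show ?thesis using nat[of "x + axis i (2 * pi * of_int k)" i "nat (- k)"] unfolding eq by simp
  qed
  have "f (x + (\<Sum>i\<in>I. axis i (2 * pi * of_int (z $ i)))) = f x" if "finite I" for I
    using that
  proof (induction I rule: finite_induct)
    case (insert i I)
    have "x + (\<Sum>i\<in>insert i I. axis i (2 * pi * of_int (z $ i))) =
        (x + (\<Sum>i\<in>I. axis i (2 * pi * of_int (z $ i)))) + axis i (2 * pi * of_int (z $ i))"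
      using insert.hyps by (simp add: add_ac)
    then show ?case by (simp only: int insert.IH)
  qed simp
  moreover have "(\<Sum>i\<in>UNIV. axis i (2 * pi * of_int (z $ i))) = (2 * pi) *\<^sub>R of_int_vec z"
    by (simp add: vec_eq_iff sum_component axis_def of_int_vec_def if_distrib[of "\<lambda>u. u = _"] cong: if_cong)
  ultimately show ?thesis by (metis finite)
qed

text \<open>Any point of disagreement is moved into the cell by a lattice vector, so the bad set
  lies in a countable union of translates of a null set.\<close>

lemma AE_torus_periodic_eq:
  fixes v w :: "real^'d \<Rightarrow> 'b"
  assumes per: "torus_periodic v" "torus_periodic w"
    and ae: "AE x in lebesgue. x \<in> torus_cell \<longrightarrow> v x = w x"
  shows "AE x in lebesgue. v x = w x"
proof -
  define N where "N = {x. \<not> (x \<in> torus_cell \<longrightarrow> v x = w x)}"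
  have "N \<in> null_sets lebesgue"
    using ae unfolding N_def by (simp add: completion.AE_iff_null_sets)
  then have N: "negligible N" by (simp add: negligible_iff_null_sets)
  have "negligible (\<Union>z::int^'d. (+) ((2 * pi) *\<^sub>R of_int_vec z) ` N)"
    by (intro negligible_countable_Union) (auto intro: negligible_translation N)
  moreover have "{x. v x \<noteq> w x} \<subseteq> (\<Union>z::int^'d. (+) ((2 * pi) *\<^sub>R of_int_vec z) ` N)"
  proof
    fix x assume x: "x \<in> {x. v x \<noteq> w x}"
    define z where "z = (\<chi> i. \<lfloor>x $ i / (2 * pi)\<rfloor>)"
    define y where "y = x - (2 * pi) *\<^sub>R of_int_vec z"
    have xy: "x = y + (2 * pi) *\<^sub>R of_int_vec z" by (simp add: y_def)
    have "0 \<le> y $ i \<and> y $ i \<le> 2 * pi" for i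
    proof -
      define r where "r = x $ i / (2 * pi)"
      have "y $ i = 2 * pi * (r - of_int \<lfloor>r\<rfloor>)"
        by (simp add: y_def z_def of_int_vec_def r_def right_diff_distrib)
      moreover have "0 \<le> r - of_int \<lfloor>r\<rfloor>" "r - of_int \<lfloor>r\<rfloor> \<le> 1" by linarith+
      ultimately show ?thesis by (simp add: mult_left_le)
    qed
    then have "y \<in> torus_cell" by (simp add: torus_cell_def mem_box_cart)
    moreover have "v y \<noteq> w y" using x torus_periodic_int[OF per(1), of y z] torus_periodic_int[OF per(2), of y z] xy by simp
    ultimately have "y \<in> N" by (simp add: N_def)
    moreover have "x = (2 * pi) *\<^sub>R of_int_vec z + y" by (simp add: y_def)
    ultimately show "x \<in> (\<Union>z::int^'d. (+) ((2 * pi) *\<^sub>R of_int_vec z) ` N)" by blast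
  qed
  ultimately have "negligible {x. v x \<noteq> w x}" by (rule negligible_subset)
  then show ?thesis by (simp add: completion.AE_iff_null_sets negligible_iff_null_sets)
qed

section \<open>Sobolev regularity and summability of Fourier coefficients\<close>

lemma summable_int_powr:
  fixes \<sigma> :: real
  assumes "\<sigma> > 1 / 2"
  shows "(\<lambda>k::int. (1 + (of_int k)\<^sup>2) powr (- \<sigma>)) summable_on UNIV"
proof -
  let ?f = "\<lambda>k::int. (1 + (of_int k)\<^sup>2 :: real) powr (- \<sigma>)"
  have "summable (\<lambda>n. ?f (int n))"
  proof (rule summable_comparison_test_ev)
    show "summable (\<lambda>n. real n powr (- 2 * \<sigma>))" using assms by (simp add: summable_real_powr_iff)
    show "\<forall>\<^sub>F n in sequentially. norm (?f (int n)) \<le> real n powr (- 2 * \<sigma>)"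
      using eventually_gt_at_top[of 0]
    proof eventually_elim
      case (elim n)
      have "?f (int n) \<le> ((real n)\<^sup>2) powr (- \<sigma>)"
        using elim assms by (intro powr_mono2') auto
      also have "(real n)\<^sup>2 = real n powr 2" using elim by simp
      also have "(real n powr 2) powr (- \<sigma>) = real n powr (- 2 * \<sigma>)" by (simp only: powr_powr) simp
      finally show ?case by simp
    qed
  qed
  then have N: "(\<lambda>n. ?f (int n)) summable_on UNIV"
    by (rule summable_nonneg_imp_summable_on) simp
  have "?f summable_on range int"
    using N by (subst summable_on_reindex) (auto simp: o_def inj_on_def)
  moreover have "?f summable_on range (\<lambda>n. - int n)"
    using N by (subst summable_on_reindex) (auto simp: o_def inj_on_def)
  ultimately have "?f summable_on (range int \<union> range (\<lambda>n. - int n))" by (rule summable_on_union)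
  moreover have "range int \<union> range (\<lambda>n. - int n) = UNIV"
  proof -
    have "k \<in> range int \<union> range (\<lambda>n. - int n)" for k by (cases k rule: int_cases2) auto
    then show ?thesis by blast
  qed
  ultimately show ?thesis by simp
qed

text \<open>A finite set of vectors sits in a finite cube \<open>B^d\<close>, over which the sum of
  products is a product of one-dimensional sums, each bounded by the full sum.\<close>

lemma summable_on_vec_prod:
  fixes f :: "'a \<Rightarrow> real"
  assumes f: "f summable_on UNIV" and nonneg: "\<And>k. 0 \<le> f k"
  shows "(\<lambda>n::'a^'d. \<Prod>i\<in>UNIV. f (n $ i)) summable_on UNIV"
proof (rule nonneg_bdd_above_summable_on)
  show "bdd_above (sum (\<lambda>n::'a^'d. \<Prod>i\<in>UNIV. f (n $ i)) ` {F. F \<subseteq> UNIV \<and> finite F})"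
  proof (rule bdd_aboveI2)
    fix F :: "('a^'d) set" assume "F \<in> {F. F \<subseteq> UNIV \<and> finite F}"
    then have F: "finite F" by simp
    define B where "B = (\<Union>n\<in>F. range (vec_nth n))"
    have B: "finite B" using F by (simp add: B_def)
    have "(\<Sum>n\<in>F. \<Prod>i\<in>UNIV. f (n $ i)) = (\<Sum>\<phi>\<in>vec_nth ` F. \<Prod>i\<in>UNIV. f (\<phi> i))"
      by (subst sum.reindex) (auto simp: inj_on_def vec_nth_inject)
    also have "\<dots> \<le> (\<Sum>\<phi>\<in>PiE (UNIV::'d set) (\<lambda>_. B). \<Prod>i\<in>UNIV. f (\<phi> i))"
      by (rule sum_mono2) (use B nonneg in \<open>auto simp: B_def intro!: finite_PiE prod_nonneg\<close>)
    also have "\<dots> = (\<Prod>i\<in>(UNIV::'d set). \<Sum>k\<in>B. f k)"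
      by (rule prod_sum_PiE[symmetric]) (use B in auto)
    also have "\<dots> \<le> (\<Prod>i\<in>(UNIV::'d set). infsum f UNIV)"
      by (intro prod_mono conjI sum_nonneg nonneg finite_sum_le_infsum f B) auto
    finally show "(\<Sum>n\<in>F. \<Prod>i\<in>UNIV. f (n $ i)) \<le> (\<Prod>i\<in>(UNIV::'d set). infsum f UNIV)" .
  qed
qed (auto intro!: prod_nonneg nonneg)

text \<open>The power is split into \<open>d\<close> equal factors and \<open>|n|\<close> is
  replaced by \<open>|n_i|\<close> in the \<open>i\<close>-th. The hypothesis on
  \<open>\<sigma>\<close> is exactly the one-dimensional condition
  \<open>\<sigma> / d > 1 / 2\<close>.\<close>

lemma summable_lattice_powr:
  assumes "\<sigma> > real CARD('d) / 2"
  shows "(\<lambda>n::int^'d. (1 + (norm (of_int_vec n))\<^sup>2) powr (- \<sigma>)) summable_on UNIV"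
proof -
  define d where "d = real CARD('d)"
  have d: "d > 0" by (simp add: d_def)
  have s: "\<sigma> / d > 1 / 2" using assms d by (simp add: d_def field_simps)
  have sum: "(\<lambda>n::int^'d. \<Prod>i\<in>UNIV. (1 + (of_int (n $ i))\<^sup>2) powr (- (\<sigma> / d))) summable_on UNIV"
    by (rule summable_on_vec_prod[OF summable_int_powr[OF s]]) simp
  show ?thesis
  proof (rule summable_on_comparison_test[OF sum])
    fix n :: "int^'d"
    let ?y = "1 + (norm (of_int_vec n))\<^sup>2"
    have "?y powr (- \<sigma>) = (?y powr (- (\<sigma> / d))) powr d" using d by (simp add: powr_powr)
    also have "\<dots> = (\<Prod>i\<in>(UNIV::'d set). ?y powr (- (\<sigma> / d)))"
      by (simp add: d_def powr_realpow add_pos_nonneg less_imp_neq[THEN not_sym])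
    also have "\<dots> \<le> (\<Prod>i\<in>UNIV. (1 + (of_int (n $ i))\<^sup>2) powr (- (\<sigma> / d)))"
    proof (intro prod_mono conjI powr_ge_zero powr_mono2')
      fix i
      have "\<bar>of_int (n $ i)\<bar> \<le> norm (of_int_vec n)"
        using component_le_norm_cart[of "of_int_vec n" i] by (simp add: of_int_vec_nth)
      then have "\<bar>of_int (n $ i)\<bar>\<^sup>2 \<le> (norm (of_int_vec n))\<^sup>2" by (intro power_mono) auto
      then show "1 + (of_int (n $ i))\<^sup>2 \<le> ?y" by simp
      show "0 < 1 + (real_of_int (n $ i))\<^sup>2" by (simp add: add_pos_nonneg)
      show "- (\<sigma> / d) \<le> 0" using s by linarith
    qed
    finally show "?y powr (- \<sigma>) \<le> (\<Prod>i\<in>UNIV. (1 + (of_int (n $ i))\<^sup>2) powr (- (\<sigma> / d)))" .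
  qed simp
qed

text \<open>Only summability is asked for, so the Cauchy-Schwarz inequality appears as
  \<open>b * e \<le> b^2 + e^2\<close>, with \<open>b\<close> the Sobolev-weighted coefficient and
  \<open>e\<close> the remaining power of \<open>y\<close>. The even exponent \<open>2 * s\<close>
  allows \<open>wt n ^ 2 \<le> 2 * y\<close> to be used without roots.\<close>

lemma sobolev_coeff_summable:
  fixes c :: "int^'d \<Rightarrow> complex"
  assumes c: "(\<lambda>n. (1 + (norm (of_int_vec n))\<^sup>2) powr m * (cmod (c n))\<^sup>2) summable_on UNIV"
    and m: "m > real CARD('d) / 2 + 2 * real s"
  shows "(\<lambda>n. wt n ^ (2 * s) * cmod (c n)) summable_on UNIV"
proof -
  have "(\<lambda>n::int^'d. (1 + (norm (of_int_vec n))\<^sup>2) powr (- (m - 2 * real s))) summable_on UNIV"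
    by (rule summable_lattice_powr) (use m in simp)
  then have sum: "(\<lambda>n. 2 ^ s * ((1 + (norm (of_int_vec n))\<^sup>2) powr m * (cmod (c n))\<^sup>2 +
      (1 + (norm (of_int_vec n))\<^sup>2) powr (- (m - 2 * real s)))) summable_on UNIV"
    by (intro summable_on_cmult_right summable_on_add c)
  show ?thesis
  proof (rule summable_on_comparison_test[OF sum])
    fix n :: "int^'d"
    define x where "x = norm (of_int_vec n)"
    define y where "y = 1 + x\<^sup>2"
    define b where "b = y powr (m / 2) * cmod (c n)"
    define e where "e = y powr (real s - m / 2)"
    have y: "y > 0" by (simp add: y_def add_pos_nonneg)
    have "wt n ^ 2 \<le> 2 * y"
      using zero_le_power2[of "x - 1"] by (simp add: wt_def x_def[symmetric] y_def power2_sum power2_diff)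
    then have "(wt n ^ 2) ^ s \<le> (2 * y) ^ s" by (rule power_mono) simp
    then have "wt n ^ (2 * s) * cmod (c n) \<le> 2 ^ s * (y ^ s * cmod (c n))"
      by (simp add: power_mult power_mult_distrib mult_right_mono flip: mult.assoc)
    also have "y ^ s * cmod (c n) = b * e"
    proof -
      have "y powr (m / 2) * y powr (real s - m / 2) = y ^ s"
        using y by (simp add: powr_add[symmetric] powr_realpow)
      then show ?thesis by (simp add: b_def e_def mult_ac)
    qed
    also have "b * e \<le> b\<^sup>2 + e\<^sup>2"
    proof -
      have "0 \<le> (b - e)\<^sup>2" "0 \<le> b\<^sup>2" "0 \<le> e\<^sup>2" by simp_all
      then show ?thesis unfolding power2_diff by linarith
    qed
    also have "b\<^sup>2 = y powr m * (cmod (c n))\<^sup>2"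
      using y by (simp add: b_def power_mult_distrib powr_power)
    also have "e\<^sup>2 = y powr (- (m - 2 * real s))"
      using y by (simp add: e_def powr_power algebra_simps)
    finally show "wt n ^ (2 * s) * cmod (c n) \<le> 2 ^ s * ((1 + (norm (of_int_vec n))\<^sup>2) powr m * (cmod (c n))\<^sup>2 +
        (1 + (norm (of_int_vec n))\<^sup>2) powr (- (m - 2 * real s)))"
      by (simp add: y_def x_def)
  qed (simp add: wt_nonneg)
qed

section \<open>The Kuramoto-Sivashinsky equation\<close>

text \<open>Each component of the difference is integrable on the cell with vanishing Fourier
  coefficients, hence null there, and periodicity spreads this over the whole space.\<close>

lemma field_initial_value:
  fixes u0 :: "real^'d \<Rightarrow> real^'d" and u :: "'d \<Rightarrow> int^'d \<Rightarrow> real \<Rightarrow> complex"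
  assumes per: "torus_periodic u0" and L2: "L2_on torus_cell u0" and T: "0 < T"
    and w: "\<And>j. wiener 0 T (u j)" and init: "\<And>j n. u j n 0 = fourier_coeff (\<lambda>x. u0 x $ j) n"
  shows "AE x in lebesgue. fourier_field u (x, 0) = u0 x"
proof -
  have comp: "AE x in lebesgue. x \<in> torus_cell \<longrightarrow> fourier_field u (x, 0) $ j = u0 x $ j" for j
  proof -
    define F where "F x = (\<Sum>\<^sub>\<infinity>k. u j k 0 * cis (of_int_vec k \<bullet> x))" for x
    have fld: "fourier_field u (x, 0) $ j = Re (F x)" for x by (simp add: fourier_field_def fser_def F_def)
    have real: "F x \<in> \<real>" for x
      using fser_real[of "u j" "(x, 0)"] by (simp add: init fourier_coeff_uminus fser_def F_def)
    have summ: "(\<lambda>k. norm (u j k 0)) summable_on UNIV"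
      using fser_summable[OF w, of "(0, 0)" j] T by (simp add: norm_mult)
    note F = fourier_coeff_series[OF summ, folded F_def, OF real]
    have fi: "set_integrable lebesgue torus_cell (\<lambda>x. Re (F x))"
      by (rule torus_cell_integral) (intro continuous_intros F(1))
    note ui = L2_on_component_integrable[OF L2, of j]
    have "AE x in lebesgue. x \<in> torus_cell \<longrightarrow> Re (F x) - u0 x $ j = 0"
    proof (rule fourier_coeff_zero_imp_AE_zero)
      show "set_integrable lebesgue torus_cell (\<lambda>x. Re (F x) - u0 x $ j)" by (rule set_integral_diff(1)[OF fi ui])
      show "fourier_coeff (\<lambda>x. Re (F x) - u0 x $ j) n = 0" for n
        by (simp add: fourier_coeff_diff[OF fi ui] F(2) init)
    qed
    then show ?thesis by (simp add: fld)
  qed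
  have "AE x in lebesgue. \<forall>j\<in>(UNIV::'d set). x \<in> torus_cell \<longrightarrow> fourier_field u (x, 0) $ j = u0 x $ j"
    by (rule AE_finite_allI) (use comp in auto)
  then have "AE x in lebesgue. x \<in> torus_cell \<longrightarrow> fourier_field u (x, 0) = u0 x"
    by eventually_elim (simp add: vec_eq_iff)
  then show ?thesis by (rule AE_torus_periodic_eq[OF torus_periodic_field per])
qed

theorem corollary2p3:
  fixes u0 :: "real^'d \<Rightarrow> real^'d" and lam m :: real and k :: nat
  assumes "CARD('d) \<in> {2, 3}"
    and "lam > 0"
    and "k \<ge> 1"
    and "m > real CARD('d) / 2 + 4 * real k"
    and "sobolev_torus m u0"
  shows "\<exists>T>0. \<exists>u :: (real^'d) \<times> real \<Rightarrow> real^'d.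
           KS_classical_solution lam T u \<and>
           sobolev_spacetime k T u \<and>
           (AE x in lebesgue. u (x, 0) = u0 x)"
proof -
  define c0 where "c0 j = fourier_coeff (\<lambda>x. u0 x $ j)" for j
  have u0: "torus_periodic u0" "L2_on torus_cell u0"
    "\<And>j. (\<lambda>n. (1 + (norm (of_int_vec n))\<^sup>2) powr m * (cmod (c0 j n))\<^sup>2) summable_on UNIV"
    using assms(5) by (auto simp: sobolev_torus_def c0_def)
  have "(\<lambda>n. wt n ^ (2 * (2 * k)) * cmod (c0 j n)) summable_on UNIV" for j
    by (rule sobolev_coeff_summable[OF u0(3)]) (use assms(4) in simp)
  \<comment> \<open>The fixed point argument needs an exponent of the form \<open>Suc s\<close>, as
    the advection term lives one order lower; \<open>k \<ge> 1\<close> provides it.\<close>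
  then have summ: "(\<lambda>n. wt n ^ Suc (4 * k - 1) * cmod (c0 j n)) summable_on UNIV" for j
    using assms(3) by simp
  have herm: "c0 j (- n) = cnj (c0 j n)" for j n by (simp add: c0_def fourier_coeff_uminus)
  obtain T R u where T: "0 < T" and uR: "\<And>j. majorized (Suc (4 * k - 1)) T R (u j)"
    and uc: "\<And>j n. continuous_on {0..T} (u j n)"
    and uh: "\<And>j n t. t \<in> {0..T} \<Longrightarrow> u j (- n) t = cnj (u j n t)"
    and up: "\<And>j n t. t \<in> {0..T} \<Longrightarrow> u j n t = picard lam c0 u j n t"
    by (rule mild_solution_exists[OF summ herm, of lam]) (rule that)
  have sol: "mild_solution lam T c0 u" using up by (simp add: mild_solution_def)
  have w: "wiener (4 * k) T (u j)" for j
    using uR[of j] uc assms(3) by (auto simp: wiener_def)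
  \<comment> \<open>With \<open>k \<ge> 1\<close> the weight \<open>4 * k\<close> covers the four
    spatial derivatives of the equation.\<close>
  have w4: "wiener 4 T (u j)" and w0: "wiener 0 T (u j)" for j
    using wiener_mono[OF w] assms(3) by simp_all
  \<comment> \<open>At time 0 the Duhamel integral runs over a single point and vanishes.\<close>
  have init: "u j n 0 = fourier_coeff (\<lambda>x. u0 x $ j) n" for j n
    using up[of 0 j n] T by (simp add: picard_def heat_def duhamel_def c0_def)
  show ?thesis
  proof (intro exI conjI)
    show "0 < T" by (rule T)
    show "KS_classical_solution lam T (fourier_field u)" by (rule mild_solution_classical[OF T w4 sol uh])
    show "sobolev_spacetime k T (fourier_field u)"
      by (rule creg_sobolev_spacetime[OF T creg_field]) (rule mild_solution_smooth[OF sol w order_refl])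
    show "AE x in lebesgue. fourier_field u (x, 0) = u0 x" by (rule field_initial_value[OF u0(1,2) T w0 init])
  qed
qed

end
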